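(* Let $X$ be a finite connected CW complex of dimension $d\ge 1$ and let $r\colon X_d\to\mathbb{R}_{+}$, $b\mapsto r_b$, be a positive function on the set of $d$-cells. Let $\mathcal{L}^R\colon B_{d-1}(X;\mathbb{R})\to B_{d-1}(X;\mathbb{R})$ be the (invertible) restriction of $\partial\partial_R^*$ to $B_{d-1}(X;\mathbb{R})$. Then $$\det\mathcal{L}^R=\gamma_X\sum_T w_T,$$ where the sum is indexed over all spanning trees $T$ of $X$, and the normalizing factor is $$\gamma_X=\frac{\mu_X}{\theta_X^2},$$ where $\mu_X\in\mathbb{N}$ is the square of the covolume of the lattice $B_{d-1}(X;\mathbb{Z})\subset B_{d-1}(X;\mathbb{R})$ with respect to the restriction of the standard inner product of $C_{d-1}(X;\mathbb{R})$, and $\theta_X$ is the order of the torsion subgroup of $H_{d-1}(X;\mathbb{Z})$.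
   Context: Notation. $X_k$ is the set of $k$-cells of $X$, $X^{(k)}$ its $k$-skeleton, $C_k(X;A)$ the cellular chain group (free $A$-module on $X_k$), $\partial$ the cellular boundary, $B_k(X;A)$ the $k$-boundaries; all homology is cellular, and $\beta_k$ denotes the $k$-th Betti number. The standard inner product $\langle\ ,\ \rangle$ on $C_k(X;\mathbb{R})$ is the one for which $X_k$ is an orthonormal basis. $R\colon C_d(X;\mathbb{R})\to C_d(X;\mathbb{R})$ is the linear map with $R(b)=r_b b$ for $b\in X_d$, and the modified inner product on $C_d(X;\mathbb{R})$ is $\langle x,y\rangle_R=\langle Rx,y\rangle$. $\partial_R^*\colon C_{d-1}(X;\mathbb{R})\to C_d(X;\mathbb{R})$ is the adjoint of $\partial$ with respect to the standard inner product on $C_{d-1}(X;\mathbb{R})$ and the modified inner product on $C_d(X;\mathbb{R})$. Spanning tree. A spanning tree for $X$ is a subcomplex $T\subset X$ such that $H_d(T;\mathbb{Z})=0$, $\beta_{d-1}(T)=\beta_{d-1}(X)$, and $X^{(d-1)}\subset T$. $T_d$ denotes the set of $d$-cells of $T$. Weights. $\theta_T$ is the order of the torsion subgroup of $H_{d-1}(T;\mathbb{Z})$, and $w_T=\theta_T^2\prod_{b\in T_d} r_b^{-1}$. *)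

theory Defs
  imports
    "HOL-Analysis.Analysis"
    "HOL-Homology.Homology"
    "Jordan_Normal_Form.Determinant"
begin

section \<open>CW complexes\<close>

text \<open>Coordinates follow \<^const>\<open>nsphere\<close>: the boundary of \<open>disc (Suc n)\<close> is
  \<open>topspace (nsphere n)\<close>, and the boundary of the point \<open>disc 0\<close> is empty.\<close>

definition disc :: "nat \<Rightarrow> (nat \<Rightarrow> real) topology" where
  "disc n = subtopology (Euclidean_space n) {x. (\<Sum>i<n. (x i)\<^sup>2) \<le> 1}"

definition open_disc :: "nat \<Rightarrow> (nat \<Rightarrow> real) set" where
  "open_disc n = {x \<in> topspace (disc n). (\<Sum>i<n. (x i)\<^sup>2) < 1}"

definition disc_boundary :: "nat \<Rightarrow> (nat \<Rightarrow> real) set" where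
  "disc_boundary n = {x \<in> topspace (disc n). (\<Sum>i<n. (x i)\<^sup>2) = 1}"

text \<open>\<open>cells\<close> is the set of names of the cells; \<open>cdim\<close> and \<open>chmap\<close> (the characteristic maps)
  are relevant only on \<open>cells\<close>.\<close>

record ('a, 'c) cw =
  cw_space :: "'a topology"
  cells :: "'c set"
  cdim :: "'c \<Rightarrow> nat"
  chmap :: "'c \<Rightarrow> (nat \<Rightarrow> real) \<Rightarrow> 'a"

definition open_cell :: "('a, 'c) cw \<Rightarrow> 'c \<Rightarrow> 'a set" where
  "open_cell X \<sigma> = chmap X \<sigma> ` open_disc (cdim X \<sigma>)"

definition closed_cell :: "('a, 'c) cw \<Rightarrow> 'c \<Rightarrow> 'a set" where
  "closed_cell X \<sigma> = chmap X \<sigma> ` topspace (disc (cdim X \<sigma>))"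

definition cells_of_dim :: "('a, 'c) cw \<Rightarrow> nat \<Rightarrow> 'c set" where
  "cells_of_dim X k = {\<sigma> \<in> cells X. cdim X \<sigma> = k}"

text \<open>The last two clauses are closure-finiteness and the weak topology.\<close>

definition cw_complex :: "('a, 'c) cw \<Rightarrow> bool" where
  "cw_complex X \<longleftrightarrow>
     Hausdorff_space (cw_space X) \<and>
     (\<forall>\<sigma>\<in>cells X. continuous_map (disc (cdim X \<sigma>)) (cw_space X) (chmap X \<sigma>)) \<and>
     (\<forall>\<sigma>\<in>cells X. embedding_map
        (subtopology (disc (cdim X \<sigma>)) (open_disc (cdim X \<sigma>))) (cw_space X) (chmap X \<sigma>)) \<and>
     disjoint_family_on (open_cell X) (cells X) \<and>
     (\<Union>\<sigma>\<in>cells X. open_cell X \<sigma>) = topspace (cw_space X) \<and>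
     (\<forall>\<sigma>\<in>cells X. \<exists>F\<subseteq>cells X. finite F \<and> (\<forall>\<tau>\<in>F. cdim X \<tau> < cdim X \<sigma>) \<and>
        chmap X \<sigma> ` disc_boundary (cdim X \<sigma>) \<subseteq> (\<Union>\<tau>\<in>F. open_cell X \<tau>)) \<and>
     (\<forall>C\<subseteq>topspace (cw_space X).
        (\<forall>\<sigma>\<in>cells X. closedin (cw_space X) (C \<inter> closed_cell X \<sigma>)) \<longrightarrow> closedin (cw_space X) C)"

definition finite_cw_complex :: "('a, 'c) cw \<Rightarrow> bool" where
  "finite_cw_complex X \<longleftrightarrow> cw_complex X \<and> finite (cells X)"

definition has_cw_dim :: "('a, 'c) cw \<Rightarrow> nat \<Rightarrow> bool" where
  "has_cw_dim X d \<longleftrightarrow> (\<forall>\<sigma>\<in>cells X. cdim X \<sigma> \<le> d) \<and> (\<exists>\<sigma>\<in>cells X. cdim X \<sigma> = d)"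

text \<open>A subcomplex is a closed union of open cells; it is determined by its set of cells.\<close>

definition subcomplex :: "('a, 'c) cw \<Rightarrow> 'c set \<Rightarrow> bool" where
  "subcomplex X S \<longleftrightarrow> S \<subseteq> cells X \<and> closedin (cw_space X) (\<Union>\<sigma>\<in>S. open_cell X \<sigma>)"

definition restrict_cw :: "('a, 'c) cw \<Rightarrow> 'c set \<Rightarrow> ('a, 'c) cw" where
  "restrict_cw X S =
     X\<lparr>cw_space := subtopology (cw_space X) (\<Union>\<sigma>\<in>S. open_cell X \<sigma>), cells := S\<rparr>"


section \<open>The cellular chain complex\<close>

text \<open>Base point of the \<open>n\<close>-sphere.\<close>

definition south_pole :: "nat \<Rightarrow> nat \<Rightarrow> real" where
  "south_pole n = (\<lambda>i. if i = n then - 1 else 0)"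

text \<open>\<open>disc_collapse n\<close> maps the disc onto the \<open>n\<close>-sphere: it is a homeomorphism from the open
  disc onto the complement of the south pole, and sends the whole boundary to the south pole.\<close>

definition disc_collapse :: "nat \<Rightarrow> (nat \<Rightarrow> real) \<Rightarrow> nat \<Rightarrow> real" where
  "disc_collapse n x = (let s = (\<Sum>j<n. (x j)\<^sup>2) in
     (\<lambda>i. if i < n then 2 * sqrt (1 - s) * x i else if i = n then 1 - 2 * s else 0))"

text \<open>For an \<open>n\<close>-cell \<open>\<tau>\<close>, the quotient map from the \<open>n\<close>-skeleton \<open>X\<^sup>(\<^sup>n\<^sup>)\<close> to
  \<open>X\<^sup>(\<^sup>n\<^sup>) / (X\<^sup>(\<^sup>n\<^sup>) - e\<^sub>\<tau>)\<close>, the latter being identified with the \<open>n\<close>-sphere by means of the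
  characteristic map of \<open>\<tau>\<close>.\<close>

definition cell_pinch :: "('a, 'c) cw \<Rightarrow> 'c \<Rightarrow> 'a \<Rightarrow> nat \<Rightarrow> real" where
  "cell_pinch X \<tau> y =
     (if y \<in> open_cell X \<tau>
      then disc_collapse (cdim X \<tau>) (inv_into (open_disc (cdim X \<tau>)) (chmap X \<tau>) y)
      else south_pole (cdim X \<tau>))"

text \<open>The cellular boundary formula: the coefficient of \<open>\<tau>\<close> in the boundary of \<open>\<sigma>\<close> is the degree
  of the attaching map of \<open>\<sigma>\<close> followed by the pinch onto \<open>\<tau>\<close>. For a 1-cell this is a
  map of 0-spheres, whose degree in reduced homology is 1, 0 or -1, so the formula gives the
  difference of the two end points.\<close>

definition incidence :: "('a, 'c) cw \<Rightarrow> 'c \<Rightarrow> 'c \<Rightarrow> int" where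
  "incidence X \<sigma> \<tau> =
     (if cdim X \<sigma> = Suc (cdim X \<tau>)
      then Brouwer_degree2 (cdim X \<tau>) (cell_pinch X \<tau> \<circ> chmap X \<sigma>) else 0)"

text \<open>\<open>chains X k\<close> is the free module on the \<open>k\<close>-cells, realised as the functions \<open>'c \<Rightarrow> 'r\<close>
  supported on the \<open>k\<close>-cells. The type \<open>'c\<close> of cell names is finite, so that chains are vectors
  and, for real coefficients, \<open>\<bullet>\<close> is the inner product for which the cells are orthonormal.
  The unused elements of \<open>'c\<close> play no role.\<close>

definition chains :: "('a, 'c::finite) cw \<Rightarrow> nat \<Rightarrow> ('r::comm_ring_1 ^ 'c) set" where
  "chains X k = {x. \<forall>\<sigma>. \<sigma> \<notin> cells_of_dim X k \<longrightarrow> vec_nth x \<sigma> = 0}"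

text \<open>All degrees at once: incidence numbers vanish unless the dimensions differ by one.\<close>

definition boundary_map :: "('a, 'c::finite) cw \<Rightarrow> 'r::comm_ring_1 ^ 'c \<Rightarrow> 'r ^ 'c" where
  "boundary_map X x = (\<chi> \<tau>. if \<tau> \<in> cells X
      then \<Sum>\<sigma>\<in>cells X. of_int (incidence X \<sigma> \<tau>) * vec_nth x \<sigma> else 0)"

definition cycles :: "('a, 'c::finite) cw \<Rightarrow> nat \<Rightarrow> ('r::comm_ring_1 ^ 'c) set" where
  "cycles X k = {x \<in> chains X k. boundary_map X x = 0}"

definition boundaries :: "('a, 'c::finite) cw \<Rightarrow> nat \<Rightarrow> ('r::comm_ring_1 ^ 'c) set" where
  "boundaries X k = boundary_map X ` chains X (Suc k)"

definition additive_group :: "'v::ab_group_add set \<Rightarrow> 'v monoid" where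
  "additive_group V = \<lparr>carrier = V, monoid.mult = (+), one = 0\<rparr>"

definition cellular_homology :: "('a, 'c::finite) cw \<Rightarrow> nat \<Rightarrow> (int ^ 'c) set monoid" where
  "cellular_homology X k = additive_group (cycles X k) Mod boundaries X k"


section \<open>Rank and torsion of abelian groups\<close>

definition group_independent :: "('g, 'b) monoid_scheme \<Rightarrow> 'g set \<Rightarrow> bool" where
  "group_independent G S \<longleftrightarrow>
     (\<forall>c :: 'g \<Rightarrow> int. finprod G (\<lambda>x. x [^]\<^bsub>G\<^esub> c x) S = \<one>\<^bsub>G\<^esub> \<longrightarrow> (\<forall>x\<in>S. c x = 0))"

definition group_rank :: "('g, 'b) monoid_scheme \<Rightarrow> nat" where
  "group_rank G = Max {card S |S. finite S \<and> S \<subseteq> carrier G \<and> group_independent G S}"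

definition torsion_subgroup :: "('g, 'b) monoid_scheme \<Rightarrow> 'g set" where
  "torsion_subgroup G = {x \<in> carrier G. \<exists>n::nat. n > 0 \<and> x [^]\<^bsub>G\<^esub> n = \<one>\<^bsub>G\<^esub>}"

definition betti :: "('a, 'c::finite) cw \<Rightarrow> nat \<Rightarrow> nat" where
  "betti X k = group_rank (cellular_homology X k)"

definition torsion_order :: "('a, 'c::finite) cw \<Rightarrow> nat \<Rightarrow> nat" where
  "torsion_order X k = card (torsion_subgroup (cellular_homology X k))"


section \<open>Determinants of endomorphisms and covolumes of lattices\<close>

definition ordered_basis :: "'v::real_vector set \<Rightarrow> 'v list \<Rightarrow> bool" where
  "ordered_basis V bs \<longleftrightarrow> distinct bs \<and> independent (set bs) \<and> span (set bs) = V"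

text \<open>Entry \<open>(i, j)\<close> is the \<open>i\<close>-th coordinate of the image of the \<open>j\<close>-th basis vector.\<close>

definition matrix_wrt :: "'v::real_vector list \<Rightarrow> ('v \<Rightarrow> 'v) \<Rightarrow> real mat" where
  "matrix_wrt bs f = Matrix.mat (length bs) (length bs)
     (\<lambda>(i, j). representation (set bs) (f (bs ! j)) (bs ! i))"

text \<open>The determinant of an endomorphism \<open>f\<close> of the finite-dimensional space \<open>V\<close>; it does not
  depend on the chosen basis.\<close>

definition endo_det :: "'v::real_vector set \<Rightarrow> ('v \<Rightarrow> 'v) \<Rightarrow> real" where
  "endo_det V f = Determinant.det (matrix_wrt (SOME bs. ordered_basis V bs) f)"

definition lattice_basis :: "'v::real_vector set \<Rightarrow> 'v list \<Rightarrow> bool" where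
  "lattice_basis \<Lambda> bs \<longleftrightarrow> distinct bs \<and> independent (set bs) \<and>
     \<Lambda> = {\<Sum>i<length bs. of_int (c i) *\<^sub>R bs ! i |c :: nat \<Rightarrow> int. True}"

definition gram_matrix :: "'v::real_inner list \<Rightarrow> real mat" where
  "gram_matrix bs = Matrix.mat (length bs) (length bs) (\<lambda>(i, j). bs ! i \<bullet> bs ! j)"

text \<open>The volume, in the span of the lattice, of the fundamental parallelepiped of a lattice
  basis; it does not depend on the chosen basis.\<close>

definition covolume :: "'v::real_inner set \<Rightarrow> real" where
  "covolume \<Lambda> = sqrt (Determinant.det (gram_matrix (SOME bs. lattice_basis \<Lambda> bs)))"


section \<open>Spanning trees and the weighted operator\<close>

text \<open>A spanning tree of the \<open>d\<close>-dimensional complex \<open>X\<close>, given by its set of cells.\<close>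

definition spanning_tree :: "('a, 'c::finite) cw \<Rightarrow> nat \<Rightarrow> 'c set \<Rightarrow> bool" where
  "spanning_tree X d T \<longleftrightarrow> subcomplex X T \<and>
     trivial_group (cellular_homology (restrict_cw X T) d) \<and>
     betti (restrict_cw X T) (d - 1) = betti X (d - 1) \<and>
     {\<sigma> \<in> cells X. cdim X \<sigma> \<le> d - 1} \<subseteq> T"

definition tree_weight :: "('a, 'c::finite) cw \<Rightarrow> nat \<Rightarrow> ('c \<Rightarrow> real) \<Rightarrow> 'c set \<Rightarrow> real" where
  "tree_weight X d r T = (real (torsion_order (restrict_cw X T) (d - 1)))\<^sup>2 *
     (\<Prod>b\<in>cells_of_dim (restrict_cw X T) d. inverse (r b))"

definition resistance_map :: "('c::finite \<Rightarrow> real) \<Rightarrow> real ^ 'c \<Rightarrow> real ^ 'c" where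
  "resistance_map r x = (\<chi> b. r b * vec_nth x b)"

definition modified_inner :: "('c::finite \<Rightarrow> real) \<Rightarrow> real ^ 'c \<Rightarrow> real ^ 'c \<Rightarrow> real" where
  "modified_inner r x y = resistance_map r x \<bullet> y"

text \<open>The adjoint of the boundary map from \<open>d\<close>-chains with the modified inner product to
  \<open>(d-1)\<close>-chains with the standard one, characterised by
  \<open>\<langle>\<partial>x, y\<rangle> = \<langle>x, \<partial>\<^sub>R\<^sup>* y\<rangle>\<^sub>R\<close>; meaningful for \<open>y\<close> a \<open>(d-1)\<close>-chain.\<close>

definition boundary_adjoint ::
    "('a, 'c::finite) cw \<Rightarrow> nat \<Rightarrow> ('c \<Rightarrow> real) \<Rightarrow> real ^ 'c \<Rightarrow> real ^ 'c" where
  "boundary_adjoint X d r y = (THE z. z \<in> chains X d \<and>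
     (\<forall>x\<in>chains X d. boundary_map X x \<bullet> y = modified_inner r x z))"

definition weighted_laplacian ::
    "('a, 'c::finite) cw \<Rightarrow> nat \<Rightarrow> ('c \<Rightarrow> real) \<Rightarrow> real ^ 'c \<Rightarrow> real ^ 'c" where
  "weighted_laplacian X d r y = boundary_map X (boundary_adjoint X d r y)"

definition int_chain_to_real :: "int ^ 'c::finite \<Rightarrow> real ^ 'c" where
  "int_chain_to_real x = (\<chi> \<sigma>. of_int (vec_nth x \<sigma>))"

definition mu :: "('a, 'c::finite) cw \<Rightarrow> nat \<Rightarrow> real" where
  "mu X d = (covolume (int_chain_to_real ` boundaries X (d - 1)))\<^sup>2"

definition gamma :: "('a, 'c::finite) cw \<Rightarrow> nat \<Rightarrow> real" where
  "gamma X d = mu X d / (real (torsion_order X (d - 1)))\<^sup>2"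

end

theory Submission
  imports Defs
begin

text \<open>The statement splits into linear algebra over the lattice of boundaries and one topological
  fact, namely that the boundary operator given by Brouwer degrees squares to zero.

  Write \<open>d = n + 1\<close>, let \<open>\<partial>e\<close> be the boundary vector of a \<open>d\<close>-cell \<open>e\<close>, and let \<open>B\<close> be the
  lattice that these vectors generate. The operator is
  \<open>L y = \<Sum>\<^sub>e r\<^sub>e\<inverse> \<langle>\<partial>e, y\<rangle> \<partial>e\<close>; since \<open>\<langle>L y, y\<rangle> = \<Sum>\<^sub>e r\<^sub>e\<inverse> \<langle>\<partial>e, y\<rangle>\<^sup>2\<close>, it is positive definite on the real
  span of \<open>B\<close>. In a basis of \<open>B\<close> with Gram matrix \<open>G\<close>, let \<open>M\<close> be the integer matrix whose columns
  are the coordinates of the vectors \<open>\<partial>e\<close>. Then \<open>L\<close> has the matrix \<open>M D M\<^sup>T G\<close> with \<open>D\<close> the diagonal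
  matrix of the \<open>r\<^sub>e\<inverse>\<close>. Here \<open>det G\<close> is the squared covolume, and the Cauchy-Binet formula
  (\<open>cauchy_binet_weighted\<close>) expands \<open>det (M D M\<^sup>T)\<close> as the sum of \<open>(det M\<^sub>S)\<^sup>2 \<Prod>\<^sub>e\<^sub>\<in>\<^sub>S r\<^sub>e\<inverse>\<close> over the sets
  \<open>S\<close> of \<open>d\<close>-cells whose size is the rank of \<open>B\<close>.

  A minor is nonzero exactly if the boundaries of the cells in \<open>S\<close> form a basis of the span of \<open>B\<close>,
  that is, if \<open>S\<close> is the set of \<open>d\<close>-cells of a spanning tree \<open>T\<close> (\<open>spanning_tree_iff\<close>). In that
  case let \<open>B\<^sub>T\<close> be the lattice spanned by the \<open>\<partial>e\<close> with \<open>e \<in> S\<close>. The torsion subgroups of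
  \<open>H\<^sub>n(T)\<close> and of \<open>H\<^sub>n(X)\<close> are \<open>P / B\<^sub>T\<close> and \<open>P / B\<close> for the same group \<open>P\<close>, which consists of the
  integral cycles in the real span of \<open>B\<close>. Since the index of a sublattice is the absolute value of
  the determinant of a change of bases (\<open>lattice_index\<close>), it follows that
  \<open>\<theta>\<^sub>T = \<theta>\<^sub>X \<bar>det M\<^sub>S\<bar>\<close> (\<open>torsion_quotient\<close>), and summing over all trees gives the formula.

  That \<open>B\<close> consists of cycles is \<open>incidence_incidence\<close>. The attaching map of a
  \<open>(k+2)\<close>-cell gives a class in \<open>H\<^sub>k\<^sub>+\<^sub>1\<close> of the \<open>(k+1)\<close>-skeleton relative to the \<open>k\<close>-skeleton. This
  relative group is generated by the \<open>(k+1)\<close>-cells (\<open>relative_homology_cell_induct\<close>); pinching onto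
  a cell reads off its coefficient, and the connecting homomorphism of singular homology kills the
  class because it comes from the absolute group.\<close>

section \<open>Discs and radial stretching\<close>

lemma disc_eq: "disc n = top_of_set {x. (\<forall>i\<ge>n. x i = 0) \<and> (\<Sum>i<n. (x i)\<^sup>2) \<le> 1}"
  by (simp add: disc_def Euclidean_space_def subtopology_subtopology euclidean_product_topology Collect_conj_eq
   flip: Collect_conj_eq)

lemma topspace_disc: "topspace (disc n) = {x. (\<forall>i\<ge>n. x i = 0) \<and> (\<Sum>i<n. (x i)\<^sup>2) \<le> 1}"
  by (simp add: disc_eq)

lemma disc_split: "topspace (disc n) = open_disc n \<union> disc_boundary n"
  by (auto simp: topspace_disc open_disc_def disc_boundary_def)

lemma subtopology_disc_boundary: "subtopology (disc (Suc n)) (disc_boundary (Suc n)) = nsphere n"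
  unfolding nsphere disc_eq disc_boundary_def
  by (auto simp: subtopology_subtopology euclidean_product_topology Suc_le_eq lessThan_Suc_atMost intro!: arg_cong2[where f=subtopology])

lemma topspace_nsphere_eq_disc_boundary: "topspace (nsphere n) = disc_boundary (Suc n)"
  by (metis (no_types, lifting) disc_boundary_def inf.absorb_iff2 mem_Collect_eq subsetI subtopology_disc_boundary topspace_subtopology)

lemma compact_space_disc: "compact_space (disc n)"
proof -
  let ?D = "{x::nat\<Rightarrow>real. (\<forall>i\<ge>n. x i = 0) \<and> (\<Sum>i<n. (x i)\<^sup>2) \<le> 1}"
  have abs: "\<bar>x i\<bar> \<le> 1" if "x \<in> ?D" for x i
  proof (cases "i < n")
    case True
    have "(x i)\<^sup>2 \<le> (\<Sum>i<n. (x i)\<^sup>2)"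
      by (rule member_le_sum) (use True in auto)
    also have "\<dots> \<le> 1" using that by simp
    finally show ?thesis by (simp add: abs_square_le_1)
  qed (use that in auto)
  have "?D \<subseteq> (\<Pi>\<^sub>E i\<in>UNIV. {-1..1})"
    using abs by (force simp: abs_le_iff PiE_UNIV_domain minus_le_iff)
  moreover have "compactin (powertop_real UNIV) (\<Pi>\<^sub>E i\<in>UNIV. {-1..1})"
    by (simp add: compactin_PiE)
  moreover have "closed ({x. \<forall>i\<ge>n. x i = 0} \<inter> {x::nat \<Rightarrow> real. (\<Sum>i<n. (x i)\<^sup>2) \<le> 1})"
  proof (rule closed_Int)
    have "{x::nat\<Rightarrow>real. \<forall>i\<ge>n. x i = 0} = (\<Inter>i\<in>{n..}. {x. x i = 0})" by auto
    then show "closed {x::nat\<Rightarrow>real. \<forall>i\<ge>n. x i = 0}"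
      by (auto intro!: closed_INT closed_Collect_eq continuous_on_const continuous_on_product_coordinates)
    show "closed {x::nat \<Rightarrow> real. (\<Sum>i<n. (x i)\<^sup>2) \<le> 1}"
      by (intro closed_Collect_le continuous_on_sum continuous_on_power continuous_on_const continuous_on_product_coordinates)
  qed
  then have "closedin (powertop_real UNIV) ?D"
    by (simp add: Collect_conj_eq euclidean_product_topology)
  ultimately have "compactin (powertop_real UNIV) ?D"
    using closed_compactin by blast
  then have "compactin euclidean ?D"
    by (simp add: euclidean_product_topology)
  then show ?thesis
    by (simp add: disc_eq compact_space_subtopology)
qed

lemma contractible_space_disc: "contractible_space (disc n)"
proof -
  let ?D = "{x::nat\<Rightarrow>real. (\<forall>i\<ge>n. x i = 0) \<and> (\<Sum>i<n. (x i)\<^sup>2) \<le> 1}"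
  have "(\<Sum>i<n. ((1 - t) * x i)\<^sup>2) \<le> 1" if "t \<in> {0..1}" "x \<in> ?D" for t :: real and x
  proof -
    have "(\<Sum>i<n. ((1 - t) * x i)\<^sup>2) = (1-t)\<^sup>2 * (\<Sum>i<n. (x i)\<^sup>2)"
      by (simp add: power_mult_distrib sum_distrib_left)
    also have "\<dots> \<le> 1 * 1"
      using that by (intro mult_mono power_le_one) (auto simp: sum_nonneg)
    finally show ?thesis by simp
  qed
  then have "homotopic_with (\<lambda>_. True) (disc n) (disc n) id (\<lambda>_. (\<lambda>_. 0))"
    unfolding homotopic_with_def disc_eq
    by (intro exI [where x = "\<lambda>(t,x) i. (1 - t) * x i"])
       (auto simp: case_prod_unfold id_def
             intro!: continuous_on_mult continuous_on_diff continuous_on_const continuous_on_fst continuous_on_id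
               continuous_on_compose2[OF continuous_on_product_coordinates continuous_on_snd[OF continuous_on_id]] continuous_on_coordinatewise_then_product)
  then show ?thesis
    unfolding contractible_space_def by blast
qed

text \<open>Radial expansion by the factor \<open>1 + t\<close>, cut off at the unit sphere: a deformation of the
  identity that fixes the boundary and, at time 1, moves everything of norm greater than \<open>1/2\<close>
  into the boundary. The denominator is at least 1, so the formula is continuous at the origin.\<close>

definition stretch :: "nat \<Rightarrow> real \<Rightarrow> (nat \<Rightarrow> real) \<Rightarrow> nat \<Rightarrow> real" where
  "stretch n t x = (\<lambda>i. (1 + t) / max 1 ((1 + t) * sqrt (\<Sum>j<n. (x j)\<^sup>2)) * x i)"

lemma sum_squares_stretch:
  assumes "0 \<le> t"
  shows "(\<Sum>i<n. (stretch n t x i)\<^sup>2) = (min 1 ((1 + t) * sqrt (\<Sum>j<n. (x j)\<^sup>2)))\<^sup>2"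
proof -
  let ?s = "\<Sum>j<n. (x j)\<^sup>2"
  have s: "?s = (sqrt ?s)\<^sup>2" by (simp add: sum_nonneg)
  have "(\<Sum>i<n. (stretch n t x i)\<^sup>2) = ((1 + t) / max 1 ((1 + t) * sqrt ?s))\<^sup>2 * ?s"
    by (simp add: stretch_def power_mult_distrib sum_distrib_left power_divide)
  also have "\<dots> = ((1 + t) * sqrt ?s / max 1 ((1 + t) * sqrt ?s))\<^sup>2"
    by (subst s) (simp add: power_mult_distrib power_divide)
  also have "(1 + t) * sqrt ?s / max 1 ((1 + t) * sqrt ?s) = min 1 ((1 + t) * sqrt ?s)"
    by (auto simp: max_def min_def)
  finally show ?thesis .
qed

lemma stretch_in_disc:
  assumes "x \<in> topspace (disc n)" "0 \<le> t"
  shows "stretch n t x \<in> topspace (disc n)"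
  using assms by (auto simp: topspace_disc sum_squares_stretch abs_square_le_1 min_def sum_nonneg)
     (auto simp: stretch_def)

lemma stretch_boundary:
  assumes "x \<in> disc_boundary n" "0 \<le> t"
  shows "stretch n t x = x"
proof -
  have "(\<Sum>j<n. (x j)\<^sup>2) = 1" using assms(1) by (simp add: disc_boundary_def)
  then show ?thesis using assms(2) by (simp add: stretch_def)
qed

lemma stretch_0:
  assumes "x \<in> topspace (disc n)"
  shows "stretch n 0 x = x"
proof -
  have "sqrt (\<Sum>j<n. (x j)\<^sup>2) \<le> 1" using assms by (simp add: topspace_disc)
  then have "max 1 (sqrt (\<Sum>j<n. (x j)\<^sup>2)) = 1" by linarith
  then show ?thesis by (simp add: stretch_def)
qed

lemma stretch_1_outer:
  assumes "x \<in> topspace (disc n)" "1/4 < (\<Sum>i<n. (x i)\<^sup>2)"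
  shows "stretch n 1 x \<in> disc_boundary n"
proof -
  let ?s = "\<Sum>j<n. (x j)\<^sup>2"
  have "1/2 < sqrt ?s" using real_sqrt_less_mono[OF assms(2)] by (simp add: real_sqrt_divide)
  then show ?thesis
    using stretch_in_disc[OF assms(1), of 1] by (simp add: disc_boundary_def sum_squares_stretch)
qed

lemma continuous_map_stretch:
  "continuous_map (prod_topology (top_of_set {0..1}) (disc n)) (disc n) (\<lambda>(t, x). stretch n t x)"
proof -
  let ?D = "{x::nat\<Rightarrow>real. (\<forall>i\<ge>n. x i = 0) \<and> (\<Sum>i<n. (x i)\<^sup>2) \<le> 1}"
  have "continuous_on ({0..1} \<times> ?D) (\<lambda>(t, x). stretch n t x)"
    unfolding case_prod_unfold
    apply (rule continuous_on_coordinatewise_then_product)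
    apply (simp only: stretch_def)
    by (intro continuous_intros continuous_on_product_coordinates continuous_on_compose2[OF continuous_on_product_coordinates continuous_on_snd[OF continuous_on_id]]) auto
  moreover have "(\<lambda>(t, x). stretch n t x) ` ({0..1} \<times> ?D) \<subseteq> ?D"
    using stretch_in_disc[of _ n] by (force simp: topspace_disc)
  ultimately show ?thesis
    unfolding disc_eq
    by (auto simp: case_prod_unfold)
qed

section \<open>Attaching one cell\<close>

text \<open>The space \<open>Y\<close> arises from the closed set \<open>A\<close> by attaching one \<open>n\<close>-cell. Its topology is
  determined by these data: discs are compact and \<open>Y\<close> is Hausdorff, so the characteristic map is a
  quotient map onto the closed cell.\<close>

locale attached_cell =
  fixes Y :: "'a topology" and A :: "'a set" and n :: nat and \<Phi> :: "(nat \<Rightarrow> real) \<Rightarrow> 'a"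
  assumes Hausdorff: "Hausdorff_space Y"
    and closed_base: "closedin Y A"
    and continuous_char: "continuous_map (disc n) Y \<Phi>"
    and char_boundary: "\<Phi> ` disc_boundary n \<subseteq> A"
    and embedding_char: "embedding_map (subtopology (disc n) (open_disc n)) Y \<Phi>"
    and open_cell_disjoint: "\<Phi> ` open_disc n \<inter> A = {}"
    and topspace_attached: "topspace Y = A \<union> \<Phi> ` open_disc n"
begin

lemma inj_on_char: "inj_on \<Phi> (open_disc n)"
  using embedding_char by (auto simp: embedding_map_def homeomorphic_map_def disc_split inf.absorb2 dest!: injective_quotient_map)

lemma char_in_base_iff: "x \<in> topspace (disc n) \<Longrightarrow> \<Phi> x \<in> A \<longleftrightarrow> x \<in> disc_boundary n"
  using open_cell_disjoint char_boundary disc_split by blast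

lemma char_eq_iff:
  assumes "x \<in> open_disc n" "y \<in> topspace (disc n)" "\<Phi> x = \<Phi> y"
  shows "x = y"
proof -
  have "y \<in> open_disc n"
    using assms char_boundary open_cell_disjoint unfolding disc_split by blast
  then show ?thesis
    using assms inj_on_char by (auto dest: inj_onD)
qed

text \<open>Stretching of the cell, extended by the identity of \<open>A\<close>; this is consistent because
  stretching fixes the boundary of the disc.\<close>

definition flow :: "real \<Rightarrow> 'a \<Rightarrow> 'a" where
  "flow t y = (if y \<in> A then y else \<Phi> (stretch n t (inv_into (open_disc n) \<Phi> y)))"

lemma flow_char:
  assumes "x \<in> topspace (disc n)" "0 \<le> t"
  shows "flow t (\<Phi> x) = \<Phi> (stretch n t x)"
proof (cases "x \<in> disc_boundary n")
  case True
  then show ?thesis using assms by (simp add: flow_def char_in_base_iff stretch_boundary)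
next
  case False
  then have "x \<in> open_disc n" using assms disc_split by blast
  then show ?thesis using assms False by (simp add: flow_def char_in_base_iff inv_into_f_f[OF inj_on_char])
qed

lemma topspace_cover: "topspace Y = A \<union> \<Phi> ` topspace (disc n)"
  using topspace_attached char_boundary unfolding disc_split by blast

lemma closed_closed_cell: "closedin Y (\<Phi> ` topspace (disc n))"
  using compactin_imp_closedin[OF Hausdorff] image_compactin[OF _ continuous_char] compact_space_disc
  by (simp add: compact_space_def)

text \<open>The closed sets \<open>A\<close> and \<open>\<Phi> ` topspace (disc n)\<close> cover \<open>Y\<close>. On the second one, continuity may be
  checked after composition with \<open>id \<times> \<Phi>\<close>, a continuous surjection from a compact space to a Hausdorff
  space and hence a quotient map; there the flow becomes the stretching of the disc.\<close>

lemma continuous_map_flow: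
  "continuous_map (prod_topology (top_of_set {0..1}) Y) Y (\<lambda>(t, y). flow t y)"
proof -
  let ?I = "top_of_set {0..1::real}"
  let ?C = "\<Phi> ` topspace (disc n)"
  have on_A: "continuous_map (subtopology (prod_topology ?I Y) ({0..1} \<times> A)) Y (\<lambda>(t, y). flow t y)"
  proof (rule continuous_map_eq[where f = snd])
    show "continuous_map (subtopology (prod_topology ?I Y) ({0..1} \<times> A)) Y snd"
      by (intro continuous_map_from_subtopology continuous_map_snd)
  qed (auto simp: flow_def)
  have on_C: "continuous_map (subtopology (prod_topology ?I Y) ({0..1} \<times> ?C)) Y (\<lambda>(t, y). flow t y)"
  proof (rule continuous_compose_quotient_map)
    let ?q = "\<lambda>(t, x). (t, \<Phi> x)"
    show "quotient_map (prod_topology ?I (disc n)) (subtopology (prod_topology ?I Y) ({0..1} \<times> ?C)) ?q"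
    proof (rule T1_Spaces.continuous_imp_quotient_map)
      have "continuous_map (prod_topology ?I (disc n)) (prod_topology ?I Y) ?q"
        unfolding case_prod_unfold continuous_map_pairwise o_def
        using continuous_map_fst continuous_map_compose[OF continuous_map_snd continuous_char]
        by (auto simp: o_def)
      then show "continuous_map (prod_topology ?I (disc n)) (subtopology (prod_topology ?I Y) ({0..1} \<times> ?C)) ?q"
        by (auto simp: continuous_map_in_subtopology)
      show "compact_space (prod_topology ?I (disc n))"
        by (simp add: compact_space_prod_topology compact_space_disc compact_space_subtopology)
      show "Hausdorff_space (subtopology (prod_topology ?I Y) ({0..1} \<times> ?C))"
        by (intro Hausdorff_space_subtopology) (auto simp: Hausdorff_space_prod_topology Hausdorff Hausdorff_space_subtopology)
      show "?q ` topspace (prod_topology ?I (disc n)) = topspace (subtopology (prod_topology ?I Y) ({0..1} \<times> ?C))"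
        using topspace_cover by (auto simp: image_iff)
    qed
    have "continuous_map (prod_topology ?I (disc n)) Y (\<Phi> \<circ> (\<lambda>(t, x). stretch n t x))"
      by (rule continuous_map_compose[OF continuous_map_stretch continuous_char])
    then show "continuous_map (prod_topology ?I (disc n)) Y ((\<lambda>(t, y). flow t y) \<circ> ?q)"
      by (rule continuous_map_eq) (auto simp: flow_char)
  qed
  show ?thesis
  proof (rule pasting_lemma_closed[where I = "{A, ?C}" and T = "\<lambda>B. {0..1} \<times> B" and f = "\<lambda>_ (t, y). flow t y"])
    show "closedin (prod_topology ?I Y) ({0..1} \<times> B)" if "B \<in> {A, ?C}" for B
      using that closed_base closed_closed_cell closedin_prod_Times_iff closedin_topspace[of ?I] by fastforce
  qed (use on_A on_C topspace_cover in auto)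
qed

text \<open>An open neighbourhood of \<open>A\<close> that the flow pushes into \<open>A\<close>. The bound \<open>1/4\<close> is
  the square of the radius \<open>1/2\<close> below which the stretching at time 1 stays off the boundary.\<close>

definition collar :: "'a set" where
  "collar = A \<union> \<Phi> ` {x \<in> topspace (disc n). 1/4 < (\<Sum>i<n. (x i)\<^sup>2)}"

lemma char_in_collar_iff:
  assumes "x \<in> topspace (disc n)"
  shows "\<Phi> x \<in> collar \<longleftrightarrow> 1/4 < (\<Sum>i<n. (x i)\<^sup>2)"
proof (cases "x \<in> disc_boundary n")
  case True
  then show ?thesis using char_in_base_iff[OF assms] by (simp add: collar_def disc_boundary_def)
next
  case False
  then have "x \<in> open_disc n" using assms disc_split by blast
  then show ?thesis using False assms char_eq_iff[of x]
    by (auto simp: collar_def char_in_base_iff)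
qed

lemma collar_subset: "collar \<subseteq> topspace Y"
  using topspace_cover by (auto simp: collar_def)

lemma open_collar: "openin Y collar"
proof -
  let ?K = "{x \<in> topspace (disc n). (\<Sum>i<n. (x i)\<^sup>2) \<le> 1/4}"
  have "closedin (disc n) ?K"
  proof -
    have "closed {x::nat\<Rightarrow>real. (\<Sum>i<n. (x i)\<^sup>2) \<le> 1/4}"
      by (intro closed_Collect_le continuous_on_sum continuous_on_power continuous_on_const continuous_on_product_coordinates)
    then show ?thesis
      unfolding disc_eq by (auto simp: closedin_closed)
  qed
  then have "compactin (disc n) ?K"
    by (rule closedin_compact_space[OF compact_space_disc])
  then have "closedin Y (\<Phi> ` ?K)"
    by (intro compactin_imp_closedin[OF Hausdorff] image_compactin[OF _ continuous_char])
  moreover have "topspace Y - collar = \<Phi> ` ?K"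
  proof -
    have "y \<in> \<Phi> ` ?K" if "y \<in> topspace Y" "y \<notin> collar" for y
    proof -
      obtain x where x: "x \<in> topspace (disc n)" "y = \<Phi> x"
        using \<open>y \<in> topspace Y\<close> \<open>y \<notin> collar\<close> topspace_cover by (auto simp: collar_def)
      then show ?thesis
        using \<open>y \<notin> collar\<close> char_in_collar_iff by force
    qed
    moreover have "\<Phi> ` ?K \<subseteq> topspace Y - collar"
      using char_in_collar_iff topspace_cover by force
    ultimately show ?thesis by blast
  qed
  ultimately show ?thesis
    using collar_subset by (metis closedin_def double_diff order_refl openin_closedin_eq)
qed

lemma flow_1_collar:
  assumes "y \<in> collar"
  shows "flow 1 y \<in> A"
proof (cases "y \<in> A")
  case False
  then obtain x where x: "x \<in> topspace (disc n)" "1/4 < (\<Sum>i<n. (x i)\<^sup>2)" "y = \<Phi> x"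
    using assms by (auto simp: collar_def)
  then show ?thesis
    using stretch_1_outer[OF x(1,2)] char_boundary by (auto simp: flow_char)
qed (simp add: flow_def)

lemma flow_0: "y \<in> topspace Y \<Longrightarrow> flow 0 y = y"
  using topspace_cover by (auto simp: flow_char stretch_0) (simp add: flow_def)

lemma continuous_map_flow_1: "continuous_map Y Y (flow 1)"
proof -
  have "continuous_map Y (prod_topology (top_of_set {0..1::real}) Y) (\<lambda>y. (1, y))"
    by (simp add: continuous_map_pairwise o_def)
  from continuous_map_compose[OF this continuous_map_flow] show ?thesis
    by (simp add: o_def)
qed

lemma homotopic_flow: "homotopic_with (\<lambda>h. h \<in> A \<rightarrow> A) Y Y id (flow 1)"
proof -
  have "homotopic_with (\<lambda>h. h \<in> A \<rightarrow> A) Y Y (flow 0) (flow 1)"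
    unfolding homotopic_with_def
    using continuous_map_flow by (intro exI[where x = "\<lambda>(t, y). flow t y"]) (auto simp: flow_def)
  moreover have "homotopic_with (\<lambda>h. h \<in> A \<rightarrow> A) Y Y id (flow 0)"
    by (rule homotopic_with_equal) (simp_all add: flow_0, auto simp: flow_def)
  ultimately show ?thesis
    using homotopic_with_trans by blast
qed

text \<open>By excision of \<open>A\<close>, every class of \<open>(Y, collar)\<close> comes from the open disc relative to its outer
  part; apply this to the image of \<open>c\<close>. The flow at time 1 maps \<open>(Y, collar)\<close> to \<open>(Y, A)\<close> and is
  homotopic to the identity as a map of \<open>(Y, A)\<close>, so it carries that image back to \<open>c\<close>. As the
  flow corresponds to the stretching of the disc, \<open>c\<close> comes from \<open>(disc n, disc_boundary n)\<close>.\<close>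

proposition relative_homology_from_disc:
  assumes c: "c \<in> carrier (relative_homology_group p Y A)"
  obtains u where "u \<in> carrier (relative_homology_group p (disc n) (disc_boundary n))"
    and "hom_induced p (disc n) (disc_boundary n) Y A \<Phi> u = c"
proof -
  let ?D = "disc n" and ?S = "disc_boundary n" and ?Do = "subtopology (disc n) (open_disc n)"
  let ?E = "{x \<in> topspace (disc n). 1/4 < (\<Sum>i<n. (x i)\<^sup>2)}"
  let ?Eo = "?E \<inter> open_disc n"
  let ?e = "\<Phi> ` open_disc n"
  have A_sub: "A \<subseteq> collar" by (simp add: collar_def)
  have e_diff: "topspace Y - A = ?e"
    using topspace_attached open_cell_disjoint by blast
  have collar_diff: "\<Phi> ` ?Eo = collar - A"
  proof -
    have "\<Phi> ` ?Eo \<subseteq> collar - A"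
      using open_cell_disjoint by (auto simp: collar_def)
    moreover have "collar - A \<subseteq> \<Phi> ` ?Eo"
      using char_boundary disc_split by (fastforce simp: collar_def)
    ultimately show ?thesis by blast
  qed
  have excision: "hom_induced p (subtopology Y ?e) (collar - A) Y collar id
     \<in> iso (relative_homology_group p (subtopology Y ?e) (collar - A)) (relative_homology_group p Y collar)"
  proof -
    have "Y closure_of A \<subseteq> Y interior_of collar"
      using closed_base open_collar A_sub by (simp add: closure_of_closedin interior_of_openin)
    from homology_excision_axiom[OF this collar_subset, of p] show ?thesis
      by (simp add: e_diff)
  qed
  have cell: "hom_induced p ?Do ?Eo (subtopology Y ?e) (collar - A) \<Phi>
     \<in> iso (relative_homology_group p ?Do ?Eo) (relative_homology_group p (subtopology Y ?e) (collar - A))"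
  proof (rule homeomorphic_map_relative_homology_iso)
    show "homeomorphic_map ?Do (subtopology Y ?e) \<Phi>"
      using embedding_char disc_split by (simp add: embedding_map_def inf.absorb2)
    show "\<Phi> ` ?Eo = collar - A" by (rule collar_diff)
  qed auto
  let ?i = "hom_induced p Y A Y collar id"
  have "?i c \<in> carrier (relative_homology_group p Y collar)"
    by (rule hom_induced_carrier)
  then obtain b where b: "b \<in> carrier (relative_homology_group p (subtopology Y ?e) (collar - A))"
    and ic: "?i c = hom_induced p (subtopology Y ?e) (collar - A) Y collar id b"
    using excision unfolding iso_iff by blast
  then obtain a where a: "a \<in> carrier (relative_homology_group p ?Do ?Eo)"
    and ba: "b = hom_induced p ?Do ?Eo (subtopology Y ?e) (collar - A) \<Phi> a"
    using cell b unfolding iso_iff by blast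
  \<comment> \<open>The class on \<open>(disc n, disc_boundary n)\<close> is the stretched image of the class on the open disc.\<close>
  let ?k = "stretch n 1"
  have cont_k: "continuous_map ?D ?D ?k"
  proof -
    have "continuous_map ?D (prod_topology (top_of_set {0..1::real}) ?D) (\<lambda>y. (1, y))"
      by (simp add: continuous_map_pairwise o_def)
    from continuous_map_compose[OF this continuous_map_stretch] show ?thesis
      by (simp add: o_def)
  qed
  have k_outer: "?k \<in> ?E \<rightarrow> ?S"
    using stretch_1_outer by auto
  define v where "v = hom_induced p ?Do ?Eo ?D ?E id a"
  define u where "u = hom_induced p ?D ?E ?D ?S ?k v"
  have v: "?i c = hom_induced p ?D ?E Y collar \<Phi> v"
  proof -
    have "continuous_map ?Do (subtopology Y ?e) \<Phi>"
      using continuous_char disc_split by (auto simp: continuous_map_in_subtopology continuous_map_from_subtopology)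
    moreover have "\<Phi> \<in> ?Eo \<rightarrow> collar - A" using collar_diff by blast
    moreover have "\<Phi> \<in> ?E \<rightarrow> collar" by (auto simp: collar_def)
    ultimately show ?thesis
      unfolding ic ba v_def
      by (subst hom_induced_compose'; (subst hom_induced_compose')?)
         (auto simp: continuous_map_from_subtopology continuous_char)
  qed
  have "c = hom_induced p Y A Y A (flow 1) c"
    using homology_homotopy_axiom[OF homotopic_flow, of p] hom_induced_id[OF c] by metis
  also have "\<dots> = hom_induced p Y collar Y A (flow 1) (?i c)"
    using A_sub flow_1_collar continuous_map_flow_1 by (subst hom_induced_compose') auto
  also have "\<dots> = hom_induced p ?D ?E Y A (flow 1 \<circ> \<Phi>) v"
    unfolding v using flow_1_collar continuous_map_flow_1 continuous_char
    by (subst hom_induced_compose') (auto simp: collar_def)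
  also have "\<dots> = hom_induced p ?D ?E Y A (\<Phi> \<circ> ?k) v"
    by (rule fun_cong[OF hom_induced_eq]) (simp add: flow_char)
  also have "\<dots> = hom_induced p ?D ?S Y A \<Phi> u"
    unfolding u_def using cont_k continuous_char k_outer char_boundary
    by (subst hom_induced_compose') auto
  finally have "hom_induced p ?D ?S Y A \<Phi> u = c" ..
  moreover have "u \<in> carrier (relative_homology_group p ?D ?S)"
    unfolding u_def by (rule hom_induced_carrier)
  ultimately show thesis using that by blast
qed

end

section \<open>Generators of the homology of spheres\<close>

lemma (in group) subgroup_generated_singleton_all:
  assumes "a \<in> carrier G" "subgroup_generated G {a} = G" "x \<in> carrier G"
  shows "\<exists>m::int. x = a [^] m"
  using assms carrier_subgroup_generated_by_singleton[OF assms(1)] by auto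

lemma (in group_hom) quotient_in_kernel:
  assumes "x \<in> carrier G" "z \<in> carrier G" "h z = h x"
  shows "x \<otimes> inv z \<in> kernel G H h"
  using assms by (simp add: kernel_def)

lemma (in group) mult_inv_cancel_right:
  "x \<in> carrier G \<Longrightarrow> z \<in> carrier G \<Longrightarrow> x = (x \<otimes> inv z) \<otimes> z"
  by (simp add: m_assoc)

text \<open>Infinite cyclicity, stated so that exponents of the generator can be compared.\<close>

lemma nsphere_generator:
  obtains u where "u \<in> carrier (reduced_homology_group (int n) (nsphere n))"
    and "\<And>x. x \<in> carrier (reduced_homology_group (int n) (nsphere n)) \<Longrightarrow>
          \<exists>m::int. x = u [^]\<^bsub>reduced_homology_group (int n) (nsphere n)\<^esub> m"
    and "\<And>m k::int. u [^]\<^bsub>reduced_homology_group (int n) (nsphere n)\<^esub> m =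
          u [^]\<^bsub>reduced_homology_group (int n) (nsphere n)\<^esub> k \<longleftrightarrow> m = k"
proof -
  let ?G = "reduced_homology_group (int n) (nsphere n)"
  interpret group ?G by simp
  obtain a where a: "a \<in> carrier ?G" and aeq: "subgroup_generated ?G {a} = ?G"
    using cyclic_reduced_homology_group_nsphere [of n n] by (auto simp: cyclic_group_def)
  have ord: "ord a = 0"
    by (simp add: a aeq iso_finite [OF reduced_homology_group_nsphere(1)] flip: infinite_cyclic_subgroup_order)
  show thesis
    by (rule that[OF a subgroup_generated_singleton_all[OF a aeq]]) (auto simp: int_pow_eq[OF a] ord)
qed

section \<open>Finite CW complexes\<close>

definition cell_union :: "('a, 'c) cw \<Rightarrow> 'c set \<Rightarrow> 'a set" where
  "cell_union X K = (\<Union>\<sigma>\<in>K. open_cell X \<sigma>)"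

text \<open>The combinatorial condition under which, in a finite complex, the union of a set of open cells
  is closed.\<close>

definition face_closed :: "('a, 'c) cw \<Rightarrow> 'c set \<Rightarrow> bool" where
  "face_closed X K \<longleftrightarrow> K \<subseteq> cells X \<and>
     (\<forall>\<sigma>\<in>K. chmap X \<sigma> ` disc_boundary (cdim X \<sigma>) \<subseteq> cell_union X K)"

locale finite_cw =
  fixes X :: "('a, 'c) cw"
  assumes finite_cw: "finite_cw_complex X"
begin

lemma finite_cells: "finite (cells X)"
  and Hausdorff_cw: "Hausdorff_space (cw_space X)"
  and continuous_chmap: "\<sigma> \<in> cells X \<Longrightarrow> continuous_map (disc (cdim X \<sigma>)) (cw_space X) (chmap X \<sigma>)"
  and embedding_chmap: "\<sigma> \<in> cells X \<Longrightarrow> embedding_map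
        (subtopology (disc (cdim X \<sigma>)) (open_disc (cdim X \<sigma>))) (cw_space X) (chmap X \<sigma>)"
  using finite_cw unfolding finite_cw_complex_def cw_complex_def by blast+

lemma open_cell_unique: "\<sigma> \<in> cells X \<Longrightarrow> \<tau> \<in> cells X \<Longrightarrow> y \<in> open_cell X \<sigma> \<Longrightarrow> y \<in> open_cell X \<tau> \<Longrightarrow> \<sigma> = \<tau>"
  using finite_cw unfolding finite_cw_complex_def cw_complex_def disjoint_family_on_def by blast

lemma attaching_in_lower_cells:
  assumes "\<sigma> \<in> cells X"
  shows "chmap X \<sigma> ` disc_boundary (cdim X \<sigma>) \<subseteq> cell_union X {\<tau> \<in> cells X. cdim X \<tau> < cdim X \<sigma>}"
proof -
  obtain F where F: "F \<subseteq> cells X" "\<forall>\<tau>\<in>F. cdim X \<tau> < cdim X \<sigma>"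
      "chmap X \<sigma> ` disc_boundary (cdim X \<sigma>) \<subseteq> (\<Union>\<tau>\<in>F. open_cell X \<tau>)"
    using finite_cw assms unfolding finite_cw_complex_def cw_complex_def by metis
  then show ?thesis unfolding cell_union_def by blast
qed

lemma open_cell_subset: "\<sigma> \<in> cells X \<Longrightarrow> open_cell X \<sigma> \<subseteq> topspace (cw_space X)"
  using finite_cw unfolding finite_cw_complex_def cw_complex_def by blast

lemma cell_union_subset: "K \<subseteq> cells X \<Longrightarrow> cell_union X K \<subseteq> topspace (cw_space X)"
  using open_cell_subset unfolding cell_union_def by blast

lemma in_cell_union_iff: "\<sigma> \<in> cells X \<Longrightarrow> K \<subseteq> cells X \<Longrightarrow> y \<in> open_cell X \<sigma> \<Longrightarrow> y \<in> cell_union X K \<longleftrightarrow> \<sigma> \<in> K"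
  using open_cell_unique unfolding cell_union_def by blast

lemma closed_cell_eq: "closed_cell X \<sigma> = open_cell X \<sigma> \<union> chmap X \<sigma> ` disc_boundary (cdim X \<sigma>)"
  unfolding closed_cell_def open_cell_def disc_split by blast

lemma closedin_closed_cell: "\<sigma> \<in> cells X \<Longrightarrow> closedin (cw_space X) (closed_cell X \<sigma>)"
  unfolding closed_cell_def
  using compactin_imp_closedin[OF Hausdorff_cw] image_compactin[OF _ continuous_chmap] compact_space_disc
  by (simp add: compact_space_def)

lemma face_closed_eq: "face_closed X K \<Longrightarrow> cell_union X K = (\<Union>\<sigma>\<in>K. closed_cell X \<sigma>)"
  unfolding closed_cell_eq face_closed_def cell_union_def by blast

lemma closedin_face_closed:
  assumes "face_closed X K"
  shows "closedin (cw_space X) (cell_union X K)"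
proof -
  have "K \<subseteq> cells X" using assms by (simp add: face_closed_def)
  then show ?thesis
    unfolding face_closed_eq[OF assms]
    using closedin_closed_cell finite_cells finite_subset by (intro closedin_Union) (auto, blast)
qed

lemma face_closed_skeleton: "face_closed X {\<sigma> \<in> cells X. cdim X \<sigma> \<le> n}"
  unfolding face_closed_def
proof safe
  fix \<sigma> x assume "\<sigma> \<in> cells X" "cdim X \<sigma> \<le> n" "x \<in> disc_boundary (cdim X \<sigma>)"
  then show "chmap X \<sigma> x \<in> cell_union X {\<sigma> \<in> cells X. cdim X \<sigma> \<le> n}"
    using attaching_in_lower_cells[of \<sigma>] by (fastforce simp: cell_union_def)
qed

lemma face_closed_Un:
  assumes "face_closed X K" "F \<subseteq> cells X"
    and "\<And>\<tau>. \<tau> \<in> F \<Longrightarrow> chmap X \<tau> ` disc_boundary (cdim X \<tau>) \<subseteq> cell_union X K"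
  shows "face_closed X (K \<union> F)"
  unfolding face_closed_def cell_union_def
proof (intro conjI ballI)
  show "K \<union> F \<subseteq> cells X" using assms by (simp add: face_closed_def)
  fix \<sigma> assume "\<sigma> \<in> K \<union> F"
  then have "chmap X \<sigma> ` disc_boundary (cdim X \<sigma>) \<subseteq> cell_union X K"
    using assms(1,3) unfolding face_closed_def by blast
  then show "chmap X \<sigma> ` disc_boundary (cdim X \<sigma>) \<subseteq> (\<Union>\<sigma>\<in>K \<union> F. open_cell X \<sigma>)"
    unfolding cell_union_def by blast
qed

lemma attached_cell_insert:
  assumes K: "face_closed X K" and \<tau>: "\<tau> \<in> cells X" "\<tau> \<notin> K"
    and bd: "chmap X \<tau> ` disc_boundary (cdim X \<tau>) \<subseteq> cell_union X K"
  shows "attached_cell (subtopology (cw_space X) (cell_union X (insert \<tau> K))) (cell_union X K) (cdim X \<tau>) (chmap X \<tau>)"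
proof
  let ?U = "cell_union X (insert \<tau> K)"
  have KX: "K \<subseteq> cells X" using K by (simp add: face_closed_def)
  have U: "?U = cell_union X K \<union> open_cell X \<tau>" by (auto simp: cell_union_def)
  have Usub: "?U \<subseteq> topspace (cw_space X)" using cell_union_subset KX \<tau> by simp
  show "Hausdorff_space (subtopology (cw_space X) ?U)"
    by (simp add: Hausdorff_cw Hausdorff_space_subtopology)
  show "closedin (subtopology (cw_space X) ?U) (cell_union X K)"
    using closedin_face_closed[OF K] U by (simp add: closedin_subset_topspace)
  show "continuous_map (disc (cdim X \<tau>)) (subtopology (cw_space X) ?U) (chmap X \<tau>)"
    using continuous_chmap[OF \<tau>(1)] bd by (auto simp: continuous_map_in_subtopology disc_split U open_cell_def)
  show "embedding_map (subtopology (disc (cdim X \<tau>)) (open_disc (cdim X \<tau>))) (subtopology (cw_space X) ?U) (chmap X \<tau>)"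
    using embedding_chmap[OF \<tau>(1)] by (auto simp: embedding_map_in_subtopology U open_cell_def)
  show "chmap X \<tau> ` open_disc (cdim X \<tau>) \<inter> cell_union X K = {}"
    using in_cell_union_iff[OF \<tau>(1) KX] \<tau>(2) unfolding open_cell_def by blast
  show "topspace (subtopology (cw_space X) ?U) = cell_union X K \<union> chmap X \<tau> ` open_disc (cdim X \<tau>)"
    using U Usub by (auto simp: open_cell_def)
qed (rule bd)

text \<open>The homology of \<open>Y\<close> relative to \<open>A\<close> is generated by the classes coming from the attached cells.
  Stated as an induction principle for predicates that are closed under multiplication, this needs
  no direct sum decomposition. When a cell \<open>\<tau>\<close> is added to \<open>Y\<close>, the class of a given element
  relative to the old \<open>Y\<close> comes from the disc of \<open>\<tau>\<close>; after division by the corresponding class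
  relative to \<open>A\<close>, exactness for the triple shows that the rest comes from the old \<open>Y\<close>.\<close>

proposition relative_homology_cell_induct:
  fixes K F :: "'c set"
  defines "A \<equiv> cell_union X K" and "Y \<equiv> subtopology (cw_space X) (cell_union X (K \<union> F))"
  assumes K: "face_closed X K" and F: "F \<subseteq> cells X" "F \<inter> K = {}"
    and bd: "\<And>\<tau>. \<tau> \<in> F \<Longrightarrow> chmap X \<tau> ` disc_boundary (cdim X \<tau>) \<subseteq> A"
    and x: "x \<in> carrier (relative_homology_group p Y A)"
    and one: "P (\<one>\<^bsub>relative_homology_group p Y A\<^esub>)"
    and mult: "\<And>x y. \<lbrakk>x \<in> carrier (relative_homology_group p Y A); y \<in> carrier (relative_homology_group p Y A);
        P x; P y\<rbrakk> \<Longrightarrow> P (x \<otimes>\<^bsub>relative_homology_group p Y A\<^esub> y)"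
    and cell: "\<And>\<tau> u. \<lbrakk>\<tau> \<in> F; u \<in> carrier (relative_homology_group p (disc (cdim X \<tau>)) (disc_boundary (cdim X \<tau>)))\<rbrakk> \<Longrightarrow>
        P (hom_induced p (disc (cdim X \<tau>)) (disc_boundary (cdim X \<tau>)) Y A (chmap X \<tau>) u)"
  shows "P x"
proof -
  have "finite F" using F(1) finite_cells finite_subset by blast
  then show ?thesis using F bd x one mult cell unfolding A_def Y_def
  proof (induction F arbitrary: x P rule: finite_induct)
    case empty
    let ?A = "cell_union X K"
    have "trivial_group (relative_homology_group p (subtopology (cw_space X) ?A) ?A)"
      using trivial_relative_homology_group_topspace[of p "subtopology (cw_space X) ?A"]
      by (metis relative_homology_group_restrict topspace_subtopology inf.right_idem)
    then have "x = \<one>\<^bsub>relative_homology_group p (subtopology (cw_space X) ?A) ?A\<^esub>"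
      using empty.prems(4) by (simp add: trivial_group_def)
    with empty.prems(5) show ?case by simp
  next
    case (insert \<tau> F)
    let ?A = "cell_union X K" and ?B = "cell_union X (K \<union> F)" and ?C = "cell_union X (K \<union> insert \<tau> F)"
    let ?Y = "subtopology (cw_space X) ?B" and ?Y' = "subtopology (cw_space X) ?C"
    let ?G = "relative_homology_group p ?Y ?A" and ?G' = "relative_homology_group p ?Y' ?A"
    let ?i = "hom_induced p ?Y ?A ?Y' ?A id"
    let ?D = "disc (cdim X \<tau>)" and ?S = "disc_boundary (cdim X \<tau>)"
    have AB: "?A \<subseteq> ?B" and BC: "?B \<subseteq> ?C" by (auto simp: cell_union_def)
    have sub: "subtopology ?Y' ?B = ?Y" using BC by (simp add: subtopology_subtopology inf.absorb2)
    have bd: "chmap X \<tau> ` ?S \<subseteq> ?A" using insert.prems(3) by blast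
    have fB: "face_closed X (K \<union> F)"
      by (rule face_closed_Un[OF K]) (use insert.prems(1,3) in auto)
    have \<tau>: "\<tau> \<in> cells X" "\<tau> \<notin> K \<union> F" using insert.prems(1,2) insert.hyps by auto
    interpret att: attached_cell ?Y' ?B "cdim X \<tau>" "chmap X \<tau>"
      using attached_cell_insert[OF fB \<tau>] bd AB by auto
    let ?j = "hom_induced p ?Y' ?A ?Y' ?B id"
    obtain u where u: "u \<in> carrier (relative_homology_group p ?D ?S)"
      and ju: "hom_induced p ?D ?S ?Y' ?B (chmap X \<tau>) u = ?j x"
      using att.relative_homology_from_disc[OF hom_induced_carrier] by metis
    let ?z = "hom_induced p ?D ?S ?Y' ?A (chmap X \<tau>) u"
    interpret G': comm_group ?G' by simp
    interpret j: group_hom ?G' "relative_homology_group p ?Y' ?B" ?j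
      by (simp add: group_hom_def group_hom_axioms_def hom_induced_hom)
    have z: "?z \<in> carrier ?G'" by (rule hom_induced_carrier)
    have jz: "?j ?z = ?j x"
      unfolding ju[symmetric] using att.continuous_char bd AB
      by (subst hom_induced_compose') auto
    let ?w = "x \<otimes>\<^bsub>?G'\<^esub> inv\<^bsub>?G'\<^esub> ?z"
    have "?w \<in> kernel ?G' (relative_homology_group p ?Y' ?B) ?j"
      by (rule j.quotient_in_kernel[OF insert.prems(4) z jz])
    moreover have "kernel ?G' (relative_homology_group p ?Y' ?B) ?j = ?i ` carrier ?G"
      using homology_exactness_triple_3[OF AB, of p ?Y'] unfolding sub by simp
    ultimately obtain y where y: "y \<in> carrier ?G" and wy: "?w = ?i y" by blast
    have ci: "continuous_map ?Y ?Y' id"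
      using BC by (auto simp: continuous_map_in_subtopology continuous_map_from_subtopology)
    have Piy: "P (?i y)"
    proof (rule insert.IH[where P = "\<lambda>y. P (?i y)"])
      show "P (?i \<one>\<^bsub>?G\<^esub>)"
        by (subst hom_one[OF hom_induced_hom group_relative_homology_group group_relative_homology_group]) (rule insert.prems(5))
      show "P (?i (a \<otimes>\<^bsub>?G\<^esub> b))" if "a \<in> carrier ?G" "b \<in> carrier ?G" "P (?i a)" "P (?i b)" for a b
        by (subst hom_mult[OF hom_induced_hom that(1,2)])
           (rule insert.prems(6)[OF hom_induced_carrier hom_induced_carrier that(3,4)])
      show "P (?i (hom_induced p (disc (cdim X \<kappa>)) (disc_boundary (cdim X \<kappa>)) ?Y ?A (chmap X \<kappa>) v))"
        if "\<kappa> \<in> F" "v \<in> carrier (relative_homology_group p (disc (cdim X \<kappa>)) (disc_boundary (cdim X \<kappa>)))" for \<kappa> v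
      proof -
        have bd\<kappa>: "chmap X \<kappa> ` disc_boundary (cdim X \<kappa>) \<subseteq> ?A" using that insert.prems(3) by blast
        have "open_cell X \<kappa> \<subseteq> ?B" using that(1) by (auto simp: cell_union_def)
        then have "chmap X \<kappa> ` topspace (disc (cdim X \<kappa>)) \<subseteq> ?B"
          using bd\<kappa> AB by (auto simp: disc_split open_cell_def)
        moreover have "\<kappa> \<in> cells X" using that insert.prems(1) by blast
        ultimately have "continuous_map (disc (cdim X \<kappa>)) ?Y (chmap X \<kappa>)"
          by (auto simp: continuous_map_in_subtopology continuous_chmap)
        then have "?i (hom_induced p (disc (cdim X \<kappa>)) (disc_boundary (cdim X \<kappa>)) ?Y ?A (chmap X \<kappa>) v) =
            hom_induced p (disc (cdim X \<kappa>)) (disc_boundary (cdim X \<kappa>)) ?Y' ?A (id \<circ> chmap X \<kappa>) v"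
          by (rule hom_induced_compose'[OF _ _ ci]) (use bd\<kappa> in auto)
        then show ?thesis
          using insert.prems(7)[OF insertI2[OF that(1)] that(2)] by (metis id_comp)
      qed
      show "F \<subseteq> cells X" "F \<inter> K = {}" using insert.prems(1,2) by auto
      show "y \<in> carrier ?G" by (rule y)
      show "chmap X \<kappa> ` disc_boundary (cdim X \<kappa>) \<subseteq> ?A" if "\<kappa> \<in> F" for \<kappa>
        using that insert.prems(3) by blast
    qed
    have Pz: "P ?z" using insert.prems(7) u by blast
    have xeq: "x = ?i y \<otimes>\<^bsub>?G'\<^esub> ?z"
      unfolding wy[symmetric] by (rule G'.mult_inv_cancel_right[OF insert.prems(4) z])
    have "P (?i y \<otimes>\<^bsub>?G'\<^esub> ?z)"
      by (rule insert.prems(6)[OF hom_induced_carrier z Piy Pz])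
    then show ?case by (subst xeq)
  qed
qed

end

section \<open>Pinch maps and the square of the cellular boundary\<close>

text \<open>A constant map factors through the pair of a point and itself, whose relative homology is
  trivial.\<close>

lemma hom_induced_const:
  assumes "a \<in> topspace Y"
  shows "hom_induced p X S Y {a} (\<lambda>_. a) c = \<one>\<^bsub>relative_homology_group p Y {a}\<^esub>"
proof (cases "c \<in> carrier (relative_homology_group p X S)")
  case True
  let ?P = "subtopology Y {a}"
  have "trivial_group (relative_homology_group p ?P {a})"
    using trivial_relative_homology_group_topspace[of p ?P] assms by simp
  then have "hom_induced p X S ?P {a} (\<lambda>_. a) c = \<one>\<^bsub>relative_homology_group p ?P {a}\<^esub>"
    using hom_induced_carrier[of p X S ?P "{a}" "\<lambda>_. a" c] by (simp add: trivial_group_def)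
  moreover have "hom_induced p X S Y {a} (id \<circ> (\<lambda>_. a)) c = hom_induced p ?P {a} Y {a} id (hom_induced p X S ?P {a} (\<lambda>_. a) c)"
    using assms by (subst hom_induced_compose') (auto simp: continuous_map_from_subtopology)
  ultimately show ?thesis
    using hom_one[OF hom_induced_hom] by (simp add: o_def)
qed (simp add: hom_induced_default)

lemma disc_collapse_sphere:
  assumes "(\<Sum>i<n. (x i)\<^sup>2) \<le> 1"
  shows "disc_collapse n x \<in> topspace (nsphere n)"
proof -
  define s where "s = (\<Sum>i<n. (x i)\<^sup>2)"
  have "(\<Sum>i\<le>n. (disc_collapse n x i)\<^sup>2) = (\<Sum>i<n. (2 * sqrt (1 - s) * x i)\<^sup>2) + (1 - 2 * s)\<^sup>2"
    unfolding lessThan_Suc_atMost[symmetric] sum.lessThan_Suc by (simp add: disc_collapse_def Let_def s_def)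
  also have "(\<Sum>i<n. (2 * sqrt (1 - s) * x i)\<^sup>2) = 4 * (1 - s) * s"
    using assms by (simp add: power_mult_distrib s_def sum_distrib_left)
  finally have "(\<Sum>i\<le>n. (disc_collapse n x i)\<^sup>2) = 1"
    by (simp add: power2_eq_square algebra_simps)
  moreover have "disc_collapse n x i = 0" if "i > n" for i
    using that by (simp add: disc_collapse_def Let_def)
  ultimately show ?thesis
    by (simp add: nsphere)
qed

lemma disc_collapse_boundary: "x \<in> disc_boundary n \<Longrightarrow> disc_collapse n x = south_pole n"
  by (auto simp: disc_collapse_def south_pole_def disc_boundary_def)

lemma south_pole_sphere: "south_pole n \<in> topspace (nsphere n)"
  by (simp add: nsphere south_pole_def if_distrib[of "\<lambda>x. x^2"] cong: if_cong)

lemma continuous_map_disc_collapse: "continuous_map (disc n) (nsphere n) (disc_collapse n)"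
proof -
  let ?D = "{x::nat\<Rightarrow>real. (\<forall>i\<ge>n. x i = 0) \<and> (\<Sum>i<n. (x i)\<^sup>2) \<le> 1}"
  have "continuous_on ?D (disc_collapse n)"
  proof (rule continuous_on_coordinatewise_then_product)
    fix i
    have coord: "continuous_on ?D (\<lambda>x. x j)" for j
      by (rule continuous_on_subset[OF continuous_on_product_coordinates]) simp
    then have s: "continuous_on ?D (\<lambda>x. \<Sum>i<n. (x i)\<^sup>2)"
      by (intro continuous_on_sum continuous_on_power)
    consider "i < n" | "i = n" | "i > n" by linarith
    then show "continuous_on ?D (\<lambda>x. disc_collapse n x i)"
      by cases (auto simp: disc_collapse_def Let_def intro!: continuous_on_mult continuous_on_diff continuous_on_const continuous_on_real_sqrt coord s)
  qed
  moreover have "disc_collapse n ` ?D \<subseteq> topspace (nsphere n)"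
    using disc_collapse_sphere by auto
  ultimately show ?thesis
    by (auto simp: disc_eq nsphere euclidean_product_topology continuous_map_in_subtopology)
qed

context finite_cw
begin

lemma cell_pinch_off: "y \<notin> open_cell X \<tau> \<Longrightarrow> cell_pinch X \<tau> y = south_pole (cdim X \<tau>)"
  by (simp add: cell_pinch_def)

lemma cell_pinch_chmap:
  assumes "\<tau> \<in> cells X" "x \<in> topspace (disc (cdim X \<tau>))"
  shows "cell_pinch X \<tau> (chmap X \<tau> x) = disc_collapse (cdim X \<tau>) x"
proof (cases "x \<in> disc_boundary (cdim X \<tau>)")
  case True
  then have "chmap X \<tau> x \<in> cell_union X {\<kappa> \<in> cells X. cdim X \<kappa> < cdim X \<tau>}"
    using attaching_in_lower_cells[OF assms(1)] by blast
  then have "chmap X \<tau> x \<notin> open_cell X \<tau>"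
    using open_cell_unique[OF assms(1)] unfolding cell_union_def by fastforce
  then show ?thesis using True by (simp add: cell_pinch_def disc_collapse_boundary)
next
  case False
  then have x: "x \<in> open_disc (cdim X \<tau>)" using assms(2) disc_split by blast
  have "inj_on (chmap X \<tau>) (open_disc (cdim X \<tau>))"
    using embedding_chmap[OF assms(1)]
    by (auto simp: embedding_map_def homeomorphic_map_def disc_split inf.absorb2)
  then show ?thesis using x by (simp add: cell_pinch_def open_cell_def)
qed

lemma cell_pinch_other:
  assumes "\<tau> \<in> cells X" "\<kappa> \<in> cells X" "\<kappa> \<noteq> \<tau>" "cdim X \<kappa> \<le> cdim X \<tau>" "x \<in> topspace (disc (cdim X \<kappa>))"
  shows "cell_pinch X \<tau> (chmap X \<kappa> x) = south_pole (cdim X \<tau>)"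
proof -
  have "chmap X \<kappa> x \<in> open_cell X \<kappa> \<union> cell_union X {\<mu> \<in> cells X. cdim X \<mu> < cdim X \<kappa>}"
    using attaching_in_lower_cells[OF assms(2)] assms(5) unfolding disc_split open_cell_def by blast
  then have "chmap X \<kappa> x \<notin> open_cell X \<tau>"
    using open_cell_unique[OF assms(1)] assms(2-4) unfolding cell_union_def by fastforce
  then show ?thesis by (rule cell_pinch_off)
qed

text \<open>The pinch map is constant on the union of the cells other than \<open>\<tau>\<close>, which is closed by the bound on
  dimensions; on the closed cell it becomes \<open>disc_collapse\<close> after composition with the
  characteristic map, which is a quotient map.\<close>

lemma continuous_map_cell_pinch:
  assumes K: "face_closed X K" and \<tau>: "\<tau> \<in> cells X" and dim: "\<And>\<kappa>. \<kappa> \<in> K \<Longrightarrow> cdim X \<kappa> \<le> cdim X \<tau>"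
  shows "continuous_map (subtopology (cw_space X) (cell_union X K)) (nsphere (cdim X \<tau>)) (cell_pinch X \<tau>)"
proof -
  have KX: "K \<subseteq> cells X" using K by (simp add: face_closed_def)
  let ?L = "K - {\<tau>}" and ?S = "nsphere (cdim X \<tau>)"
  have L: "face_closed X ?L"
    unfolding face_closed_def
  proof (intro conjI ballI subsetI)
    fix \<kappa> y assume \<kappa>: "\<kappa> \<in> ?L" and y: "y \<in> chmap X \<kappa> ` disc_boundary (cdim X \<kappa>)"
    have "y \<in> cell_union X K" using K \<kappa> y unfolding face_closed_def by blast
    then obtain \<nu> where \<nu>: "\<nu> \<in> K" "y \<in> open_cell X \<nu>" unfolding cell_union_def by blast
    obtain \<mu> where \<mu>: "\<mu> \<in> cells X" "cdim X \<mu> < cdim X \<kappa>" "y \<in> open_cell X \<mu>"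
      using attaching_in_lower_cells[of \<kappa>] \<kappa> KX y unfolding cell_union_def by blast
    have "\<nu> = \<mu>" using open_cell_unique \<nu> \<mu> KX by blast
    then have "\<nu> \<noteq> \<tau>" using \<mu>(2) dim[of \<kappa>] \<kappa> by auto
    then show "y \<in> cell_union X ?L" using \<nu> unfolding cell_union_def by blast
  qed (use KX in auto)
  have on_L: "continuous_map (subtopology (cw_space X) (cell_union X ?L)) ?S (cell_pinch X \<tau>)"
  proof (rule continuous_map_eq[where f = "\<lambda>_. south_pole (cdim X \<tau>)"])
    fix y assume "y \<in> topspace (subtopology (cw_space X) (cell_union X ?L))"
    then have "y \<notin> open_cell X \<tau>"
      using in_cell_union_iff[OF \<tau>, of ?L] KX by auto
    then show "south_pole (cdim X \<tau>) = cell_pinch X \<tau> y" by (simp add: cell_pinch_off)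
  qed (simp add: south_pole_sphere)
  show ?thesis
  proof (cases "\<tau> \<in> K")
    case False
    then show ?thesis using on_L by simp
  next
    case True
    let ?C = "closed_cell X \<tau>"
    have KC: "cell_union X K = cell_union X ?L \<union> ?C"
    proof (rule equalityI)
      show "cell_union X K \<subseteq> cell_union X ?L \<union> ?C"
        unfolding closed_cell_eq by (auto simp: cell_union_def)
      have "chmap X \<tau> ` disc_boundary (cdim X \<tau>) \<subseteq> cell_union X K"
        using K True by (simp add: face_closed_def)
      moreover have "open_cell X \<tau> \<union> cell_union X ?L \<subseteq> cell_union X K"
        using True by (auto simp: cell_union_def)
      ultimately show "cell_union X ?L \<union> ?C \<subseteq> cell_union X K"
        unfolding closed_cell_eq by blast
    qed
    have Ctop: "?C \<subseteq> topspace (cw_space X)"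
      using closedin_subset[OF closedin_closed_cell[OF \<tau>]] .
    have on_C: "continuous_map (subtopology (cw_space X) ?C) ?S (cell_pinch X \<tau>)"
    proof (rule continuous_compose_quotient_map)
      show "quotient_map (disc (cdim X \<tau>)) (subtopology (cw_space X) ?C) (chmap X \<tau>)"
        using continuous_chmap[OF \<tau>] Ctop
        by (intro T1_Spaces.continuous_imp_quotient_map compact_space_disc Hausdorff_space_subtopology Hausdorff_cw)
           (auto simp: continuous_map_in_subtopology closed_cell_def)
      show "continuous_map (disc (cdim X \<tau>)) ?S (cell_pinch X \<tau> \<circ> chmap X \<tau>)"
        using continuous_map_disc_collapse by (rule continuous_map_eq) (simp add: cell_pinch_chmap[OF \<tau>])
    qed
    let ?Z = "subtopology (cw_space X) (cell_union X K)"
    show ?thesis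
    proof (rule pasting_lemma_closed[where I = "{cell_union X ?L, ?C}" and T = id and f = "\<lambda>_. cell_pinch X \<tau>"])
      fix B assume B: "B \<in> {cell_union X ?L, ?C}"
      have "closedin (cw_space X) B" "B \<subseteq> cell_union X K"
        using B closedin_face_closed[OF L] closedin_closed_cell[OF \<tau>] KC by auto
      then show "closedin ?Z (id B)" by (simp add: closedin_subset_topspace)
      have "subtopology ?Z (id B) = subtopology (cw_space X) B"
        using \<open>B \<subseteq> cell_union X K\<close> by (simp add: subtopology_subtopology inf.absorb2)
      then show "continuous_map (subtopology ?Z (id B)) ?S (cell_pinch X \<tau>)"
        using B on_L on_C by auto
    next
      show "\<exists>j. j \<in> {cell_union X ?L, ?C} \<and> y \<in> id j \<and> cell_pinch X \<tau> y = cell_pinch X \<tau> y"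
        if "y \<in> topspace ?Z" for y
      proof -
        have "y \<in> cell_union X K" using that by simp
        then have "y \<in> cell_union X ?L \<union> ?C" by (subst (asm) KC)
        then show ?thesis by auto
      qed
    qed auto
  qed
qed

text \<open>Let \<open>Y\<close> and \<open>A\<close> be the skeleta of dimensions \<open>n + 1\<close> and \<open>n\<close>. The induction principle for
  \<open>H\<^sub>n\<^sub>+\<^sub>1(Y, A)\<close> shows that for every class \<open>x\<close> there are integers \<open>m \<tau>\<close> such that the pinch onto \<open>\<tau>\<close>
  maps \<open>x\<close> to the power \<open>m \<tau>\<close> of a fixed element, while the connecting homomorphism followed by the
  pinch onto \<open>\<rho>\<close> yields the power \<open>\<Sum>\<^sub>\<tau> m \<tau> * incidence X \<tau> \<rho>\<close> of a generator. The class of the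
  attaching map of \<open>\<sigma>\<close> comes from \<open>H\<^sub>n\<^sub>+\<^sub>1(Y)\<close>, so the latter exponent is zero, while its pinch onto
  \<open>\<tau>\<close> has degree \<open>incidence X \<sigma> \<tau>\<close>. The fixed element is some power \<open>k\<close> of a generator, so these
  degrees are \<open>k * m \<tau>\<close>, and \<open>k\<close> factors out of the sum whatever orientations were chosen.\<close>

theorem incidence_incidence_skeleton:
  assumes \<sigma>: "\<sigma> \<in> cells X" "cdim X \<sigma> = Suc (Suc n)" and \<rho>: "\<rho> \<in> cells X" "cdim X \<rho> = n"
  shows "(\<Sum>\<tau> | \<tau> \<in> cells X \<and> cdim X \<tau> = Suc n. incidence X \<sigma> \<tau> * incidence X \<tau> \<rho>) = 0"
proof -
  let ?p = "int (Suc n)"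
  have p1 [simp]: "?p - 1 = int n" by simp
  note of_nat_Suc [simp del] one_relative_homology_group [simp del]
  define K where "K = {\<tau> \<in> cells X. cdim X \<tau> \<le> n}"
  define F where "F = {\<tau> \<in> cells X. cdim X \<tau> = Suc n}"
  define A where "A = cell_union X K"
  define Y where "Y = subtopology (cw_space X) (cell_union X (K \<union> F))"
  let ?S = "nsphere (Suc n)" and ?D = "disc (Suc n)" and ?B = "disc_boundary (Suc n)"
  let ?s = "south_pole (Suc n)" and ?HD = "relative_homology_group ?p ?D ?B"
  let ?H = "relative_homology_group ?p Y A"
  let ?R = "reduced_homology_group (int n) (nsphere n)"
  let ?T = "relative_homology_group ?p ?S {?s}"
  have fin: "finite F" using finite_cells by (auto simp: F_def)
  have KF: "K \<union> F = {\<tau> \<in> cells X. cdim X \<tau> \<le> Suc n}" by (auto simp: K_def F_def)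
  have fK: "face_closed X K" unfolding K_def by (rule face_closed_skeleton)
  have fKF: "face_closed X (K \<union> F)" unfolding KF by (rule face_closed_skeleton)
  have AKF: "A \<subseteq> cell_union X (K \<union> F)" by (auto simp: A_def cell_union_def)
  have YA: "subtopology Y A = subtopology (cw_space X) A"
    unfolding Y_def using AKF by (simp add: subtopology_subtopology inf.absorb2)
  have attach: "chmap X \<tau> ` disc_boundary (cdim X \<tau>) \<subseteq> A" if "\<tau> \<in> F" for \<tau>
  proof -
    have "{\<kappa> \<in> cells X. cdim X \<kappa> < cdim X \<tau>} = K" using that by (auto simp: K_def F_def)
    then show ?thesis using attaching_in_lower_cells[of \<tau>] that by (simp add: A_def F_def)
  qed
  have char: "continuous_map ?D Y (chmap X \<tau>)" "chmap X \<tau> ` ?B \<subseteq> A" if "\<tau> \<in> F" for \<tau>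
  proof -
    have d: "cdim X \<tau> = Suc n" "\<tau> \<in> cells X" using that by (auto simp: F_def)
    show "chmap X \<tau> ` ?B \<subseteq> A" using attach[OF that] d by simp
    moreover have "open_cell X \<tau> \<subseteq> cell_union X (K \<union> F)" using that by (auto simp: cell_union_def)
    ultimately have "chmap X \<tau> ` topspace ?D \<subseteq> cell_union X (K \<union> F)"
      using AKF d by (auto simp: disc_split open_cell_def)
    then show "continuous_map ?D Y (chmap X \<tau>)"
      unfolding Y_def using continuous_chmap[OF d(2)] d by (auto simp: continuous_map_in_subtopology)
  qed
  have pinch: "continuous_map Y ?S (cell_pinch X \<tau>)" "cell_pinch X \<tau> ` A \<subseteq> {?s}" if "\<tau> \<in> F" for \<tau>
  proof -
    have d: "cdim X \<tau> = Suc n" "\<tau> \<in> cells X" "\<tau> \<notin> K" using that by (auto simp: F_def K_def)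
    show "continuous_map Y ?S (cell_pinch X \<tau>)"
      unfolding Y_def d(1)[symmetric]
      by (rule continuous_map_cell_pinch[OF fKF d(2)]) (auto simp: KF d)
    show "cell_pinch X \<tau> ` A \<subseteq> {?s}"
      using in_cell_union_iff[OF d(2), of K] d fK cell_pinch_off[of _ \<tau>] by (auto simp: A_def face_closed_def)
  qed
  have pinch_\<rho>: "continuous_map (subtopology Y A) (nsphere n) (cell_pinch X \<rho>)"
    unfolding YA unfolding A_def \<rho>(2)[symmetric] by (rule continuous_map_cell_pinch[OF fK \<rho>(1)]) (auto simp: K_def \<rho>)

  \<comment> \<open>As the disc is contractible, its relative homology is infinite cyclic; the generator \<open>e\<close> is
    chosen over the generator \<open>u\<close> of the reduced homology of the boundary sphere.\<close>
  obtain u where u: "u \<in> carrier ?R"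
      and u_gen: "\<And>x. x \<in> carrier ?R \<Longrightarrow> \<exists>m::int. x = u [^]\<^bsub>?R\<^esub> m"
      and u_inj: "\<And>m k::int. u [^]\<^bsub>?R\<^esub> m = u [^]\<^bsub>?R\<^esub> k \<longleftrightarrow> m = k"
    by (rule nsphere_generator[of n], rule that)
  have bd_iso: "hom_boundary ?p ?D ?B \<in> iso ?HD ?R"
  proof -
    have "topspace ?D \<inter> ?B \<noteq> {}"
      using south_pole_sphere[of n] topspace_nsphere_eq_disc_boundary disc_split by blast
    from iso_relative_homology_of_contractible[OF contractible_space_disc this, of ?p] show ?thesis
      by (simp add: subtopology_disc_boundary)
  qed
  interpret D: comm_group "?HD" by simp
  interpret H: comm_group ?H by simp
  interpret T: comm_group ?T by simp
  interpret R: group ?R by simp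
  interpret bd: group_hom "?HD" ?R "hom_boundary ?p ?D ?B"
    using bd_iso by (simp add: group_hom_def group_hom_axioms_def iso_def)
  obtain e where e: "e \<in> carrier ?HD" and ue: "u = hom_boundary ?p ?D ?B e"
    using bd_iso u unfolding iso_iff by blast
  have bd_inj: "inj_on (hom_boundary ?p ?D ?B) (carrier ?HD)"
    using bd_iso unfolding iso_iff by blast
  have e_gen: "\<exists>m::int. x = e [^]\<^bsub>?HD\<^esub> m" if x: "x \<in> carrier ?HD" for x
  proof -
    obtain m :: int where "hom_boundary ?p ?D ?B x = u [^]\<^bsub>?R\<^esub> m"
      using u_gen bd.hom_closed[OF x] by blast
    also have "\<dots> = hom_boundary ?p ?D ?B (e [^]\<^bsub>?HD\<^esub> m)"
      unfolding ue by (rule bd.hom_int_pow[OF e, symmetric])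
    finally have "x = e [^]\<^bsub>?HD\<^esub> m"
      by (rule inj_onD[OF bd_inj _ x D.int_pow_closed[OF e]])
    then show ?thesis ..
  qed

  define b where "b = hom_induced n (subtopology Y A) {} (nsphere n) {} (cell_pinch X \<rho>) \<circ> hom_boundary ?p Y A"
  have b_hom: "b \<in> hom ?H ?R"
    unfolding b_def using hom_boundary_reduced_hom[of ?p Y A] hom_induced_reduced_hom
    by (intro hom_compose) auto
  interpret b: group_hom ?H ?R b by (intro group_hom.intro group_hom_axioms.intro b_hom) simp_all
  let ?q = "\<lambda>\<tau>. hom_induced ?p Y A ?S {?s} (cell_pinch X \<tau>)"
  define e' where "e' = hom_induced ?p ?D ?B ?S {?s} (disc_collapse (Suc n)) e"
  have e': "e' \<in> carrier ?T" unfolding e'_def by (rule hom_induced_carrier)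

  define good where "good = (\<lambda>x. \<exists>m::'c \<Rightarrow> int. (\<forall>\<tau>\<in>F. ?q \<tau> x = e' [^]\<^bsub>?T\<^esub> m \<tau>) \<and> b x = u [^]\<^bsub>?R\<^esub> (\<Sum>\<tau>\<in>F. m \<tau> * incidence X \<tau> \<rho>))"
  have key: "good x" if "x \<in> carrier ?H" for x
  proof (rule relative_homology_cell_induct[OF fK, where F = F and p = ?p and x = x and P = good, folded A_def Y_def])
    show "F \<subseteq> cells X" "F \<inter> K = {}" by (auto simp: F_def K_def)
    show "x \<in> carrier ?H" by (rule that)
    show "chmap X \<tau> ` disc_boundary (cdim X \<tau>) \<subseteq> A" if "\<tau> \<in> F" for \<tau> by (rule attach[OF that])
    show "good \<one>\<^bsub>?H\<^esub>"
      unfolding good_def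
      by (rule exI[of _ "\<lambda>_. 0"]) (simp add: hom_one[OF hom_induced_hom])
  next
    fix x y
    assume x: "x \<in> carrier ?H" and y: "y \<in> carrier ?H"
    assume "good x" "good y"
    then obtain m k :: "'c \<Rightarrow> int" where
      m: "\<forall>\<tau>\<in>F. ?q \<tau> x = e' [^]\<^bsub>?T\<^esub> m \<tau>" "b x = u [^]\<^bsub>?R\<^esub> (\<Sum>\<tau>\<in>F. m \<tau> * incidence X \<tau> \<rho>)" and
      k: "\<forall>\<tau>\<in>F. ?q \<tau> y = e' [^]\<^bsub>?T\<^esub> k \<tau>" "b y = u [^]\<^bsub>?R\<^esub> (\<Sum>\<tau>\<in>F. k \<tau> * incidence X \<tau> \<rho>)"
      unfolding good_def by blast
    show "good (x \<otimes>\<^bsub>?H\<^esub> y)"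
      unfolding good_def
    proof (intro exI conjI ballI)
      show "?q \<tau> (x \<otimes>\<^bsub>?H\<^esub> y) = e' [^]\<^bsub>?T\<^esub> (m \<tau> + k \<tau>)" if "\<tau> \<in> F" for \<tau>
        using m k that e' by (simp add: hom_mult[OF hom_induced_hom x y] T.int_pow_mult)
      show "b (x \<otimes>\<^bsub>?H\<^esub> y) = u [^]\<^bsub>?R\<^esub> (\<Sum>\<tau>\<in>F. (m \<tau> + k \<tau>) * incidence X \<tau> \<rho>)"
        using m k u x y by (simp add: R.int_pow_mult distrib_right sum.distrib)
    qed
  next
    fix \<tau> v
    assume \<tau>: "\<tau> \<in> F" and v0: "v \<in> carrier (relative_homology_group ?p (disc (cdim X \<tau>)) (disc_boundary (cdim X \<tau>)))"
    have d: "cdim X \<tau> = Suc n" and \<tau>X: "\<tau> \<in> cells X" using \<tau> by (auto simp: F_def)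
    have v: "v \<in> carrier ?HD" using v0 d by simp
    obtain m :: int where m: "v = e [^]\<^bsub>?HD\<^esub> m" using e_gen[OF v] by blast
    let ?v = "hom_induced ?p ?D ?B Y A (chmap X \<tau>) v"
    have q: "?q \<kappa> ?v = e' [^]\<^bsub>?T\<^esub> (if \<kappa> = \<tau> then m else 0)" if \<kappa>: "\<kappa> \<in> F" for \<kappa>
    proof -
      have "?q \<kappa> ?v = hom_induced ?p ?D ?B ?S {?s} (cell_pinch X \<kappa> \<circ> chmap X \<tau>) v"
        using char[OF \<tau>] pinch[OF \<kappa>] by (subst hom_induced_compose') auto
      also have "\<dots> = e' [^]\<^bsub>?T\<^esub> (if \<kappa> = \<tau> then m else 0)"
      proof (cases "\<kappa> = \<tau>")
        case True
        have "hom_induced ?p ?D ?B ?S {?s} (cell_pinch X \<kappa> \<circ> chmap X \<tau>) v = hom_induced ?p ?D ?B ?S {?s} (disc_collapse (Suc n)) v"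
          by (rule fun_cong[OF hom_induced_eq]) (use True cell_pinch_chmap[OF \<tau>X] d in auto)
        also have "\<dots> = e' [^]\<^bsub>?T\<^esub> m"
          unfolding m e'_def by (rule hom_int_pow[OF hom_induced_hom e D.is_group T.is_group])
        finally show ?thesis using True by simp
      next
        case False
        have "hom_induced ?p ?D ?B ?S {?s} (cell_pinch X \<kappa> \<circ> chmap X \<tau>) v = hom_induced ?p ?D ?B ?S {?s} (\<lambda>_. ?s) v"
          by (rule fun_cong[OF hom_induced_eq]) (use False cell_pinch_other[of \<kappa> \<tau>] \<kappa> \<tau>X d in \<open>auto simp: F_def\<close>)
        then show ?thesis using False by (simp add: hom_induced_const south_pole_sphere)
      qed
      finally show ?thesis .
    qed
    have "b ?v = u [^]\<^bsub>?R\<^esub> (m * incidence X \<tau> \<rho>)"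
    proof -
      have "hom_boundary ?p Y A ?v = hom_induced n (nsphere n) {} (subtopology Y A) {} (chmap X \<tau>) (hom_boundary ?p ?D ?B v)"
        using fun_cong[OF naturality_hom_induced[OF char(1)[OF \<tau>], of ?B A ?p], of v] char(2)[OF \<tau>]
        by (auto simp: subtopology_disc_boundary)
      moreover have "continuous_map (nsphere n) (subtopology Y A) (chmap X \<tau>)"
        unfolding subtopology_disc_boundary[symmetric] using char[OF \<tau>]
        by (auto simp: continuous_map_in_subtopology continuous_map_from_subtopology)
      ultimately have "b ?v = hom_induced n (nsphere n) {} (nsphere n) {} (cell_pinch X \<rho> \<circ> chmap X \<tau>) (hom_boundary ?p ?D ?B v)"
        unfolding b_def o_apply using pinch_\<rho> by (simp add: hom_induced_compose' o_def)
      also have "\<dots> = (hom_boundary ?p ?D ?B v) [^]\<^bsub>?R\<^esub> incidence X \<tau> \<rho>"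
        unfolding incidence_def using d \<rho> bd.hom_closed[OF v] by (simp add: Brouwer_degree2)
      also have "hom_boundary ?p ?D ?B v = u [^]\<^bsub>?R\<^esub> m"
        unfolding m ue by (rule bd.hom_int_pow[OF e])
      finally show ?thesis using u by (simp add: R.int_pow_pow)
    qed
    moreover have "(\<Sum>\<kappa>\<in>F. (if \<kappa> = \<tau> then m else 0) * incidence X \<kappa> \<rho>) = m * incidence X \<tau> \<rho>"
      using \<tau> fin by (simp add: if_distrib[of "\<lambda>x. x * _"] cong: if_cong)
    ultimately show "good (hom_induced ?p (disc (cdim X \<tau>)) (disc_boundary (cdim X \<tau>)) Y A (chmap X \<tau>) v)"
      unfolding good_def d using q by (intro exI[of _ "\<lambda>\<kappa>. if \<kappa> = \<tau> then m else 0"]) simp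
  qed

  \<comment> \<open>The class that the attaching map of \<open>\<sigma>\<close> induces in \<open>H\<^sub>n\<^sub>+\<^sub>1(Y, A)\<close> is killed by the
    boundary map, and its exponents are the incidence numbers up to the common factor \<open>k\<close>.\<close>
  let ?f = "chmap X \<sigma>" and ?RS = "reduced_homology_group ?p ?S"
  obtain g where g: "g \<in> carrier ?RS"
      and g_gen: "\<And>x. x \<in> carrier ?RS \<Longrightarrow> \<exists>m::int. x = g [^]\<^bsub>?RS\<^esub> m"
      and g_inj: "\<And>m k::int. g [^]\<^bsub>?RS\<^esub> m = g [^]\<^bsub>?RS\<^esub> k \<longleftrightarrow> m = k"
    by (rule nsphere_generator[of "Suc n"], rule that)
  have f: "continuous_map ?S Y ?f"
  proof -
    have "{\<kappa> \<in> cells X. cdim X \<kappa> < cdim X \<sigma>} = K \<union> F" unfolding KF \<sigma>(2) less_Suc_eq_le ..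
    then have "?f ` disc_boundary (Suc (Suc n)) \<subseteq> cell_union X (K \<union> F)"
      using attaching_in_lower_cells[OF \<sigma>(1)] \<sigma>(2) by simp
    then show ?thesis
      unfolding subtopology_disc_boundary[of "Suc n", symmetric] Y_def
      using continuous_chmap[OF \<sigma>(1)] \<sigma>(2) by (auto simp: continuous_map_in_subtopology continuous_map_from_subtopology)
  qed
  define y where "y = hom_induced ?p ?S {} Y {} ?f g"
  define x where "x = hom_induced ?p Y {} Y A id y"
  have y: "y \<in> carrier (homology_group ?p Y)" unfolding y_def by (rule hom_induced_carrier)
  have x: "x \<in> carrier ?H" unfolding x_def by (rule hom_induced_carrier)
  have "hom_boundary ?p Y A x = \<one>\<^bsub>homology_group (?p - 1) (subtopology Y A)\<^esub>"
    using homology_exactness_axiom_1[of ?p Y A] y unfolding x_def by (auto simp: kernel_def)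
  then have bx: "b x = \<one>\<^bsub>?R\<^esub>"
    unfolding b_def by (simp add: hom_one[OF hom_induced_hom] one_reduced_homology_group)
  obtain m :: "'c \<Rightarrow> int" where m: "\<And>\<tau>. \<tau> \<in> F \<Longrightarrow> ?q \<tau> x = e' [^]\<^bsub>?T\<^esub> m \<tau>"
      and m_sum: "b x = u [^]\<^bsub>?R\<^esub> (\<Sum>\<tau>\<in>F. m \<tau> * incidence X \<tau> \<rho>)"
    using key[OF x] unfolding good_def by blast
  have sum0: "(\<Sum>\<tau>\<in>F. m \<tau> * incidence X \<tau> \<rho>) = 0"
    using bx m_sum u_inj[of _ 0] by simp

  let ?j = "hom_induced ?p ?S {} ?S {?s} id"
  have j_iso: "?j \<in> iso ?RS ?T"
    using iso_reduced_homology_by_contractible[of ?S "{?s}" ?p] south_pole_sphere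
    by (simp add: contractible_space_subtopology_singleton)
  have j_inj: "inj_on ?j (carrier ?RS)"
    using j_iso unfolding iso_iff by blast
  interpret RS: group ?RS by simp
  interpret j: group_hom ?RS ?T ?j
    using j_iso by (simp add: group_hom_def group_hom_axioms_def iso_def)
  obtain k :: int where k: "e' = ?j (g [^]\<^bsub>?RS\<^esub> k)"
  proof -
    have "?j ` carrier ?RS = carrier ?T"
      using j_iso unfolding iso_iff by (elim conjE)
    then have "e' \<in> ?j ` carrier ?RS" using e' by (simp only:)
    then obtain z where z: "z \<in> carrier ?RS" "e' = ?j z" by (elim imageE)
    obtain k :: int where "z = g [^]\<^bsub>?RS\<^esub> k" using g_gen[OF z(1)] ..
    then show thesis using that z(2) by simp
  qed
  have inc: "incidence X \<sigma> \<tau> = k * m \<tau>" if \<tau>: "\<tau> \<in> F" for \<tau>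
  proof -
    have d: "cdim X \<tau> = Suc n" using \<tau> by (simp add: F_def)
    have "?j (g [^]\<^bsub>?RS\<^esub> (k * m \<tau>)) = ?q \<tau> x"
      unfolding m[OF \<tau>] k using g by (simp add: j.hom_int_pow[symmetric] RS.int_pow_pow)
    also have "\<dots> = hom_induced ?p ?S {} ?S {?s} (cell_pinch X \<tau> \<circ> ?f) g"
      unfolding x_def y_def using f pinch[OF \<tau>]
      by (subst hom_induced_compose'; (subst hom_induced_compose')?) auto
    also have "\<dots> = ?j (hom_induced ?p ?S {} ?S {} (cell_pinch X \<tau> \<circ> ?f) g)"
      using continuous_map_compose[OF f pinch(1)[OF \<tau>]] by (subst hom_induced_compose') auto
    also have "hom_induced ?p ?S {} ?S {} (cell_pinch X \<tau> \<circ> ?f) g = g [^]\<^bsub>?RS\<^esub> incidence X \<sigma> \<tau>"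
      using Brouwer_degree2[OF g] \<sigma> d by (simp add: incidence_def)
    finally have "g [^]\<^bsub>?RS\<^esub> (k * m \<tau>) = g [^]\<^bsub>?RS\<^esub> incidence X \<sigma> \<tau>"
      by (rule inj_onD[OF j_inj _ RS.int_pow_closed[OF g] RS.int_pow_closed[OF g]])
    then show ?thesis using g_inj by simp
  qed
  have "(\<Sum>\<tau>\<in>F. incidence X \<sigma> \<tau> * incidence X \<tau> \<rho>) = k * (\<Sum>\<tau>\<in>F. m \<tau> * incidence X \<tau> \<rho>)"
    by (simp add: inc sum_distrib_left mult.assoc)
  then show ?thesis using sum0 by (simp add: F_def)
qed

theorem incidence_incidence:
  assumes "\<sigma> \<in> cells X" "\<rho> \<in> cells X"
  shows "(\<Sum>\<tau>\<in>cells X. incidence X \<sigma> \<tau> * incidence X \<tau> \<rho>) = 0"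
proof (cases "cdim X \<sigma> = Suc (Suc (cdim X \<rho>))")
  case True
  have "(\<Sum>\<tau>\<in>cells X. incidence X \<sigma> \<tau> * incidence X \<tau> \<rho>) =
      (\<Sum>\<tau> | \<tau> \<in> cells X \<and> cdim X \<tau> = Suc (cdim X \<rho>). incidence X \<sigma> \<tau> * incidence X \<tau> \<rho>)"
    by (rule sum.mono_neutral_right) (use finite_cells in \<open>auto simp: incidence_def\<close>)
  then show ?thesis using incidence_incidence_skeleton[OF assms(1) True assms(2) refl] by simp
qed (auto simp: incidence_def intro!: sum.neutral)

end

section \<open>Coordinates with respect to a basis\<close>

definition coord_mat :: "'v::real_vector list \<Rightarrow> 'v list \<Rightarrow> real mat" where
  "coord_mat bs cs = Matrix.mat (length bs) (length cs)
     (\<lambda>(i, j). representation (set bs) (cs ! j) (bs ! i))"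

abbreviation coord_det :: "'v::real_vector list \<Rightarrow> 'v list \<Rightarrow> real" where
  "coord_det bs cs \<equiv> Determinant.det (coord_mat bs cs)"

lemma coord_mat_carrier [simp]: "coord_mat bs cs \<in> carrier_mat (length bs) (length cs)"
  by (simp add: coord_mat_def)

lemma dim_coord_mat [simp]:
  "dim_row (coord_mat bs cs) = length bs" "dim_col (coord_mat bs cs) = length cs"
  by (simp_all add: coord_mat_def)

lemma coord_mat_index [simp]:
  "i < length bs \<Longrightarrow> j < length cs \<Longrightarrow> coord_mat bs cs $$ (i, j) = representation (set bs) (cs ! j) (bs ! i)"
  by (simp add: coord_mat_def)

lemma sum_list_index: "distinct bs \<Longrightarrow> (\<Sum>i<length bs. f (bs ! i)) = sum f (set bs)"
  by (simp add: sum.distinct_set_conv_list sum_list_sum_nth atLeast0LessThan)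

lemma sum_representation_list:
  assumes "distinct bs" "independent (set bs)" "v \<in> span (set bs)"
  shows "(\<Sum>i<length bs. representation (set bs) v (bs ! i) *\<^sub>R bs ! i) = v"
  using sum_list_index[OF assms(1), of "\<lambda>b. representation (set bs) v b *\<^sub>R b"]
    real_vector.sum_representation_eq[OF assms(2,3)] by simp

lemma representation_comb:
  fixes B :: "'v::real_vector set"
  assumes "independent B" "finite I" "\<And>i. i \<in> I \<Longrightarrow> v i \<in> span B"
  shows "representation B (\<Sum>i\<in>I. a i *\<^sub>R v i) b = (\<Sum>i\<in>I. a i * representation B (v i) b)"
  using assms
  by (subst real_vector.representation_sum[OF assms(1)])
     (auto simp: real_vector.representation_scale[OF assms(1)] span_scale)

lemma representation_sum_list:
  fixes bs :: "'v::real_vector list"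
  assumes "distinct bs" "independent (set bs)" "k < length bs"
  shows "representation (set bs) (\<Sum>i<length bs. a i *\<^sub>R bs ! i) (bs ! k) = a k"
proof -
  have "representation (set bs) (\<Sum>i<length bs. a i *\<^sub>R bs ! i) (bs ! k)
      = (\<Sum>i<length bs. a i * representation (set bs) (bs ! i) (bs ! k))"
    by (rule representation_comb) (use assms in \<open>auto intro: span_base\<close>)
  also have "\<dots> = (\<Sum>i<length bs. if i = k then a i else 0)"
    using assms by (intro sum.cong) (auto simp: real_vector.representation_basis nth_eq_iff_index_eq)
  also have "\<dots> = a k" using assms by simp
  finally show ?thesis .
qed

text \<open>The chain rule for changes of basis. All comparisons of bases below reduce to it.\<close>

lemma coord_mat_mult:
  fixes as bs cs :: "'v::real_vector list"
  assumes "distinct as" "independent (set as)" "distinct bs" "independent (set bs)"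
    and "set bs \<subseteq> span (set as)" "set cs \<subseteq> span (set bs)"
  shows "coord_mat as cs = coord_mat as bs * coord_mat bs cs"
proof (rule eq_matI)
  fix i j assume i: "i < dim_row (coord_mat as bs * coord_mat bs cs)" and j: "j < dim_col (coord_mat as bs * coord_mat bs cs)"
  have cj: "cs ! j \<in> span (set bs)" using assms(6) j nth_mem by auto
  have "representation (set as) (cs ! j) (as ! i)
      = representation (set as) (\<Sum>k<length bs. representation (set bs) (cs ! j) (bs ! k) *\<^sub>R bs ! k) (as ! i)"
    using sum_representation_list[OF assms(3,4) cj] by simp
  also have "\<dots> = (\<Sum>k<length bs. representation (set bs) (cs ! j) (bs ! k) * representation (set as) (bs ! k) (as ! i))"
    by (rule representation_comb) (use assms in auto)
  also have "\<dots> = (coord_mat as bs * coord_mat bs cs) $$ (i, j)"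
    using i j by (simp add: scalar_prod_def atLeast0LessThan mult.commute)
  finally show "coord_mat as cs $$ (i, j) = (coord_mat as bs * coord_mat bs cs) $$ (i, j)"
    using i j by simp
qed simp_all

lemma coord_mat_refl:
  assumes "distinct bs" "independent (set bs)"
  shows "coord_mat bs bs = 1\<^sub>m (length bs)"
  using assms by (intro eq_matI) (auto simp: real_vector.representation_basis nth_eq_iff_index_eq)

lemma length_eq_if_span_eq:
  fixes bs cs :: "'v::euclidean_space list"
  assumes "distinct bs" "independent (set bs)" "distinct cs" "independent (set cs)" "span (set bs) = span (set cs)"
  shows "length bs = length cs"
  using assms by (metis dim_span_eq_card_independent distinct_card)

lemma det_coord_mat_inverse:
  fixes bs cs :: "'v::euclidean_space list"
  assumes "distinct bs" "independent (set bs)" "distinct cs" "independent (set cs)" "span (set bs) = span (set cs)"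
  shows "coord_det bs cs * coord_det cs bs = 1"
proof -
  have len: "length cs = length bs" using length_eq_if_span_eq[OF assms] by simp
  have "coord_mat bs cs * coord_mat cs bs = coord_mat bs bs"
    using assms span_superset[of "set bs"] span_superset[of "set cs"]
    by (intro coord_mat_mult[symmetric]) auto
  then have "Determinant.det (coord_mat bs cs * coord_mat cs bs) = 1"
    using coord_mat_refl[OF assms(1,2)] by simp
  then show ?thesis
    using len coord_mat_carrier[of bs cs] coord_mat_carrier[of cs bs] by (simp add: Determinant.det_mult)
qed

text \<open>Changing the basis conjugates the matrix of \<open>f\<close>.\<close>

lemma endo_det_eq:
  fixes f :: "'v::euclidean_space \<Rightarrow> 'v"
  assumes f: "linear f" "f ` V \<subseteq> V" and bs: "ordered_basis V bs"
  shows "endo_det V f = coord_det bs (map f bs)"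
proof -
  define cs where "cs = (SOME cs. ordered_basis V cs)"
  have cs: "ordered_basis V cs" unfolding cs_def using bs by (rule someI)
  have b: "distinct bs" "independent (set bs)" "span (set bs) = V"
    and c: "distinct cs" "independent (set cs)" "span (set cs) = V"
    using bs cs by (auto simp: ordered_basis_def)
  have len: "length cs = length bs" using length_eq_if_span_eq b c by metis
  have sub: "set cs \<subseteq> V" "set bs \<subseteq> V" using b c span_superset by blast+
  have mat: "matrix_wrt cs f = coord_mat cs (map f cs)"
    by (rule eq_matI) (auto simp: matrix_wrt_def)
  have "coord_mat cs (map f cs) = coord_mat cs bs * coord_mat bs (map f cs)"
    using b c sub f(2) by (intro coord_mat_mult) (auto simp: image_subset_iff subset_iff)
  also have "coord_mat bs (map f cs) = coord_mat bs (map f bs) * coord_mat bs cs"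
  proof (rule eq_matI)
    fix i j assume i: "i < dim_row (coord_mat bs (map f bs) * coord_mat bs cs)" and j: "j < dim_col (coord_mat bs (map f bs) * coord_mat bs cs)"
    then have j': "j < length cs" by simp
    have cj: "cs ! j \<in> span (set bs)" using j' sub b by auto
    have fb: "f (bs ! k) \<in> span (set bs)" if "k < length bs" for k
      using that sub(2) f(2) b(3) nth_mem[OF that] by blast
    have "f (cs ! j) = f (\<Sum>k<length bs. representation (set bs) (cs ! j) (bs ! k) *\<^sub>R bs ! k)"
      by (simp only: sum_representation_list[OF b(1,2) cj])
    then have "f (cs ! j) = (\<Sum>k<length bs. representation (set bs) (cs ! j) (bs ! k) *\<^sub>R f (bs ! k))"
      by (simp only: linear_sum[OF f(1)] linear_scale[OF f(1)])
    then have "representation (set bs) (f (cs ! j)) (bs ! i)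
        = (\<Sum>k<length bs. representation (set bs) (cs ! j) (bs ! k) * representation (set bs) (f (bs ! k)) (bs ! i))"
      using b(1,2) by (simp only:) (rule representation_comb, auto simp: fb)
    then show "coord_mat bs (map f cs) $$ (i, j) = (coord_mat bs (map f bs) * coord_mat bs cs) $$ (i, j)"
      using i j by (simp add: scalar_prod_def atLeast0LessThan mult.commute)
  qed simp_all
  finally have eq: "coord_mat cs (map f cs) = coord_mat cs bs * (coord_mat bs (map f bs) * coord_mat bs cs)" .
  have carr: "coord_mat cs bs \<in> carrier_mat (length bs) (length bs)"
    "coord_mat bs (map f bs) \<in> carrier_mat (length bs) (length bs)"
    "coord_mat bs cs \<in> carrier_mat (length bs) (length bs)"
    using coord_mat_carrier[of cs bs] coord_mat_carrier[of bs "map f bs"] coord_mat_carrier[of bs cs] len by auto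
  have "Determinant.det (matrix_wrt cs f) = coord_det cs bs *
      (coord_det bs (map f bs) * coord_det bs cs)"
    unfolding mat eq using carr by (simp add: Determinant.det_mult[of _ "length bs"])
  also have "\<dots> = coord_det bs (map f bs)"
    using det_coord_mat_inverse[OF b(1,2) c(1,2)] unfolding b(3) c(3) by (simp add: mult.commute mult.left_commute)
  finally show ?thesis by (simp only: endo_det_def cs_def)
qed

section \<open>Lattices and their indices\<close>

text \<open>The lattice generated by a linearly independent set, described by coordinates.\<close>

definition int_comb :: "'v::real_vector set \<Rightarrow> 'v set" where
  "int_comb B = {x \<in> span B. \<forall>b\<in>B. representation B x b \<in> \<int>}"

lemma lattice_basis_iff:
  "lattice_basis \<Lambda> bs \<longleftrightarrow> distinct bs \<and> independent (set bs) \<and> \<Lambda> = int_comb (set bs)"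
proof -
  have "{\<Sum>i<length bs. of_int (c i) *\<^sub>R bs ! i |c :: nat \<Rightarrow> int. True} = int_comb (set bs)"
    if d: "distinct bs" and ind: "independent (set bs)"
  proof (intro equalityI subsetI)
    fix x assume "x \<in> {\<Sum>i<length bs. of_int (c i) *\<^sub>R bs ! i |c :: nat \<Rightarrow> int. True}"
    then obtain c :: "nat \<Rightarrow> int" where x: "x = (\<Sum>i<length bs. of_int (c i) *\<^sub>R bs ! i)" by blast
    have "representation (set bs) x b \<in> \<int>" if "b \<in> set bs" for b
    proof -
      obtain k where "k < length bs" "b = bs ! k" using \<open>b \<in> set bs\<close> by (metis in_set_conv_nth)
      then show ?thesis unfolding x by (simp add: representation_sum_list[OF d ind])
    qed
    moreover have "x \<in> span (set bs)"
      unfolding x by (intro span_sum span_scale span_base) auto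
    ultimately show "x \<in> int_comb (set bs)" by (simp add: int_comb_def)
  next
    fix x assume x: "x \<in> int_comb (set bs)"
    then have xs: "x \<in> span (set bs)" by (simp add: int_comb_def)
    have "x = (\<Sum>i<length bs. of_int \<lfloor>representation (set bs) x (bs ! i)\<rfloor> *\<^sub>R bs ! i)"
      using sum_representation_list[OF d ind xs, symmetric] x
      by (auto simp: int_comb_def intro!: sum.cong elim!: trans)
    then show "x \<in> {\<Sum>i<length bs. of_int (c i) *\<^sub>R bs ! i |c :: nat \<Rightarrow> int. True}" by fastforce
  qed
  then show ?thesis by (auto simp: lattice_basis_def)
qed

lemma int_comb_diff:
  assumes "independent B" "x \<in> int_comb B" "y \<in> int_comb B"
  shows "x - y \<in> int_comb B"
  using assms by (auto simp: int_comb_def span_diff real_vector.representation_diff)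

lemma subset_int_comb: "independent B \<Longrightarrow> B \<subseteq> int_comb B"
  by (auto simp: int_comb_def real_vector.representation_basis span_base)

lemma int_comb_subset_span: "int_comb B \<subseteq> span B"
  by (auto simp: int_comb_def)

lemma span_int_comb: "independent B \<Longrightarrow> span (int_comb B) = span B"
  by (metis int_comb_subset_span span_minimal span_mono subset_antisym subset_int_comb subspace_span)

lemma det_Ints:
  fixes A :: "real mat"
  assumes "\<And>i j. i < dim_row A \<Longrightarrow> j < dim_row A \<Longrightarrow> A $$ (i, j) \<in> \<int>"
  shows "Determinant.det A \<in> \<int>"
proof -
  have "(\<Prod>i = 0..<dim_row A. A $$ (i, p i)) \<in> \<int>" if "p permutes {0..<dim_row A}" for p
    using that by (intro Ints_prod assms) (auto dest: permutes_in_image)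
  then show ?thesis
    unfolding Determinant.det_def by (auto intro!: Ints_sum Ints_mult)
qed

text \<open>The two matrices of base change are integral and inverse to each other.\<close>

lemma det_coord_mat_same_lattice:
  fixes bs cs :: "'v::euclidean_space list"
  assumes "lattice_basis \<Lambda> bs" "lattice_basis \<Lambda> cs"
  shows "\<bar>coord_det bs cs\<bar> = 1" "length bs = length cs"
proof -
  have b: "distinct bs" "independent (set bs)" "\<Lambda> = int_comb (set bs)"
    and c: "distinct cs" "independent (set cs)" "\<Lambda> = int_comb (set cs)"
    using assms by (auto simp: lattice_basis_iff)
  have sp: "span (set bs) = span (set cs)" using span_int_comb b c by metis
  show len: "length bs = length cs" using length_eq_if_span_eq[OF b(1,2) c(1,2) sp] .
  have int: "coord_det bs cs \<in> \<int>" if "int_comb (set bs) = int_comb (set cs)" "independent (set cs)" "length bs = length cs" for bs cs :: "'v list"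
  proof (rule det_Ints)
    fix i j assume ij: "i < dim_row (coord_mat bs cs)" "j < dim_row (coord_mat bs cs)"
    then have "cs ! j \<in> int_comb (set bs)"
      using subset_int_comb[OF that(2)] that(1,3) by auto
    then show "coord_mat bs cs $$ (i, j) \<in> \<int>" using ij that(3) by (simp add: int_comb_def)
  qed
  have prod: "coord_det bs cs * coord_det cs bs = 1"
    by (rule det_coord_mat_inverse[OF b(1,2) c(1,2) sp])
  obtain m n :: int where "coord_det bs cs = of_int m" "coord_det cs bs = of_int n"
    using int[of bs cs] int[of cs bs] b c len by (auto elim!: Ints_cases)
  moreover from this have "m * n = 1" using prod by (metis of_int_1 of_int_eq_iff of_int_mult)
  then have "\<bar>m\<bar> = 1" by (metis abs_mult abs_one zmult_eq_1_iff abs_minus_cancel)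
  ultimately show "\<bar>coord_det bs cs\<bar> = 1" by (metis of_int_1 of_int_abs)
qed

text \<open>A set of representatives of the cosets of \<open>Q\<close> in \<open>P\<close>, whose size is the index.\<close>

definition transversal :: "'v::ab_group_add set \<Rightarrow> 'v set \<Rightarrow> 'v set \<Rightarrow> bool" where
  "transversal P Q R \<longleftrightarrow> R \<subseteq> P \<and> (\<forall>x\<in>P. \<exists>!r. r \<in> R \<and> x - r \<in> Q)"

lemma int_comb_insert_iff:
  assumes ind: "independent (insert b B)" and b: "b \<notin> B"
  shows "x \<in> int_comb (insert b B) \<longleftrightarrow> (\<exists>m::int. x - of_int m *\<^sub>R b \<in> int_comb B)" (is "?l = ?r")
proof
  have indB: "independent B" using ind by (meson independent_mono subset_insertI)
  let ?C = "insert b B"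
  assume l: ?l
  then obtain m :: int where m: "representation ?C x b = of_int m" by (auto simp: int_comb_def elim: Ints_cases)
  let ?y = "x - of_int m *\<^sub>R b"
  have xs: "x \<in> span ?C" using l by (simp add: int_comb_def)
  have bs: "b \<in> span ?C" by (simp add: span_base)
  have ys: "?y \<in> span ?C" using xs bs by (intro span_diff span_scale)
  have rep: "representation ?C ?y c = representation ?C x c - of_int m * (if c = b then 1 else 0)" for c
    using xs bs ind by (simp add: real_vector.representation_diff real_vector.representation_scale span_scale real_vector.representation_basis)
  have "finite {c. representation ?C ?y c \<noteq> 0}" by (rule real_vector.finite_representation)
  have "?y = (\<Sum>c | representation ?C ?y c \<noteq> 0. representation ?C ?y c *\<^sub>R c)"
    using real_vector.sum_nonzero_representation_eq[OF ind ys] by simp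
  also have "\<dots> \<in> span B"
  proof (intro span_sum span_scale span_base)
    fix c assume "c \<in> {c. representation ?C ?y c \<noteq> 0}"
    then have "c \<in> ?C" "c \<noteq> b" using rep m real_vector.representation_ne_zero[of ?C ?y c] by auto
    then show "c \<in> B" by blast
  qed
  finally have yB: "?y \<in> span B" .
  have "representation B ?y = representation ?C ?y"
    using real_vector.representation_extend[OF ind yB subset_insertI] by simp
  then have "\<forall>c\<in>B. representation B ?y c \<in> \<int>"
    using rep l b by (auto simp: int_comb_def)
  then show ?r using yB by (auto simp: int_comb_def)
next
  let ?C = "insert b B"
  assume ?r
  then obtain m :: int where m: "x - of_int m *\<^sub>R b \<in> int_comb B" by blast
  have "int_comb B \<subseteq> int_comb ?C"
  proof
    fix y assume y: "y \<in> int_comb B"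
    then have yB: "y \<in> span B" by (simp add: int_comb_def)
    have "representation ?C y = representation B y"
      using real_vector.representation_extend[OF ind yB subset_insertI] by simp
    moreover have "representation B y b = 0" using real_vector.representation_ne_zero[of B y b] b by auto
    ultimately show "y \<in> int_comb ?C" using y span_mono[of B ?C] by (auto simp: int_comb_def)
  qed
  then have y: "x - of_int m *\<^sub>R b \<in> int_comb ?C" using m by blast
  have "of_int m *\<^sub>R b \<in> int_comb ?C"
    using ind by (auto simp: int_comb_def span_base span_scale real_vector.representation_scale real_vector.representation_basis)
  then have "0 - of_int m *\<^sub>R b \<in> int_comb ?C"
    using int_comb_diff[OF ind] subset_int_comb[OF ind] by (metis diff_self insertI1 subsetD)
  then have "(x - of_int m *\<^sub>R b) - (0 - of_int m *\<^sub>R b) \<in> int_comb ?C"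
    by (rule int_comb_diff[OF ind y])
  then show ?l by simp
qed

lemma int_subgroup_generator:
  fixes H :: "int set"
  assumes "0 \<in> H" "\<And>x y. x \<in> H \<Longrightarrow> y \<in> H \<Longrightarrow> x - y \<in> H"
  obtains h where "h \<ge> 0" "h \<in> H" "\<And>x. x \<in> H \<Longrightarrow> h dvd x"
proof (cases "H \<subseteq> {0}")
  case True
  then show thesis using that[of 0] assms(1) by auto
next
  case False
  have neg: "- x \<in> H" if "x \<in> H" for x using assms that by (metis diff_0)
  have add: "x + y \<in> H" if "x \<in> H" "y \<in> H" for x y using assms(2)[OF that(1) neg[OF that(2)]] by simp
  obtain x where x: "x \<in> H" "x > 0" using False neg by (metis insertI1 linorder_neqE_linordered_idom neg_0_less_iff_less subsetI)
  define P where "P = (\<lambda>n::nat. n > 0 \<and> int n \<in> H)"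
  have P: "P (nat x)" using x by (simp add: P_def)
  define h where "h = (LEAST n. P n)"
  have h: "h > 0" "int h \<in> H" using LeastI[of P, OF P] by (auto simp: P_def h_def)
  have mult_nat: "int n * int h \<in> H" for n
  proof (induction n)
    case (Suc n) then show ?case using add[OF Suc h(2)] by (simp add: algebra_simps)
  qed (simp add: assms(1))
  have mult: "k * int h \<in> H" for k
    using mult_nat[of "nat k"] neg[OF mult_nat[of "nat (- k)"]] by (cases "k \<ge> 0") auto
  have "int h dvd y" if y: "y \<in> H" for y
  proof (rule ccontr)
    assume "\<not> int h dvd y"
    then have pos: "y mod int h > 0" using h(1) by (metis dvd_eq_mod_eq_0 of_nat_0_less_iff order_less_le pos_mod_sign)
    have "y mod int h = y - (y div int h) * int h" by (simp add: minus_div_mult_eq_mod)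
    then have "P (nat (y mod int h))" using pos assms(2)[OF y mult] by (simp add: P_def)
    then have "h \<le> nat (y mod int h)" unfolding h_def by (rule Least_le)
    moreover have "y mod int h < int h" using h(1) by simp
    ultimately show False using pos by linarith
  qed
  then show thesis using that[of "int h"] h by auto
qed

text \<open>The Hermite normal form, built by induction on the basis \<open>b # bs\<close> of the ambient lattice. The
  coefficients of \<open>b\<close> in elements of \<open>Q\<close> form a subgroup \<open>h\<int>\<close> of the integers. If \<open>h = 0\<close>, then \<open>Q\<close> lies
  in the lattice of \<open>bs\<close>. Otherwise some \<open>c \<in> Q\<close> has the coefficient \<open>h\<close>; together with a basis of the
  intersection with the lattice of \<open>bs\<close> it forms a basis of \<open>Q\<close>. Adding the multiples of \<open>b\<close> by
  \<open>0, \<dots>, h - 1\<close> to the old representatives gives representatives for the larger lattice, so the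
  index is multiplied by \<open>h\<close>; so is the determinant, since the new first row is \<open>(h, 0, \<dots>, 0)\<close>.\<close>

theorem sublattice_basis:
  fixes bs :: "'v::euclidean_space list"
  assumes "distinct bs" "independent (set bs)" "Q \<subseteq> int_comb (set bs)" "0 \<in> Q"
    and "\<And>x y. x \<in> Q \<Longrightarrow> y \<in> Q \<Longrightarrow> x - y \<in> Q"
  shows "\<exists>cs. lattice_basis Q cs \<and> length cs \<le> length bs \<and> (length cs = length bs \<longrightarrow>
    (\<exists>R. finite R \<and> transversal (int_comb (set bs)) Q R \<and> real (card R) = \<bar>coord_det bs cs\<bar>))"
  using assms
proof (induction bs arbitrary: Q)
  case Nil
  have "int_comb {} = ({0} :: 'v set)" by (auto simp: int_comb_def)
  then have "Q = {0}" using Nil by auto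
  moreover have "transversal {0} {0} {0::'v}" by (auto simp: transversal_def)
  moreover have "coord_det [] ([] :: 'v list) = 1"
    by (rule det_dim_zero) (simp add: coord_mat_def)
  ultimately have "lattice_basis Q []"
    and "finite {0::'v} \<and> transversal (int_comb (set [])) Q {0} \<and>
      real (card {0::'v}) = \<bar>coord_det [] ([] :: 'v list)\<bar>"
    using \<open>int_comb {} = {0}\<close> by (simp_all add: lattice_basis_iff independent_empty)
  then show ?case by (intro exI[of _ "[]"]) blast
next
  case (Cons b bs)
  let ?B = "set bs" and ?C = "insert b (set bs)"
  have ind: "independent ?C" and b: "b \<notin> ?B" and dist: "distinct bs" using Cons.prems by auto
  have indB: "independent ?B" using ind by (meson independent_mono subset_insertI)
  have b_span: "b \<notin> span ?B" using ind b by (simp add: independent_insert)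
  have P_iff: "x \<in> int_comb ?C \<longleftrightarrow> (\<exists>m::int. x - of_int m *\<^sub>R b \<in> int_comb ?B)" for x
    by (rule int_comb_insert_iff[OF ind b])
  have coeff_unique: "m = 0" if "of_int m *\<^sub>R b + y \<in> span ?B" "y \<in> span ?B" for m :: int and y
  proof (rule ccontr)
    assume "m \<noteq> 0"
    have "of_int m *\<^sub>R b \<in> span ?B" using span_diff[OF that] by simp
    then have "(1 / of_int m) *\<^sub>R (of_int m *\<^sub>R b) \<in> span ?B" by (rule span_scale)
    then show False using \<open>m \<noteq> 0\<close> b_span by simp
  qed
  define Q' where "Q' = Q \<inter> int_comb ?B"
  have diffQ: "x - y \<in> Q" if "x \<in> Q" "y \<in> Q" for x y using Cons.prems(5) that .
  have zero: "0 \<in> int_comb ?B" by (simp add: int_comb_def span_zero real_vector.representation_zero)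
  have "\<exists>cs. lattice_basis Q' cs \<and> length cs \<le> length bs \<and> (length cs = length bs \<longrightarrow>
    (\<exists>R. finite R \<and> transversal (int_comb ?B) Q' R \<and> real (card R) = \<bar>coord_det bs cs\<bar>))"
    by (rule Cons.IH) (use dist indB zero diffQ Cons.prems(4) int_comb_diff[OF indB] in \<open>auto simp: Q'_def\<close>)
  then obtain cs where cs: "lattice_basis Q' cs" "length cs \<le> length bs"
    and index: "length cs = length bs \<Longrightarrow> \<exists>R. finite R \<and> transversal (int_comb ?B) Q' R \<and> real (card R) = \<bar>coord_det bs cs\<bar>"
    by blast
  have csd: "distinct cs" "independent (set cs)" "Q' = int_comb (set cs)" using cs(1) by (auto simp: lattice_basis_iff)
  have cs_sub: "set cs \<subseteq> int_comb ?B" using subset_int_comb[OF csd(2)] csd(3) by (auto simp: Q'_def)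
  define H where "H = {m::int. \<exists>x\<in>Q. x - of_int m *\<^sub>R b \<in> int_comb ?B}"
  have "0 \<in> H" using Cons.prems(4) zero by (auto simp: H_def)
  moreover have "m - n \<in> H" if mn: "m \<in> H" "n \<in> H" for m n
  proof -
    obtain x y where "x \<in> Q" "x - of_int m *\<^sub>R b \<in> int_comb ?B" "y \<in> Q" "y - of_int n *\<^sub>R b \<in> int_comb ?B"
      using mn unfolding H_def by blast
    then have "x - y \<in> Q" "(x - of_int m *\<^sub>R b) - (y - of_int n *\<^sub>R b) \<in> int_comb ?B"
      using diffQ int_comb_diff[OF indB] by auto
    then show ?thesis by (auto simp: H_def algebra_simps intro!: bexI[of _ "x - y"])
  qed
  ultimately obtain h where h: "h \<ge> 0" "h \<in> H" "\<And>m. m \<in> H \<Longrightarrow> h dvd m"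
    using int_subgroup_generator[of H] by blast
  show ?case
  proof (cases "h = 0")
    case True
    have "Q \<subseteq> int_comb ?B"
    proof
      fix x assume x: "x \<in> Q"
      then have "x \<in> int_comb ?C" using Cons.prems(3) by auto
      then obtain m :: int where m: "x - of_int m *\<^sub>R b \<in> int_comb ?B" using P_iff by blast
      then have "m \<in> H" using x by (auto simp: H_def)
      then have "m = 0" using h(3) True by auto
      then show "x \<in> int_comb ?B" using m by simp
    qed
    then have "Q' = Q" by (auto simp: Q'_def)
    then show ?thesis using cs by (intro exI[of _ cs]) auto
  next
    case False
    then have hpos: "h > 0" using h(1) by simp
    obtain c where c: "c \<in> Q" "c - of_int h *\<^sub>R b \<in> int_comb ?B" using h(2) by (auto simp: H_def)
    have cs_span: "span (set cs) \<subseteq> span ?B"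
      using cs_sub int_comb_subset_span[of ?B] by (intro span_minimal) auto
    have c_span: "c - of_int h *\<^sub>R b \<in> span ?B" using c(2) int_comb_subset_span by blast
    have c_notin: "c \<notin> span (set cs)"
    proof
      assume "c \<in> span (set cs)"
      then have "c \<in> span ?B" using cs_span by blast
      then have "of_int h *\<^sub>R b + (c - of_int h *\<^sub>R b) \<in> span ?B" by simp
      then show False using coeff_unique[OF _ c_span] hpos by blast
    qed
    have c_new: "c \<notin> set cs" using c_notin span_base by blast
    have indc: "independent (insert c (set cs))" using csd(2) c_notin c_new by (simp add: independent_insert)
    have Q_iff: "x \<in> Q \<longleftrightarrow> (\<exists>k::int. x - of_int k *\<^sub>R c \<in> Q')" for x
    proof
      have kc: "of_int k *\<^sub>R c \<in> Q" for k :: int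
      proof (induction k rule: int_induct[where k = 0])
        case base show ?case using Cons.prems(4) by simp
      next
        case (step1 i)
        have "of_int i *\<^sub>R c - (0 - c) \<in> Q" using step1 c(1) Cons.prems(4) diffQ by blast
        then show ?case by (simp add: algebra_simps)
      next
        case (step2 i)
        have "of_int i *\<^sub>R c - c \<in> Q" using step2 c(1) diffQ by blast
        then show ?case by (simp add: algebra_simps)
      qed
      {
        assume x: "x \<in> Q"
        then have "x \<in> int_comb ?C" using Cons.prems(3) by auto
        then obtain m :: int where m: "x - of_int m *\<^sub>R b \<in> int_comb ?B" using P_iff by blast
        then have "m \<in> H" using x by (auto simp: H_def)
        then obtain k where k: "m = h * k" using h(3) by (auto elim: dvdE)
        have kc': "of_int k *\<^sub>R (c - of_int h *\<^sub>R b) \<in> int_comb ?B"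
          using c(2) indB by (auto simp: int_comb_def span_scale real_vector.representation_scale)
        have "x - of_int k *\<^sub>R c = (x - of_int m *\<^sub>R b) - of_int k *\<^sub>R (c - of_int h *\<^sub>R b)"
          by (simp add: k algebra_simps)
        then have "x - of_int k *\<^sub>R c \<in> int_comb ?B"
          by (simp only: int_comb_diff[OF indB m kc'])
        then show "\<exists>k::int. x - of_int k *\<^sub>R c \<in> Q'" using diffQ[OF x kc] by (auto simp: Q'_def)
      }
      {
        assume "\<exists>k::int. x - of_int k *\<^sub>R c \<in> Q'"
        then obtain k :: int where "x - of_int k *\<^sub>R c \<in> Q" by (auto simp: Q'_def)
        from diffQ[OF this diffQ[OF Cons.prems(4) kc[of k]]] show "x \<in> Q" by simp
      }
    qed
    have basis: "lattice_basis Q (c # cs)"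
      using csd c_new indc Q_iff int_comb_insert_iff[OF indc c_new]
      by (auto simp: lattice_basis_iff)
    show ?thesis
    proof (intro exI[of _ "c # cs"] conjI impI)
      show "lattice_basis Q (c # cs)" by (rule basis)
      show "length (c # cs) \<le> length (b # bs)" using cs(2) by simp
      assume "length (c # cs) = length (b # bs)"
      then have len: "length cs = length bs" by simp
      obtain R where R: "finite R" "transversal (int_comb ?B) Q' R" "real (card R) = \<bar>coord_det bs cs\<bar>"
        using index[OF len] by blast
      have R_sub: "R \<subseteq> int_comb ?B" using R(2) by (simp add: transversal_def)
      let ?f = "\<lambda>(i::int, r). of_int i *\<^sub>R b + r"
      define R' where "R' = ?f ` ({0..<h} \<times> R)"
      have inj: "inj_on ?f ({0..<h} \<times> R)"
      proof (rule inj_onI, clarify)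
        fix i r j s assume i: "r \<in> R" "s \<in> R" and eq: "of_int i *\<^sub>R b + r = of_int j *\<^sub>R b + s"
        have rs: "r \<in> span ?B" "s \<in> span ?B" using i R_sub int_comb_subset_span by blast+
        have "of_int (i - j) *\<^sub>R b + r = s" using eq by (simp add: algebra_simps)
        then have "i - j = 0" using coeff_unique[of "i - j" r] rs by simp
        then show "i = j \<and> r = s" using eq by simp
      qed
      have "transversal (int_comb ?C) Q R'"
        unfolding transversal_def
      proof (intro conjI ballI subsetI)
        fix x assume "x \<in> R'"
        then obtain i :: int and r where "x = of_int i *\<^sub>R b + r" "r \<in> int_comb ?B" using R_sub by (auto simp: R'_def)
        then show "x \<in> int_comb ?C" using P_iff by (auto intro!: exI[of _ i])
      next
        fix x assume "x \<in> int_comb ?C"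
        then obtain m :: int where m: "x - of_int m *\<^sub>R b \<in> int_comb ?B" using P_iff by blast
        define k where "k = m div h"
        define i where "i = m mod h"
        have mk: "m = k * h + i" by (simp add: k_def i_def)
        have i: "i \<in> {0..<h}" using hpos by (simp add: i_def)
        have kc': "of_int k *\<^sub>R (c - of_int h *\<^sub>R b) \<in> int_comb ?B"
          using c(2) indB by (auto simp: int_comb_def span_scale real_vector.representation_scale)
        define y where "y = x - of_int k *\<^sub>R c - of_int i *\<^sub>R b"
        have "y = (x - of_int m *\<^sub>R b) - of_int k *\<^sub>R (c - of_int h *\<^sub>R b)"
          by (simp add: y_def mk algebra_simps)
        then have y: "y \<in> int_comb ?B" by (simp only: int_comb_diff[OF indB m kc'])
        then obtain r where r: "r \<in> R" "y - r \<in> Q'" "\<And>s. s \<in> R \<Longrightarrow> y - s \<in> Q' \<Longrightarrow> s = r"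
          using R(2) unfolding transversal_def by metis
        show "\<exists>!r. r \<in> R' \<and> x - r \<in> Q"
        proof (intro ex1I conjI)
          show "of_int i *\<^sub>R b + r \<in> R'" using i r(1) by (auto simp: R'_def)
          have "x - (of_int i *\<^sub>R b + r) - of_int k *\<^sub>R c = y - r" by (simp add: y_def algebra_simps)
          then show "x - (of_int i *\<^sub>R b + r) \<in> Q" using Q_iff r(2) by metis
        next
          fix z assume z: "z \<in> R' \<and> x - z \<in> Q"
          then obtain j s where js: "z = of_int j *\<^sub>R b + s" "j \<in> {0..<h}" "s \<in> R" by (auto simp: R'_def)
          obtain l :: int where l: "x - z - of_int l *\<^sub>R c \<in> Q'" using z Q_iff by blast
          have sB: "s \<in> int_comb ?B" using js R_sub by blast
          have "x - z - of_int l *\<^sub>R c = of_int ((k - l) * h + (i - j)) *\<^sub>R b + (y + of_int (k - l) *\<^sub>R (c - of_int h *\<^sub>R b) - s)"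
            by (simp add: y_def js(1) algebra_simps)
          moreover have "y + of_int (k - l) *\<^sub>R (c - of_int h *\<^sub>R b) - s \<in> span ?B"
            by (intro span_diff[OF span_add[OF _ span_scale[OF c_span]]])
              (use y sB int_comb_subset_span[of ?B] in blast)+
          moreover have "x - z - of_int l *\<^sub>R c \<in> span ?B" using l int_comb_subset_span[of ?B] by (auto simp: Q'_def)
          ultimately have "(k - l) * h + (i - j) = 0" using coeff_unique by metis
          then have ij: "i - j = h * (l - k)" by (simp add: algebra_simps)
          have "l - k = 0"
          proof (rule ccontr)
            assume "l - k \<noteq> 0"
            then have "h \<le> \<bar>i - j\<bar>" unfolding ij abs_mult using hpos by (simp add: mult_le_cancel_left1)
            then show False using i js(2) by auto
          qed
          then have lk: "l = k" "i = j" using ij by auto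
          have "x - z - of_int l *\<^sub>R c = y - s" using lk by (simp add: y_def js(1) algebra_simps)
          then have "s = r" using r(3)[OF js(3)] l by simp
          then show "z = of_int i *\<^sub>R b + r" using js lk by simp
        qed
      qed
      moreover have "real (card R') = \<bar>coord_det (b # bs) (c # cs)\<bar>"
      proof -
        let ?M = "coord_mat (b # bs) (c # cs)"
        have carr: "?M \<in> carrier_mat (Suc (length bs)) (Suc (length bs))"
          using coord_mat_carrier[of "b # bs" "c # cs"] len by simp
        have rep: "representation ?C x = representation ?B x" if "x \<in> span ?B" for x
          by (rule real_vector.representation_extend[OF ind that subset_insertI])
        have repb: "representation ?B x b = 0" for x
          using real_vector.representation_ne_zero[of ?B x b] b by auto
        have M0: "?M $$ (0, 0) = of_int h"
        proof -
          have "representation ?C (of_int h *\<^sub>R b + (c - of_int h *\<^sub>R b)) b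
              = representation ?C (of_int h *\<^sub>R b) b + representation ?C (c - of_int h *\<^sub>R b) b"
            using ind c_span span_mono[of ?B ?C]
            by (subst real_vector.representation_add) (auto intro: span_base span_scale)
          also have "\<dots> = of_int h"
            using ind by (simp add: real_vector.representation_scale span_base real_vector.representation_basis rep[OF c_span] repb)
          finally show ?thesis by simp
        qed
        have cs_in: "cs ! j \<in> span ?B" if "j < length cs" for j
          using that cs_sub int_comb_subset_span[of ?B] nth_mem by blast
        have Mj: "?M $$ (0, Suc j) = 0" if "j < length cs" for j
          using that rep[OF cs_in[OF that]] repb by simp
        have del: "mat_delete ?M 0 0 = coord_mat bs cs"
          by (rule eq_matI) (auto simp: mat_delete_def coord_mat_def rep[OF cs_in])
        have "Determinant.det ?M = (\<Sum>j<Suc (length bs). ?M $$ (0, j) * cofactor ?M 0 j)"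
          by (rule laplace_expansion_row[OF carr]) simp
        also have "\<dots> = ?M $$ (0, 0) * cofactor ?M 0 0"
          unfolding sum.lessThan_Suc_shift using Mj len by simp
        also have "\<dots> = of_int h * coord_det bs cs"
          using M0 del by (simp add: cofactor_def)
        finally have "\<bar>Determinant.det ?M\<bar> = of_int h * real (card R)"
          using hpos R(3) by (simp add: abs_mult)
        moreover have "card R' = nat h * card R"
          unfolding R'_def using card_image[OF inj] by (simp add: card_cartesian_product)
        ultimately show ?thesis using hpos by simp
      qed
      moreover have "finite R'" unfolding R'_def using R(1) by simp
      ultimately show "\<exists>R. finite R \<and> transversal (int_comb (set (b # bs))) Q R \<and> real (card R) = \<bar>coord_det (b # bs) (c # cs)\<bar>"
        by (intro exI[of _ R']) simp
    qed
  qed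
qed

text \<open>Any basis of \<open>Q\<close> differs from the one just constructed by a matrix of determinant \<open>1\<close> or \<open>-1\<close>.\<close>

theorem lattice_index:
  fixes bs cs :: "'v::euclidean_space list"
  assumes P: "lattice_basis P bs" and Q: "lattice_basis Q cs" and "Q \<subseteq> P" and len: "length cs = length bs"
  shows "\<exists>R. finite R \<and> transversal P Q R \<and> real (card R) = \<bar>coord_det bs cs\<bar>"
proof -
  have b: "distinct bs" "independent (set bs)" "P = int_comb (set bs)"
    and c: "distinct cs" "independent (set cs)" "Q = int_comb (set cs)"
    using P Q by (auto simp: lattice_basis_iff)
  have "0 \<in> Q" unfolding c(3) by (simp add: int_comb_def span_zero real_vector.representation_zero)
  then obtain ds where ds: "lattice_basis Q ds"
    and R: "length ds = length bs \<Longrightarrow> \<exists>R. finite R \<and> transversal P Q R \<and> real (card R) = \<bar>coord_det bs ds\<bar>"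
    using sublattice_basis[OF b(1,2), of Q] int_comb_diff[OF c(2)] \<open>Q \<subseteq> P\<close> b(3) c(3) by metis
  have d: "distinct ds" "independent (set ds)" "Q = int_comb (set ds)" using ds by (auto simp: lattice_basis_iff)
  have lend: "length ds = length cs" "\<bar>coord_det ds cs\<bar> = 1"
    using det_coord_mat_same_lattice[OF ds Q] by auto
  have "coord_mat bs cs = coord_mat bs ds * coord_mat ds cs"
    using b c d \<open>Q \<subseteq> P\<close> int_comb_subset_span[of "set bs"] int_comb_subset_span[of "set ds"]
      subset_int_comb[OF d(2)] subset_int_comb[OF c(2)]
    by (intro coord_mat_mult) blast+
  then have "\<bar>coord_det bs cs\<bar> = \<bar>coord_det bs ds\<bar>"
    using coord_mat_carrier[of bs ds] coord_mat_carrier[of ds cs] lend len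
    by (simp add: Determinant.det_mult[of _ "length bs"] abs_mult)
  then show ?thesis using R lend len by simp
qed

section \<open>The Cauchy-Binet formula\<close>

text \<open>In the Leibniz expansion, multiply out the product of sums over \<open>e\<close>: this gives a sum over functions
  \<open>f\<close> from the row indices to \<open>E\<close>, in which the remaining sum over permutations is the determinant
  with rows chosen by \<open>f\<close>. It vanishes unless \<open>f\<close> is injective. The injective \<open>f\<close> with image \<open>S\<close> are
  the enumeration of \<open>S\<close> composed with a permutation; permuting the rows contributes a sign, and
  the sum of the signed products over all these permutations is once more the minor of \<open>S\<close>.\<close>

theorem cauchy_binet_weighted:
  fixes M :: "nat \<Rightarrow> 'e \<Rightarrow> real" and w :: "'e \<Rightarrow> real"
  assumes E: "finite E"
    and en: "\<And>S. S \<subseteq> E \<Longrightarrow> card S = k \<Longrightarrow> distinct (en S) \<and> set (en S) = S"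
  shows "Determinant.det (Matrix.mat k k (\<lambda>(i, j). \<Sum>e\<in>E. w e * M i e * M j e)) =
    (\<Sum>S | S \<subseteq> E \<and> card S = k. (\<Prod>e\<in>S. w e) * (Determinant.det (Matrix.mat k k (\<lambda>(i, j). M i (en S ! j))))\<^sup>2)"
proof -
  let ?I = "{0..<k}"
  let ?P = "{p. p permutes ?I}"
  define N where "N = (\<lambda>f. Matrix.mat k k (\<lambda>(i, j). M j (f i)))"
  have N: "N f \<in> carrier_mat k k" for f by (simp add: N_def)
  have detN: "Determinant.det (N f) = (\<Sum>p\<in>?P. signof p * (\<Prod>i\<in>?I. M (p i) (f i)))" for f
    unfolding det_def'[OF N]
    by (intro sum.cong refl arg_cong2[where f = "(*)"] prod.cong) (auto simp: N_def dest: permutes_in_image)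
  have detN': "Determinant.det (N f) = (\<Sum>p\<in>?P. signof p * (\<Prod>i\<in>?I. M i (f (p i))))" for f
  proof -
    have "Determinant.det (N f) = Determinant.det (transpose_mat (N f))" using Determinant.det_transpose[OF N] by simp
    also have "\<dots> = (\<Sum>p\<in>?P. signof p * (\<Prod>i\<in>?I. M i (f (p i))))"
      unfolding det_def'[OF transpose_carrier_mat[THEN iffD2, OF N]]
      by (intro sum.cong refl arg_cong2[where f = "(*)"] prod.cong) (auto simp: N_def dest: permutes_in_image)
    finally show ?thesis .
  qed
  let ?F = "PiE ?I (\<lambda>_. E)"
  have "Determinant.det (Matrix.mat k k (\<lambda>(i, j). \<Sum>e\<in>E. w e * M i e * M j e))
      = (\<Sum>p\<in>?P. signof p * (\<Prod>i\<in>?I. \<Sum>e\<in>E. w e * M i e * M (p i) e))"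
    by (subst det_def'[of _ k]) (auto intro!: sum.cong prod.cong dest: permutes_in_image)
  also have "\<dots> = (\<Sum>p\<in>?P. \<Sum>f\<in>?F. (\<Prod>i\<in>?I. w (f i) * M i (f i)) * (signof p * (\<Prod>i\<in>?I. M (p i) (f i))))"
    using E by (subst prod_sum_PiE) (auto simp: sum_distrib_left prod.distrib mult_ac intro!: sum.cong)
  also have "\<dots> = (\<Sum>f\<in>?F. (\<Prod>i\<in>?I. w (f i) * M i (f i)) * Determinant.det (N f))"
    by (subst sum.swap) (simp add: detN sum_distrib_left)
  also have "\<dots> = (\<Sum>f\<in>{f \<in> ?F. inj_on f ?I}. (\<Prod>i\<in>?I. w (f i) * M i (f i)) * Determinant.det (N f))"
  proof (rule sum.mono_neutral_right)
    show "finite ?F" using E by (simp add: finite_PiE)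
    show "\<forall>f\<in>?F - {f \<in> ?F. inj_on f ?I}. (\<Prod>i\<in>?I. w (f i) * M i (f i)) * Determinant.det (N f) = 0"
    proof
      fix f assume "f \<in> ?F - {f \<in> ?F. inj_on f ?I}"
      then obtain i j where ij: "i < k" "j < k" "i \<noteq> j" "f i = f j" by (auto simp: inj_on_def)
      then have "Matrix.row (N f) i = Matrix.row (N f) j" by (intro eq_vecI) (auto simp: N_def)
      then have "Determinant.det (N f) = 0" using det_identical_rows[OF N ij(3,1,2)] by simp
      then show "(\<Prod>i\<in>?I. w (f i) * M i (f i)) * Determinant.det (N f) = 0" by simp
    qed
  qed auto
  also have "\<dots> = (\<Sum>S\<in>{S. S \<subseteq> E \<and> card S = k}. \<Sum>f\<in>{f \<in> {f \<in> ?F. inj_on f ?I}. f ` ?I = S}. (\<Prod>i\<in>?I. w (f i) * M i (f i)) * Determinant.det (N f))"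
  proof (rule sum.group[symmetric])
    show "finite {f \<in> ?F. inj_on f ?I}" using E by (simp add: finite_PiE)
    show "finite {S. S \<subseteq> E \<and> card S = k}" using E by simp
    show "(\<lambda>f. f ` ?I) ` {f \<in> ?F. inj_on f ?I} \<subseteq> {S. S \<subseteq> E \<and> card S = k}"
      by (auto simp: card_image)
  qed
  also have "\<dots> = (\<Sum>S | S \<subseteq> E \<and> card S = k. (\<Prod>e\<in>S. w e) * (Determinant.det (Matrix.mat k k (\<lambda>(i, j). M i (en S ! j))))\<^sup>2)"
  proof (rule sum.cong[OF refl])
    fix S assume "S \<in> {S. S \<subseteq> E \<and> card S = k}"
    then have S: "S \<subseteq> E" "card S = k" by auto
    let ?e = "\<lambda>i. en S ! i"
    have enS: "distinct (en S)" "set (en S) = S" using en[OF S] by auto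
    have len: "length (en S) = k" using enS S(2) distinct_card by metis
    have e: "bij_betw ?e ?I S"
      using bij_betw_nth[OF enS(1)] enS(2) len by (simp add: atLeast0LessThan)
    let ?\<phi> = "\<lambda>p. restrict (\<lambda>i. ?e (p i)) ?I"
    have bij: "bij_betw ?\<phi> ?P {f \<in> {f \<in> ?F. inj_on f ?I}. f ` ?I = S}"
    proof (rule bij_betwI[where g = "\<lambda>f i. if i \<in> ?I then inv_into ?I ?e (f i) else i"])
      show "?\<phi> \<in> ?P \<rightarrow> {f \<in> {f \<in> ?F. inj_on f ?I}. f ` ?I = S}"
      proof
        fix p assume "p \<in> ?P"
        then have "bij_betw p ?I ?I" by (simp add: permutes_imp_bij)
        then have b: "bij_betw (\<lambda>i. ?e (p i)) ?I S" using bij_betw_trans[OF _ e] by (auto simp: o_def)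
        then have b': "bij_betw (?\<phi> p) ?I S" by (rule bij_betw_cong[THEN iffD1, rotated]) auto
        have "?\<phi> p \<in> ?F" using bij_betw_imp_surj_on[OF b] S(1) by auto
        then show "?\<phi> p \<in> {f \<in> {f \<in> ?F. inj_on f ?I}. f ` ?I = S}" using b' by (simp add: bij_betw_def)
      qed
      show "(\<lambda>f i. if i \<in> ?I then inv_into ?I ?e (f i) else i) \<in> {f \<in> {f \<in> ?F. inj_on f ?I}. f ` ?I = S} \<rightarrow> ?P"
      proof
        fix f assume f: "f \<in> {f \<in> {f \<in> ?F. inj_on f ?I}. f ` ?I = S}"
        let ?p = "\<lambda>i. if i \<in> ?I then inv_into ?I ?e (f i) else i"
        have "bij_betw f ?I S" using f by (simp add: bij_betw_def)
        then have "bij_betw (\<lambda>i. inv_into ?I ?e (f i)) ?I ?I"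
          using bij_betw_trans[OF _ bij_betw_inv_into[OF e]] by (auto simp: o_def)
        then have "bij_betw ?p ?I ?I" by (rule bij_betw_cong[THEN iffD1, rotated]) auto
        then show "?p \<in> ?P" by (auto intro: bij_imp_permutes)
      qed
      show "(\<lambda>i. if i \<in> ?I then inv_into ?I ?e (?\<phi> p i) else i) = p" if "p \<in> ?P" for p
      proof
        fix i
        show "(if i \<in> ?I then inv_into ?I ?e (?\<phi> p i) else i) = p i"
          using that permutes_in_image[of p ?I i] bij_betw_imp_inj_on[OF e]
          by (auto simp: inv_into_f_f permutes_not_in)
      qed
      show "?\<phi> (\<lambda>i. if i \<in> ?I then inv_into ?I ?e (f i) else i) = f"
        if f: "f \<in> {f \<in> {f \<in> ?F. inj_on f ?I}. f ` ?I = S}" for f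
      proof
        fix i
        show "?\<phi> (\<lambda>i. if i \<in> ?I then inv_into ?I ?e (f i) else i) i = f i"
        proof (cases "i \<in> ?I")
          case True
          then have "f i \<in> ?e ` ?I" using f bij_betw_imp_surj_on[OF e] by auto
          then have "?e (inv_into ?I ?e (f i)) = f i" by (rule f_inv_into_f)
          then show ?thesis using True by (simp only: restrict_apply if_True)
        next
          case False
          moreover have "f \<in> ?F" using f by blast
          ultimately have "f i = undefined" by (intro PiE_arb)
          then show ?thesis using False by (simp only: restrict_apply if_False)
        qed
      qed
    qed
    have Nperm: "Determinant.det (N (?\<phi> p)) = signof p * Determinant.det (N ?e)" if p: "p \<in> ?P" for p
    proof -
      have "N (?\<phi> p) = Matrix.mat k k (\<lambda>(i, j). N ?e $$ (p i, j))"
        using p permutes_in_image[of p ?I] by (intro eq_matI) (auto simp: N_def)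
      then show ?thesis using det_permute_rows[OF N, of p ?e] p by simp
    qed
    have wprod: "(\<Prod>i\<in>?I. w (?\<phi> p i)) = (\<Prod>e\<in>S. w e)" if p: "p \<in> ?P" for p
    proof -
      have "bij_betw (\<lambda>i. ?e (p i)) ?I S"
        using bij_betw_trans[OF permutes_imp_bij e] p by (auto simp: o_def)
      then show ?thesis using prod.reindex_bij_betw[of "\<lambda>i. ?e (p i)" ?I S w] by simp
    qed
    have "(\<Sum>f\<in>{f \<in> {f \<in> ?F. inj_on f ?I}. f ` ?I = S}. (\<Prod>i\<in>?I. w (f i) * M i (f i)) * Determinant.det (N f))
        = (\<Sum>p\<in>?P. (\<Prod>i\<in>?I. w (?\<phi> p i) * M i (?\<phi> p i)) * Determinant.det (N (?\<phi> p)))"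
      by (rule sum.reindex_bij_betw[OF bij, symmetric])
    also have "\<dots> = (\<Sum>p\<in>?P. (\<Prod>e\<in>S. w e) * Determinant.det (N ?e) * (signof p * (\<Prod>i\<in>?I. M i (?e (p i)))))"
      by (intro sum.cong refl) (simp add: prod.distrib wprod[simplified] Nperm mult_ac)
    also have "\<dots> = (\<Prod>e\<in>S. w e) * (Determinant.det (N ?e))\<^sup>2"
      unfolding sum_distrib_left[symmetric] detN'[of ?e, symmetric] by (simp add: power2_eq_square)
    also have "Determinant.det (N ?e) = Determinant.det (Matrix.mat k k (\<lambda>(i, j). M i (en S ! j)))"
    proof -
      have "Matrix.mat k k (\<lambda>(i, j). M i (en S ! j)) = transpose_mat (N ?e)"
        by (intro eq_matI) (auto simp: N_def)
      then show ?thesis using Determinant.det_transpose[OF N, of ?e] by simp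
    qed
    finally show "(\<Sum>f\<in>{f \<in> {f \<in> ?F. inj_on f ?I}. f ` ?I = S}. (\<Prod>i\<in>?I. w (f i) * M i (f i)) * Determinant.det (N f))
        = (\<Prod>e\<in>S. w e) * (Determinant.det (Matrix.mat k k (\<lambda>(i, j). M i (en S ! j))))\<^sup>2" .
  qed
  finally show ?thesis .
qed

section \<open>Integral chains\<close>

lemmas cvec_eq_iff = Finite_Cartesian_Product.vec_eq_iff

abbreviation \<iota> :: "int ^ 'c::finite \<Rightarrow> real ^ 'c" where "\<iota> \<equiv> int_chain_to_real"

lemma int_chain_to_real_nth [simp]: "vec_nth (int_chain_to_real x) \<sigma> = of_int (vec_nth x \<sigma>)"
  by (simp add: int_chain_to_real_def)

lemma int_chain_to_real_add: "int_chain_to_real (x + y) = int_chain_to_real x + int_chain_to_real y"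
  and int_chain_to_real_diff: "int_chain_to_real (x - y) = int_chain_to_real x - int_chain_to_real y"
  and int_chain_to_real_0 [simp]: "int_chain_to_real 0 = 0"
  and int_chain_to_real_scale: "int_chain_to_real (m *s x) = of_int m *\<^sub>R int_chain_to_real x"
  by (simp_all add: cvec_eq_iff)

lemma int_chain_to_real_sum: "int_chain_to_real (\<Sum>i\<in>I. f i) = (\<Sum>i\<in>I. int_chain_to_real (f i))"
  by (induction I rule: infinite_finite_induct) (simp_all add: int_chain_to_real_add)

lemma int_chain_to_real_eq_iff [simp]: "int_chain_to_real x = int_chain_to_real y \<longleftrightarrow> x = y"
  by (simp add: cvec_eq_iff)

lemma inj_int_chain_to_real: "inj_on int_chain_to_real S"
  by (simp add: inj_on_def)

text \<open>Independence of an indexed family; unlike independence of the set of its values, it excludes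
  repetitions.\<close>

definition family_independent :: "('i \<Rightarrow> 'v::real_vector) \<Rightarrow> 'i set \<Rightarrow> bool" where
  "family_independent v I \<longleftrightarrow> (\<forall>a. (\<Sum>i\<in>I. a i *\<^sub>R v i) = 0 \<longrightarrow> (\<forall>i\<in>I. a i = 0))"

lemma family_independent_iff:
  assumes "finite I"
  shows "family_independent v I \<longleftrightarrow> inj_on v I \<and> independent (v ` I)"
proof
  assume f: "family_independent v I"
  have inj: "inj_on v I"
  proof (rule inj_onI, rule ccontr)
    fix i j assume ij: "i \<in> I" "j \<in> I" "v i = v j" "i \<noteq> j"
    let ?a = "\<lambda>k. if k = i then 1 else if k = j then -1 else (0::real)"
    have "(\<Sum>k\<in>I. ?a k *\<^sub>R v k) = (\<Sum>k\<in>{i, j}. ?a k *\<^sub>R v k)"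
      by (rule sum.mono_neutral_right) (use assms ij in auto)
    also have "\<dots> = 0" using ij by simp
    finally have "?a i = 0" by (rule f[unfolded family_independent_def, rule_format, OF _ ij(1)])
    then show False by simp
  qed
  have "independent (v ` I)"
    unfolding real_vector.independent_explicit_finite_subsets
  proof (intro allI impI ballI)
    fix A u x assume A: "A \<subseteq> v ` I" and "finite A" and s: "(\<Sum>x\<in>A. u x *\<^sub>R x) = 0" and x: "x \<in> A"
    let ?a = "\<lambda>i. if v i \<in> A then u (v i) else 0"
    have "(\<Sum>i\<in>I. ?a i *\<^sub>R v i) = (\<Sum>y\<in>v ` I. (if y \<in> A then u y else 0) *\<^sub>R y)"
      by (subst sum.reindex[OF inj]) simp
    also have "\<dots> = (\<Sum>y\<in>A. u y *\<^sub>R y)"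
      using A assms by (intro sum.mono_neutral_cong_right) auto
    finally have "(\<Sum>i\<in>I. ?a i *\<^sub>R v i) = 0" using s by (rule trans)
    then have "\<forall>i\<in>I. ?a i = 0" by (rule f[unfolded family_independent_def, THEN spec, THEN mp])
    moreover obtain i where "i \<in> I" "x = v i" using x A by blast
    ultimately show "u x = 0" using x by auto
  qed
  then show "inj_on v I \<and> independent (v ` I)" using inj by blast
next
  assume r: "inj_on v I \<and> independent (v ` I)"
  show "family_independent v I"
    unfolding family_independent_def
  proof (intro allI impI ballI)
    fix a i assume s: "(\<Sum>i\<in>I. a i *\<^sub>R v i) = 0" and i: "i \<in> I"
    have "(\<Sum>y\<in>v ` I. a (inv_into I v y) *\<^sub>R y) = (\<Sum>i\<in>I. a i *\<^sub>R v i)"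
      using r by (subst sum.reindex) (auto simp: inv_into_f_f)
    then have "a (inv_into I v (v i)) = 0"
      using r s i assms real_vector.independentD[of "v ` I" "v ` I" "\<lambda>y. a (inv_into I v y)" "v i"] by auto
    then show "a i = 0" using r i by (simp add: inv_into_f_f)
  qed
qed

text \<open>By Dirichlet's theorem, the coefficients \<open>\<theta>\<^sub>i\<close> of a real relation can be approximated simultaneously by
  fractions \<open>c\<^sub>i / q\<close> with errors far smaller than \<open>1 / q\<close>. The combination with coefficients \<open>c\<^sub>i\<close> is
  then an integral vector with entries smaller than 1, hence zero: an integral relation. So for
  integral vectors it suffices to exclude integral relations.\<close>

theorem family_independent_integral:
  fixes v :: "'i \<Rightarrow> real ^ 'c::finite"
  assumes fin: "finite I" and int: "\<And>i \<sigma>. i \<in> I \<Longrightarrow> vec_nth (v i) \<sigma> \<in> \<int>"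
    and ind: "\<And>c::'i \<Rightarrow> int. (\<Sum>i\<in>I. of_int (c i) *\<^sub>R v i) = 0 \<Longrightarrow> \<forall>i\<in>I. c i = 0"
  shows "family_independent v I"
  unfolding family_independent_def
proof (intro allI impI ballI, rule ccontr)
  fix a i0 assume s: "(\<Sum>i\<in>I. a i *\<^sub>R v i) = 0" and i0: "i0 \<in> I" and a0: "a i0 \<noteq> 0"
  \<comment> \<open>Scaling makes the coefficient of \<open>i0\<close> equal to 1, so that its numerator cannot vanish.\<close>
  define \<theta> where "\<theta> = (\<lambda>i. a i / a i0)"
  have \<theta>: "(\<Sum>i\<in>I. \<theta> i *\<^sub>R v i) = 0"
  proof -
    have "(\<Sum>i\<in>I. \<theta> i *\<^sub>R v i) = (1 / a i0) *\<^sub>R (\<Sum>i\<in>I. a i *\<^sub>R v i)"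
      by (simp add: \<theta>_def scaleR_sum_right)
    then show ?thesis using s by simp
  qed
  obtain g where g: "bij_betw g {0..<card I} I" using ex_bij_betw_nat_finite[OF fin] by blast
  define K where "K = (\<Sum>i\<in>I. \<Sum>\<sigma>\<in>UNIV. \<bar>vec_nth (v i) \<sigma>\<bar>)"
  have K0: "K \<ge> 0" unfolding K_def by (intro sum_nonneg) auto
  obtain N :: nat where N: "K < real N" using reals_Archimedean2 by blast
  then have Npos: "N > 0" using K0 by (cases N) auto
  obtain q p where q: "0 < q" and p: "\<And>j. j < card I \<Longrightarrow> \<bar>of_int q * \<theta> (g j) - of_int (p j)\<bar> < 1 / N"
    using Dirichlet_approx_simult[OF Npos, of "card I" "\<lambda>j. \<theta> (g j)"] by metis
  define c where "c = (\<lambda>i. p (inv_into {0..<card I} g i))"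
  have c: "\<bar>of_int q * \<theta> i - of_int (c i)\<bar> < 1 / N" if "i \<in> I" for i
  proof -
    let ?j = "inv_into {0..<card I} g i"
    have "?j < card I" "g ?j = i"
      using that g bij_betw_imp_surj_on[OF g] inv_into_into[of i g "{0..<card I}"] f_inv_into_f[of i g "{0..<card I}"] by auto
    then show ?thesis using p[of ?j] by (simp add: c_def)
  qed
  have "(\<Sum>i\<in>I. of_int (c i) *\<^sub>R v i) = 0"
  proof (subst cvec_eq_iff, rule allI)
    fix \<sigma>
    let ?x = "vec_nth (\<Sum>i\<in>I. of_int (c i) *\<^sub>R v i) \<sigma>"
    have "?x \<in> \<int>" using int by (simp add: Ints_sum Ints_mult)
    have "?x = vec_nth ((\<Sum>i\<in>I. of_int (c i) *\<^sub>R v i) - of_int q *\<^sub>R (\<Sum>i\<in>I. \<theta> i *\<^sub>R v i)) \<sigma>"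
      using \<theta> by simp
    also have "\<dots> = (\<Sum>i\<in>I. (of_int (c i) - of_int q * \<theta> i) * vec_nth (v i) \<sigma>)"
      by (simp add: sum_distrib_left sum_subtractf[symmetric] algebra_simps)
    finally have "\<bar>?x\<bar> = \<bar>\<Sum>i\<in>I. (of_int (c i) - of_int q * \<theta> i) * vec_nth (v i) \<sigma>\<bar>" by simp
    also have "\<dots> \<le> (\<Sum>i\<in>I. 1 / N * \<bar>vec_nth (v i) \<sigma>\<bar>)"
    proof (rule order_trans[OF sum_abs sum_mono])
      fix i assume "i \<in> I"
      then have "\<bar>of_int (c i) - of_int q * \<theta> i\<bar> \<le> 1 / real N"
        using c[of i] by (simp add: abs_minus_commute)
      then show "\<bar>(of_int (c i) - of_int q * \<theta> i) * vec_nth (v i) \<sigma>\<bar> \<le> 1 / real N * \<bar>vec_nth (v i) \<sigma>\<bar>"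
        unfolding abs_mult by (rule mult_right_mono) simp
    qed
    also have "\<dots> \<le> (\<Sum>i\<in>I. 1 / N * (\<Sum>\<sigma>\<in>UNIV. \<bar>vec_nth (v i) \<sigma>\<bar>))"
      by (intro sum_mono mult_left_mono member_le_sum) auto
    also have "\<dots> = K / N" by (simp add: K_def sum_distrib_left sum_divide_distrib)
    also have "\<dots> < 1" using N Npos by simp
    finally have "\<bar>?x\<bar> < 1" .
    then have "?x = 0" using \<open>?x \<in> \<int>\<close> by (metis Ints_nonzero_abs_less1)
    then show "?x = vec_nth 0 \<sigma>" by simp
  qed
  then have "c i0 = 0" using ind i0 by blast
  then have "\<bar>of_int q\<bar> < 1 / real N" using c[OF i0] a0 by (simp add: \<theta>_def)
  also have "\<dots> \<le> 1" using Npos by simp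
  finally show False using q by simp
qed

definition add_subgroup :: "'v::ab_group_add set \<Rightarrow> bool" where
  "add_subgroup B \<longleftrightarrow> 0 \<in> B \<and> (\<forall>x\<in>B. \<forall>y\<in>B. x - y \<in> B)"

lemma add_subgroupD:
  assumes "add_subgroup B"
  shows "0 \<in> B" "x \<in> B \<Longrightarrow> y \<in> B \<Longrightarrow> x - y \<in> B" "x \<in> B \<Longrightarrow> - x \<in> B" "x \<in> B \<Longrightarrow> y \<in> B \<Longrightarrow> x + y \<in> B"
proof -
  show 0: "0 \<in> B" and d: "x \<in> B \<Longrightarrow> y \<in> B \<Longrightarrow> x - y \<in> B" for x y using assms by (auto simp: add_subgroup_def)
  show n: "x \<in> B \<Longrightarrow> - x \<in> B" for x using d[OF 0] by simp
  show "x \<in> B \<Longrightarrow> y \<in> B \<Longrightarrow> x + y \<in> B" using d n by fastforce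
qed

lemma add_subgroup_scale:
  fixes B :: "(int ^ 'c) set"
  assumes "add_subgroup B" "x \<in> B"
  shows "m *s x \<in> B"
proof (induction m rule: int_induct[where k = 0])
  case base
  then show ?case using add_subgroupD(1)[OF assms(1)] by simp
next
  case (step1 i)
  have "(i + 1) *s x = i *s x + x" by (simp add: cvec_eq_iff algebra_simps)
  then show ?case using add_subgroupD(4)[OF assms(1) step1(2) assms(2)] by simp
next
  case (step2 i)
  have "(i - 1) *s x = i *s x - x" by (simp add: cvec_eq_iff algebra_simps)
  then show ?case using add_subgroupD(2)[OF assms(1) step2(2) assms(2)] by simp
qed

lemma add_subgroup_sum:
  assumes "add_subgroup B" "\<And>i. i \<in> I \<Longrightarrow> f i \<in> B"
  shows "sum f I \<in> B"
  using assms(2) by (induction I rule: infinite_finite_induct) (auto simp: add_subgroupD[OF assms(1)])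

lemma integral_lattice_basis:
  fixes B :: "(int ^ 'c::finite) set"
  assumes B: "add_subgroup B"
  shows "\<exists>bs. lattice_basis (\<iota> ` B) bs"
proof -
  obtain xs :: "'c list" where xs: "set xs = UNIV" "distinct xs" using finite_distinct_list[of "UNIV :: 'c set"] by auto
  define as :: "(real ^ 'c) list" where "as = map (\<lambda>\<sigma>. axis \<sigma> 1) xs"
  have seta: "set as = range (\<lambda>\<sigma>. axis \<sigma> 1)" using xs by (auto simp: as_def)
  have dist: "distinct as" unfolding as_def using xs(2) by (simp add: distinct_map inj_on_def axis_eq_axis)
  have expand: "x = (\<Sum>\<sigma>\<in>UNIV. vec_nth x \<sigma> *\<^sub>R axis \<sigma> 1)" for x :: "real ^ 'c"
    using basis_expansion[of x] by (simp add: scalar_mult_eq_scaleR)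
  have fam: "family_independent (\<lambda>\<sigma>::'c. axis \<sigma> (1::real)) UNIV"
    unfolding family_independent_def
  proof (intro allI impI ballI)
    fix a :: "'c \<Rightarrow> real" and \<sigma> assume s: "(\<Sum>\<sigma>\<in>UNIV. a \<sigma> *\<^sub>R axis \<sigma> 1) = (0 :: real ^ 'c)"
    have "vec_nth (\<Sum>\<sigma>\<in>UNIV. a \<sigma> *\<^sub>R axis \<sigma> (1::real)) \<sigma> = (\<Sum>\<tau>\<in>UNIV. if \<tau> = \<sigma> then a \<tau> else 0)"
      unfolding sum_component by (intro sum.cong) (auto simp: axis_def)
    then show "a \<sigma> = 0" using s by simp
  qed
  have ind: "independent (set as)" using fam by (simp add: family_independent_iff seta)
  have "\<iota> ` B \<subseteq> int_comb (set as)"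
  proof
    fix y assume "y \<in> \<iota> ` B"
    then obtain x where y: "y = \<iota> x" by blast
    have ysp: "y \<in> span (set as)"
      by (subst expand) (intro span_sum span_scale span_base, simp add: seta)
    have "representation (set as) y b \<in> \<int>" if "b \<in> set as" for b
    proof -
      have "representation (set as) y b = representation (set as) (\<Sum>\<sigma>\<in>UNIV. vec_nth y \<sigma> *\<^sub>R axis \<sigma> 1) b"
        using expand[of y] by simp
      also have "\<dots> = (\<Sum>\<sigma>\<in>UNIV. vec_nth y \<sigma> * representation (set as) (axis \<sigma> 1) b)"
        by (rule representation_comb) (use ind in \<open>auto simp: seta intro: span_base\<close>)
      also have "\<dots> \<in> \<int>"
        using ind by (intro Ints_sum Ints_mult) (auto simp: y seta real_vector.representation_basis)
      finally show ?thesis .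
    qed
    then show "y \<in> int_comb (set as)" using ysp by (simp add: int_comb_def)
  qed
  moreover have "0 \<in> \<iota> ` B" using add_subgroupD(1)[OF B] by (auto intro: image_eqI[of _ _ 0])
  moreover have "x - y \<in> \<iota> ` B" if "x \<in> \<iota> ` B" "y \<in> \<iota> ` B" for x y
    using that add_subgroupD(2)[OF B] by (auto simp flip: int_chain_to_real_diff)
  ultimately show ?thesis using sublattice_basis[OF dist ind] by blast
qed

section \<open>Quotients of groups of integral chains\<close>

lemma additive_group_simps [simp]:
  "carrier (additive_group V) = V" "x \<otimes>\<^bsub>additive_group V\<^esub> y = x + y" "\<one>\<^bsub>additive_group V\<^esub> = 0"
  by (simp_all add: additive_group_def)

lemma comm_group_additive:
  assumes "add_subgroup Z"
  shows "comm_group (additive_group Z)"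
  by (rule comm_groupI) (use add_subgroupD[OF assms] in \<open>auto simp: algebra_simps intro: bexI[of _ "- _"] left_minus\<close>)

locale chain_quotient =
  fixes Z B :: "(int ^ 'c::finite) set"
  assumes Z: "add_subgroup Z" and B: "add_subgroup B" and BZ: "B \<subseteq> Z"
begin

abbreviation "G \<equiv> additive_group Z"
abbreviation "Q \<equiv> additive_group Z Mod B"
abbreviation "cl \<equiv> \<lambda>z. B #>\<^bsub>additive_group Z\<^esub> z"

sublocale G: comm_group G by (rule comm_group_additive[OF Z])

lemma inv_G: "z \<in> Z \<Longrightarrow> inv\<^bsub>G\<^esub> z = - z"
  by (rule G.inv_equality) (auto simp: add_subgroupD[OF Z])

lemma subgroup_B: "subgroup B G"
  by (rule subgroup.intro) (use BZ in \<open>auto simp: add_subgroupD[OF B] inv_G subset_iff\<close>)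

lemma normal_B: "B \<lhd> G"
  by (rule G.subgroup_imp_normal[OF subgroup_B])

sublocale Q: comm_group Q by (rule G.abelian_FactGroup[OF subgroup_B])

lemma cl_eq: "cl z = (\<lambda>b. b + z) ` B"
  by (auto simp: r_coset_def)

lemma carrier_Q: "carrier Q = cl ` Z"
  by (auto simp: FactGroup_def RCOSETS_def)

lemma one_Q: "\<one>\<^bsub>Q\<^esub> = B"
  by (simp add: FactGroup_def)

lemma cl_eq_iff: "x \<in> Z \<Longrightarrow> y \<in> Z \<Longrightarrow> cl x = cl y \<longleftrightarrow> x - y \<in> B"
proof
  assume "cl x = cl y"
  moreover have "0 + x \<in> cl x" unfolding cl_eq using add_subgroupD(1)[OF B] by blast
  ultimately have "x \<in> cl y" by simp
  then show "x - y \<in> B" unfolding cl_eq by auto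
next
  assume d: "x - y \<in> B"
  show "cl x = cl y" unfolding cl_eq
  proof (intro equalityI subsetI)
    fix z assume "z \<in> (\<lambda>b. b + x) ` B"
    then obtain b where b: "b \<in> B" "z = b + x" by blast
    then have "z = (b + (x - y)) + y" by simp
    then show "z \<in> (\<lambda>b. b + y) ` B" using add_subgroupD(4)[OF B b(1) d] by blast
  next
    fix z assume "z \<in> (\<lambda>b. b + y) ` B"
    then obtain b where b: "b \<in> B" "z = b + y" by blast
    then have "z = (b - (x - y)) + x" by simp
    then show "z \<in> (\<lambda>b. b + x) ` B" using add_subgroupD(2)[OF B b(1) d] by blast
  qed
qed

lemma cl_eq_one_iff: "z \<in> Z \<Longrightarrow> cl z = \<one>\<^bsub>Q\<^esub> \<longleftrightarrow> z \<in> B"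
proof -
  assume z: "z \<in> Z"
  have "cl 0 = \<one>\<^bsub>Q\<^esub>" unfolding cl_eq one_Q by simp
  then show ?thesis using cl_eq_iff[OF z add_subgroupD(1)[OF Z]] by simp
qed

lemma cl_hom: "cl \<in> hom G Q"
  using normal.r_coset_hom_Mod[OF normal_B] .

lemma group_hom_cl: "group_hom G Q cl"
  by (intro group_hom.intro group_hom_axioms.intro cl_hom G.is_group Q.is_group)

lemma int_pow_G: "z \<in> Z \<Longrightarrow> z [^]\<^bsub>G\<^esub> (m::int) = m *s z"
proof (induction m rule: int_induct[where k = 0])
  case base
  then show ?case by simp
next
  case (step1 i)
  have "(i + 1) *s z = i *s z + z" by (simp add: cvec_eq_iff algebra_simps)
  then show ?case using step1 G.int_pow_mult[of z i 1] by simp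
next
  case (step2 i)
  have "(i - 1) *s z = i *s z - z" by (simp add: cvec_eq_iff algebra_simps)
  then show ?case using step2 G.int_pow_diff[of z i 1] inv_G[of z] by simp
qed

lemma cl_int_pow: "z \<in> Z \<Longrightarrow> cl z [^]\<^bsub>Q\<^esub> (m::int) = cl (m *s z)"
  using group_hom.hom_int_pow[OF group_hom_cl, of z m] int_pow_G by simp

lemma finprod_cl:
  assumes "finite R" "R \<subseteq> Z"
  shows "finprod Q (\<lambda>z. cl z [^]\<^bsub>Q\<^esub> (c z :: int)) R = cl (\<Sum>z\<in>R. c z *s z)"
  using assms
proof (induction R rule: finite_induct)
  case empty
  then show ?case using cl_eq_one_iff[OF add_subgroupD(1)[OF Z]] add_subgroupD(1)[OF B] by simp
next
  case (insert z R)
  have mem: "c y *s y \<in> Z" if "y \<in> insert z R" for y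
    using that insert.prems add_subgroup_scale[OF Z] by blast
  have sumZ: "(\<Sum>z\<in>R. c z *s z) \<in> Z" by (rule add_subgroup_sum[OF Z]) (use mem in auto)
  have clQ: "cl y \<in> carrier Q" if "y \<in> Z" for y using that carrier_Q by blast
  have "finprod Q (\<lambda>z. cl z [^]\<^bsub>Q\<^esub> c z) (insert z R) = cl z [^]\<^bsub>Q\<^esub> c z \<otimes>\<^bsub>Q\<^esub> finprod Q (\<lambda>z. cl z [^]\<^bsub>Q\<^esub> c z) R"
    using insert clQ by (intro Q.finprod_insert) (auto intro!: Q.int_pow_closed)
  also have "\<dots> = cl (c z *s z) \<otimes>\<^bsub>Q\<^esub> cl (\<Sum>z\<in>R. c z *s z)"
    using insert by (simp add: cl_int_pow)
  also have "\<dots> = cl (c z *s z + (\<Sum>z\<in>R. c z *s z))"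
    using hom_mult[OF cl_hom, of "c z *s z" "\<Sum>z\<in>R. c z *s z"] mem sumZ by simp
  finally show ?case using insert by simp
qed

lemma group_independent_cl:
  assumes "finite R" "R \<subseteq> Z" "inj_on cl R"
  shows "group_independent Q (cl ` R) \<longleftrightarrow>
    (\<forall>c :: int ^ 'c \<Rightarrow> int. (\<Sum>z\<in>R. c z *s z) \<in> B \<longrightarrow> (\<forall>z\<in>R. c z = 0))" (is "?l \<longleftrightarrow> ?r")
proof -
  have clQ: "cl y \<in> carrier Q" if "y \<in> Z" for y using that carrier_Q by blast
  have sumZ: "(\<Sum>z\<in>R. c z *s z) \<in> Z" for c :: "int ^ 'c \<Rightarrow> int"
    by (rule add_subgroup_sum[OF Z]) (use assms add_subgroup_scale[OF Z] in auto)
  have eq: "finprod Q (\<lambda>x. x [^]\<^bsub>Q\<^esub> d x) (cl ` R) = \<one>\<^bsub>Q\<^esub> \<longleftrightarrow> (\<Sum>z\<in>R. d (cl z) *s z) \<in> B" for d :: "(int ^ 'c) set \<Rightarrow> int"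
  proof -
    have "finprod Q (\<lambda>x. x [^]\<^bsub>Q\<^esub> d x) (cl ` R) = finprod Q (\<lambda>z. cl z [^]\<^bsub>Q\<^esub> d (cl z)) R"
      using assms clQ by (intro Q.finprod_reindex) (auto intro!: Q.int_pow_closed)
    also have "\<dots> = cl (\<Sum>z\<in>R. d (cl z) *s z)" by (rule finprod_cl[OF assms(1,2)])
    finally show ?thesis using cl_eq_one_iff[OF sumZ] by simp
  qed
  show ?thesis
  proof
    assume l: ?l
    show ?r
    proof (intro allI impI ballI)
      fix c :: "int ^ 'c \<Rightarrow> int" and z assume s: "(\<Sum>z\<in>R. c z *s z) \<in> B" and z: "z \<in> R"
      define d where "d = (\<lambda>x. c (inv_into R cl x))"
      have d: "d (cl z) = c z" if "z \<in> R" for z using that assms(3) by (simp add: d_def inv_into_f_f)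
      then have "(\<Sum>z\<in>R. d (cl z) *s z) \<in> B" using s by simp
      then have "\<forall>x\<in>cl ` R. d x = 0" using l eq unfolding group_independent_def by blast
      then show "c z = 0" using d z by auto
    qed
  next
    assume r: ?r
    show ?l
      unfolding group_independent_def eq
    proof (intro allI impI ballI)
      fix d :: "(int ^ 'c) set \<Rightarrow> int" and x assume "(\<Sum>z\<in>R. d (cl z) *s z) \<in> B" "x \<in> cl ` R"
      then show "d x = 0" using r[rule_format, of "\<lambda>z. d (cl z)"] by auto
    qed
  qed
qed

lemma lattice_image:
  assumes "lattice_basis (\<iota> ` B) bs"
  shows "span (\<iota> ` B) = span (set bs)" "length bs = dim (\<iota> ` B)"
    "set bs \<subseteq> \<iota> ` B"
proof -
  have b: "distinct bs" "independent (set bs)" "\<iota> ` B = int_comb (set bs)"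
    using assms by (auto simp: lattice_basis_iff)
  show s: "span (\<iota> ` B) = span (set bs)" using span_int_comb[OF b(2)] b(3) by simp
  show "length bs = dim (\<iota> ` B)"
    using b s by (metis dim_span dim_span_eq_card_independent distinct_card)
  show "set bs \<subseteq> \<iota> ` B" using subset_int_comb[OF b(2)] b(3) by simp
qed

text \<open>An integral relation between \<open>R\<close> and the basis puts a combination of \<open>R\<close> into \<open>B\<close>, so its
  coefficients vanish; integral relations suffice by the previous section.\<close>

theorem independent_mod:
  assumes R: "finite R" and ind: "\<And>c::int ^ 'c \<Rightarrow> int. (\<Sum>z\<in>R. c z *s z) \<in> B \<Longrightarrow> \<forall>z\<in>R. c z = 0"
    and bs: "lattice_basis (\<iota> ` B) bs"
  shows "family_independent (case_sum \<iota> (\<lambda>j. bs ! j)) (Inl ` R \<union> Inr ` {..<length bs})"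
proof (rule family_independent_integral)
  have b: "distinct bs" "independent (set bs)" using bs by (auto simp: lattice_basis_def)
  show "finite (Inl ` R \<union> Inr ` {..<length bs})" using R by simp
  have bsB: "bs ! j \<in> \<iota> ` B" if "j < length bs" for j
    using lattice_image(3)[OF bs] that by auto
  show "vec_nth (case_sum \<iota> (\<lambda>j. bs ! j) i) \<sigma> \<in> \<int>" if "i \<in> Inl ` R \<union> Inr ` {..<length bs}" for i \<sigma>
    using that bsB by (auto simp: image_iff) (metis Ints_of_int int_chain_to_real_nth)
  fix c :: "(int ^ 'c) + nat \<Rightarrow> int"
  assume s: "(\<Sum>i\<in>Inl ` R \<union> Inr ` {..<length bs}. of_int (c i) *\<^sub>R case_sum \<iota> (\<lambda>j. bs ! j) i) = 0"
  have "(\<Sum>i\<in>Inl ` R \<union> Inr ` {..<length bs}. of_int (c i) *\<^sub>R case_sum \<iota> (\<lambda>j. bs ! j) i)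
      = (\<Sum>z\<in>R. of_int (c (Inl z)) *\<^sub>R \<iota> z) + (\<Sum>j<length bs. of_int (c (Inr j)) *\<^sub>R bs ! j)"
    using R by (subst sum.union_disjoint) (auto simp: sum.reindex)
  then have s': "\<iota> (\<Sum>z\<in>R. c (Inl z) *s z) + (\<Sum>j<length bs. of_int (c (Inr j)) *\<^sub>R bs ! j) = 0"
    using s by (simp add: int_chain_to_real_sum int_chain_to_real_scale)
  then have "\<iota> (\<Sum>z\<in>R. c (Inl z) *s z) = (\<Sum>j<length bs. of_int (- c (Inr j)) *\<^sub>R bs ! j)"
    by (simp add: sum_negf eq_neg_iff_add_eq_0)
  also have "\<dots> \<in> \<iota> ` B"
  proof -
    have "\<iota> ` B = {\<Sum>i<length bs. of_int (c i) *\<^sub>R bs ! i |c :: nat \<Rightarrow> int. True}"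
      using bs by (simp add: lattice_basis_def)
    then show ?thesis by (simp only:) (rule CollectI, rule exI[of _ "\<lambda>j. - c (Inr j)"], simp)
  qed
  finally have "(\<Sum>z\<in>R. c (Inl z) *s z) \<in> B" by auto
  then have R0: "\<forall>z\<in>R. c (Inl z) = 0" by (rule ind[of "\<lambda>z. c (Inl z)"])
  then have "(\<Sum>j<length bs. of_int (c (Inr j)) *\<^sub>R bs ! j) = 0" using s' by simp
  then have "of_int (c (Inr k)) = (0::real)" if "k < length bs" for k
    using representation_sum_list[OF b that, of "\<lambda>j. of_int (c (Inr j))"] by (simp add: real_vector.representation_zero)
  then show "\<forall>i\<in>Inl ` R \<union> Inr ` {..<length bs}. c i = 0" using R0 by auto
qed

text \<open>By the previous result, an independent subset of the quotient has at most the size of the difference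
  of dimensions. The bound is attained by the vectors of \<open>Z\<close> that extend a basis of \<open>B\<close> to a
  basis of the span of \<open>Z\<close>.\<close>

theorem group_rank_quotient: "group_rank Q = dim (\<iota> ` Z) - dim (\<iota> ` B)"
  and dim_B_le: "dim (\<iota> ` B) \<le> dim (\<iota> ` Z)"
proof -
  show le: "dim (\<iota> ` B) \<le> dim (\<iota> ` Z)" using BZ by (intro dim_subset) auto
  obtain bs where bs: "lattice_basis (\<iota> ` B) bs" using integral_lattice_basis[OF B] by blast
  have b: "distinct bs" "independent (set bs)" "\<iota> ` B = int_comb (set bs)" using bs by (auto simp: lattice_basis_iff)
  have len: "length bs = dim (\<iota> ` B)" using lattice_image(2)[OF bs] .
  have upper: "card S \<le> dim (\<iota> ` Z) - dim (\<iota> ` B)" if S: "finite S" "S \<subseteq> carrier Q" "group_independent Q S" for S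
  proof -
    obtain R where R: "R \<subseteq> Z" "inj_on cl R" "S = cl ` R"
      using S(2) carrier_Q subset_image_inj by metis
    have fR: "finite R" using R S(1) finite_imageD by blast
    have "family_independent (case_sum \<iota> (\<lambda>j. bs ! j)) (Inl ` R \<union> Inr ` {..<length bs})" (is "family_independent ?v ?I")
      by (rule independent_mod[OF fR _ bs]) (use group_independent_cl[OF fR R(1,2)] S(3) R(3) in blast)
    then have v: "inj_on ?v ?I" "independent (?v ` ?I)" using fR by (auto simp: family_independent_iff)
    have "bs ! j \<in> \<iota> ` Z" if "j < length bs" for j using that lattice_image(3)[OF bs] BZ by (meson image_mono nth_mem subsetD)
    then have "?v ` ?I \<subseteq> \<iota> ` Z" using R(1) by auto
    then have "card (?v ` ?I) \<le> dim (\<iota> ` Z)" using v(2) by (rule independent_card_le_dim)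
    moreover have "card (?v ` ?I) = card R + length bs"
      using fR by (subst card_image[OF v(1)], subst card_Un_disjoint) (auto simp: card_image)
    moreover have "card S = card R" using R by (simp add: card_image)
    ultimately show ?thesis using len by simp
  qed
  have lower: "\<exists>S. card S = dim (\<iota> ` Z) - dim (\<iota> ` B) \<and> finite S \<and> S \<subseteq> carrier Q \<and> group_independent Q S"
  proof -
    have "set bs \<subseteq> \<iota> ` Z" using lattice_image(3)[OF bs] BZ by blast
    then obtain W where W: "set bs \<subseteq> W" "W \<subseteq> \<iota> ` Z" "independent W" "\<iota> ` Z \<subseteq> span W"
      using maximal_independent_subset_extend b(2) by metis
    have fW: "finite W" using W(3) by (rule independent_imp_finite)
    have cW: "card W = dim (\<iota> ` Z)" using W(2-4) by (metis basis_card_eq_dim)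
    define R where "R = {z \<in> Z. \<iota> z \<in> W - set bs}"
    have img: "\<iota> ` R = W - set bs" using W(2) by (auto simp: R_def)
    have fR: "finite R" using fW img by (metis finite_Diff finite_imageD inj_int_chain_to_real)
    have cR: "card R = dim (\<iota> ` Z) - dim (\<iota> ` B)"
    proof -
      have "card R = card (W - set bs)" using card_image[OF inj_int_chain_to_real, of R] img by simp
      also have "\<dots> = card W - card (set bs)" using W(1) by (intro card_Diff_subset) auto
      finally show ?thesis using cW len distinct_card[OF b(1)] by simp
    qed
    have key: "\<forall>z\<in>R. c z = 0" if s: "(\<Sum>z\<in>R. c z *s z) \<in> B" for c :: "int ^ 'c \<Rightarrow> int"
    proof
      fix z assume z: "z \<in> R"
      let ?y = "\<Sum>z\<in>R. of_int (c z) *\<^sub>R \<iota> z"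
      have "?y = \<iota> (\<Sum>z\<in>R. c z *s z)" by (simp add: int_chain_to_real_sum int_chain_to_real_scale)
      then have "?y \<in> span (set bs)" using s lattice_image(1)[OF bs] by (metis imageI span_base)
      then have "representation W ?y = representation (set bs) ?y"
        by (rule real_vector.representation_extend[OF W(3) _ W(1)])
      moreover have "representation (set bs) ?y (\<iota> z) = 0"
        using real_vector.representation_ne_zero[of "set bs" ?y "\<iota> z"] z by (auto simp: R_def)
      moreover have "representation W ?y (\<iota> z) = (\<Sum>x\<in>R. of_int (c x) * representation W (\<iota> x) (\<iota> z))"
        by (rule representation_comb[OF W(3) fR]) (auto simp: R_def intro: span_base)
      moreover have "\<dots> = (\<Sum>x\<in>R. if x = z then of_int (c x) else 0)"
        using W(3) by (intro sum.cong) (auto simp: R_def real_vector.representation_basis)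
      ultimately show "c z = 0" using z fR by simp
    qed
    have inj: "inj_on cl R"
    proof (rule inj_onI, rule ccontr)
      fix x y assume xy: "x \<in> R" "y \<in> R" "cl x = cl y" "x \<noteq> y"
      let ?c = "\<lambda>z. if z = x then 1 else if z = y then -1 else (0::int)"
      have "(\<Sum>z\<in>R. ?c z *s z) = (\<Sum>z\<in>{x, y}. ?c z *s z)"
        by (rule sum.mono_neutral_right) (use fR xy in auto)
      also have "\<dots> = 1 *s x + (-1) *s y" using xy(4) by simp
      also have "\<dots> = x - y" by (simp add: cvec_eq_iff)
      also have "\<dots> \<in> B" using cl_eq_iff[of x y] xy by (simp add: R_def)
      finally have "?c x = 0" using key[of ?c] xy(1) by blast
      then show False by simp
    qed
    have "group_independent Q (cl ` R)"
      using group_independent_cl[OF fR _ inj] key by (simp add: R_def)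
    moreover have "card (cl ` R) = dim (\<iota> ` Z) - dim (\<iota> ` B)" using card_image[OF inj] cR by simp
    moreover have "cl ` R \<subseteq> carrier Q" using carrier_Q by (auto simp: R_def)
    ultimately show ?thesis using fR by blast
  qed
  let ?N = "{card S |S. finite S \<and> S \<subseteq> carrier Q \<and> group_independent Q S}"
  have "finite ?N" by (rule finite_subset[of _ "{..dim (\<iota> ` Z) - dim (\<iota> ` B)}"]) (use upper in auto)
  then show "group_rank Q = dim (\<iota> ` Z) - dim (\<iota> ` B)"
    unfolding group_rank_def by (rule Max_eqI) (use upper lower in \<open>auto, metis\<close>)
qed

lemma trivial_group_quotient: "trivial_group Q \<longleftrightarrow> Z \<subseteq> B"
proof
  assume t: "trivial_group Q"
  show "Z \<subseteq> B"
  proof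
    fix z assume z: "z \<in> Z"
    then have "cl z \<in> carrier Q" using carrier_Q by blast
    then have "cl z = \<one>\<^bsub>Q\<^esub>" using t by (simp add: trivial_group_def)
    then show "z \<in> B" using cl_eq_one_iff[OF z] by blast
  qed
next
  assume s: "Z \<subseteq> B"
  have "carrier Q = {\<one>\<^bsub>Q\<^esub>}"
    unfolding carrier_Q using s cl_eq_one_iff add_subgroupD(1)[OF Z] by (auto simp: image_iff) 
  then show "trivial_group Q" by (simp add: trivial_group_def)
qed

text \<open>An element of \<open>Z\<close> that lies in the real span of \<open>B\<close> has a nonzero multiple in \<open>B\<close>, since otherwise it
  would be independent modulo \<open>B\<close>. Therefore the torsion subgroup is \<open>P / B\<close>, and its order is an index
  of lattices of equal rank.\<close>

theorem card_torsion_subgroup: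
  assumes P: "\<And>z. z \<in> P \<longleftrightarrow> z \<in> Z \<and> \<iota> z \<in> span (\<iota> ` B)"
    and ps: "lattice_basis (\<iota> ` P) ps"
    and bs: "lattice_basis (\<iota> ` B) bs"
  shows "real (card (torsion_subgroup Q)) = \<bar>coord_det ps bs\<bar>" "length ps = length bs"
proof -
  have p: "distinct ps" "independent (set ps)" "\<iota> ` P = int_comb (set ps)" using ps by (auto simp: lattice_basis_iff)
  have BP: "B \<subseteq> P" using P BZ by (auto intro: span_base)
  have span_eq: "span (\<iota> ` P) = span (\<iota> ` B)"
  proof
    show "span (\<iota> ` P) \<subseteq> span (\<iota> ` B)" by (rule span_minimal) (use P in auto)
    show "span (\<iota> ` B) \<subseteq> span (\<iota> ` P)" using BP by (intro span_mono) auto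
  qed
  show len: "length ps = length bs"
    using lattice_image(2)[OF bs] span_eq span_int_comb[OF p(2)] p by (metis dim_span dim_span_eq_card_independent distinct_card)
  have torsion_iff: "z \<in> P \<longleftrightarrow> z \<in> Z \<and> (\<exists>n::nat. n > 0 \<and> int n *s z \<in> B)" for z
  proof
    assume z: "z \<in> P"
    have "\<exists>m::int. m \<noteq> 0 \<and> m *s z \<in> B"
    proof (rule ccontr)
      assume no: "\<not> ?thesis"
      have "family_independent (case_sum \<iota> (\<lambda>j. bs ! j)) (Inl ` {z} \<union> Inr ` {..<length bs})" (is "family_independent ?v ?I")
        by (rule independent_mod[OF _ _ bs]) (use no in auto)
      then have v: "inj_on ?v ?I" "independent (?v ` ?I)" by (auto simp: family_independent_iff)
      have "?v ` ?I \<subseteq> span (\<iota> ` B)"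
        using z P lattice_image(3)[OF bs] span_superset[of "\<iota> ` B"] nth_mem[of _ bs] by fastforce
      then have "card (?v ` ?I) \<le> dim (\<iota> ` B)" using independent_card_le_dim[OF _ v(2)] by (metis dim_span)
      moreover have "card (?v ` ?I) = Suc (length bs)"
        by (subst card_image[OF v(1)], subst card_Un_disjoint) (auto simp: card_image)
      ultimately show False using lattice_image(2)[OF bs] by simp
    qed
    then obtain m :: int where m: "m \<noteq> 0" "m *s z \<in> B" by blast
    have "(- m) *s z = - (m *s z)" by (simp add: cvec_eq_iff)
    then have "int (nat \<bar>m\<bar>) *s z \<in> B" using m add_subgroupD(3)[OF B m(2)] by (cases "m \<ge> 0") auto
    then show "z \<in> Z \<and> (\<exists>n::nat. n > 0 \<and> int n *s z \<in> B)"
      using z P m(1) by (intro conjI exI[of _ "nat \<bar>m\<bar>"]) auto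
  next
    assume z: "z \<in> Z \<and> (\<exists>n::nat. n > 0 \<and> int n *s z \<in> B)"
    then obtain n :: nat where n: "n > 0" "int n *s z \<in> B" by blast
    have "\<iota> z = (1 / real n) *\<^sub>R \<iota> (int n *s z)" using n(1) by (simp add: int_chain_to_real_scale)
    also have "\<dots> \<in> span (\<iota> ` B)" using n(2) by (intro span_scale span_base) auto
    finally show "z \<in> P" using P z by blast
  qed
  have tors: "torsion_subgroup Q = cl ` P"
  proof -
    have "cl z [^]\<^bsub>Q\<^esub> n = \<one>\<^bsub>Q\<^esub> \<longleftrightarrow> int n *s z \<in> B" if "z \<in> Z" for z and n :: nat
      using cl_int_pow[OF that, of "int n"] cl_eq_one_iff[OF add_subgroup_scale[OF Z that]] by (simp add: int_pow_int)
    then have "{x \<in> cl ` Z. \<exists>n::nat. n > 0 \<and> x [^]\<^bsub>Q\<^esub> n = \<one>\<^bsub>Q\<^esub>}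
        = cl ` {z \<in> Z. \<exists>n::nat. n > 0 \<and> int n *s z \<in> B}"
      by blast
    also have "{z \<in> Z. \<exists>n::nat. n > 0 \<and> int n *s z \<in> B} = P" using torsion_iff by blast
    finally show ?thesis unfolding torsion_subgroup_def carrier_Q .
  qed
  have "\<iota> ` B \<subseteq> \<iota> ` P" using BP by blast
  then obtain R where R: "finite R" "transversal (\<iota> ` P) (\<iota> ` B) R" "real (card R) = \<bar>coord_det ps bs\<bar>"
    using lattice_index[OF ps bs] len by metis
  define S where "S = {z \<in> P. \<iota> z \<in> R}"
  have imS: "\<iota> ` S = R" using R(2) by (auto simp: S_def transversal_def)
  have "bij_betw cl S (cl ` P)"
    unfolding bij_betw_def
  proof
    have PZ: "z \<in> Z" if "z \<in> P" for z using that P by blast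
    have uni: "\<exists>!r. r \<in> R \<and> \<iota> z - r \<in> \<iota> ` B" if "z \<in> P" for z using R(2) that by (auto simp: transversal_def)
    have diff: "\<iota> x - \<iota> y \<in> \<iota> ` B \<longleftrightarrow> x - y \<in> B" for x y
      unfolding int_chain_to_real_diff[symmetric] by auto
    show "inj_on cl S"
    proof (rule inj_onI)
      fix x y assume xy: "x \<in> S" "y \<in> S" "cl x = cl y"
      then have "x - y \<in> B" using cl_eq_iff PZ by (auto simp: S_def)
      moreover have "x - x \<in> B" using add_subgroupD(1)[OF B] by simp
      ultimately have "\<iota> x - \<iota> y \<in> \<iota> ` B" "\<iota> x - \<iota> x \<in> \<iota> ` B" using diff by blast+
      moreover have "x \<in> P" "\<iota> x \<in> R" "\<iota> y \<in> R" using xy(1,2) by (simp_all add: S_def)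
      moreover obtain r where "\<And>s. s \<in> R \<and> \<iota> x - s \<in> \<iota> ` B \<Longrightarrow> s = r" using uni[OF \<open>x \<in> P\<close>] by (elim ex1E) blast
      ultimately have "\<iota> x = \<iota> y" by metis
      then show "x = y" by simp
    qed
    show "cl ` S = cl ` P"
    proof
      show "cl ` P \<subseteq> cl ` S"
      proof
        fix c assume "c \<in> cl ` P"
        then obtain z where z: "z \<in> P" "c = cl z" by blast
        then obtain r where r: "r \<in> R" "\<iota> z - r \<in> \<iota> ` B" using uni by blast
        then obtain s where s: "s \<in> S" "r = \<iota> s" using imS by blast
        then have "cl z = cl s" using r diff cl_eq_iff PZ z by (auto simp: S_def)
        then show "c \<in> cl ` S" using s z by blast
      qed
    qed (auto simp: S_def)
  qed
  then have "card (cl ` P) = card S" by (simp add: bij_betw_same_card)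
  also have "\<dots> = card R" using card_image[OF inj_int_chain_to_real, of S] imS by simp
  finally show "real (card (torsion_subgroup Q)) = \<bar>coord_det ps bs\<bar>" using R(3) tors by simp
qed

end

section \<open>Spanning trees as sets of top-dimensional cells\<close>

lemma restrict_cw_simps [simp]:
  "cells (restrict_cw X T) = T" "cdim (restrict_cw X T) = cdim X" "chmap (restrict_cw X T) = chmap X"
  by (simp_all add: restrict_cw_def)

lemma incidence_restrict_cw [simp]: "incidence (restrict_cw X T) = incidence X"
  by (simp add: incidence_def cell_pinch_def open_cell_def fun_eq_iff o_def cong: if_cong)

lemma chain_complex_restrict_cells:
  "chains (restrict_cw X (cells X)) k = (chains X k :: ('r::comm_ring_1 ^ 'c::finite) set)"
  "boundary_map (restrict_cw X (cells X)) = (boundary_map X :: 'r ^ 'c \<Rightarrow> 'r ^ 'c)"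
  by (auto simp: chains_def cells_of_dim_def boundary_map_def fun_eq_iff)

text \<open>The dimension is \<open>n + 1\<close>, so that the boundaries in question live in degree \<open>n\<close>.\<close>

locale top_cells =
  fixes X :: "('a, 'c::finite) cw" and n :: nat
  assumes fin_cw: "finite_cw_complex X" and dim_cw: "has_cw_dim X (Suc n)"
begin

sublocale finite_cw X by (unfold_locales) (rule fin_cw)

definition E :: "'c set" where "E = cells_of_dim X (Suc n)"

definition cell_boundary :: "'c \<Rightarrow> int ^ 'c" where
  "cell_boundary e = (\<chi> \<tau>. if \<tau> \<in> cells X then incidence X e \<tau> else 0)"

definition real_boundary :: "'c \<Rightarrow> real ^ 'c" where
  "real_boundary e = \<iota> (cell_boundary e)"

definition Bd :: "'c set \<Rightarrow> (int ^ 'c) set" where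
  "Bd S = {\<Sum>e\<in>S. c e *s cell_boundary e |c. True}"

lemma E_cells: "E \<subseteq> cells X" by (auto simp: E_def cells_of_dim_def)

lemma lower_cells: "cells X - E = {\<sigma> \<in> cells X. cdim X \<sigma> \<le> n}"
  using dim_cw by (auto simp: E_def cells_of_dim_def has_cw_dim_def le_Suc_eq)

lemma chains_restrict_top:
  assumes "cells X - E \<subseteq> T" "T \<subseteq> cells X"
  shows "chains (restrict_cw X T) (Suc n) = {x. \<forall>\<sigma>. \<sigma> \<notin> T \<inter> E \<longrightarrow> vec_nth x \<sigma> = 0}"
  using assms by (auto simp: chains_def cells_of_dim_def E_def)

lemma boundary_map_restrict_top:
  fixes x :: "'r::comm_ring_1 ^ 'c"
  assumes T: "cells X - E \<subseteq> T" "T \<subseteq> cells X" and x: "x \<in> chains (restrict_cw X T) (Suc n)"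
  shows "vec_nth (boundary_map (restrict_cw X T) x) \<tau> = (\<Sum>e\<in>T \<inter> E. of_int (vec_nth (cell_boundary e) \<tau>) * vec_nth x e)"
proof (cases "\<tau> \<in> T")
  case True
  then have "vec_nth (boundary_map (restrict_cw X T) x) \<tau> = (\<Sum>\<sigma>\<in>T. of_int (incidence X \<sigma> \<tau>) * vec_nth x \<sigma>)"
    by (simp add: boundary_map_def)
  also have "\<dots> = (\<Sum>\<sigma>\<in>T \<inter> E. of_int (incidence X \<sigma> \<tau>) * vec_nth x \<sigma>)"
  proof (rule sum.mono_neutral_right)
    have "vec_nth x \<sigma> = 0" if "\<sigma> \<notin> T \<inter> E" for \<sigma>
      using x that unfolding chains_restrict_top[OF T] by blast
    then show "\<forall>\<sigma>\<in>T - T \<inter> E. of_int (incidence X \<sigma> \<tau>) * vec_nth x \<sigma> = 0" by auto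
  qed auto
  finally show ?thesis using True T by (auto simp: cell_boundary_def)
next
  case False
  have "vec_nth (cell_boundary e) \<tau> = 0" if "e \<in> E" for e
  proof (cases "\<tau> \<in> cells X")
    case True
    then have "\<tau> \<in> E" using False T by blast
    then show ?thesis using that by (simp add: cell_boundary_def incidence_def E_def cells_of_dim_def)
  qed (simp add: cell_boundary_def)
  then show ?thesis using False by (simp add: boundary_map_def)
qed

lemma boundaries_restrict:
  assumes T: "cells X - E \<subseteq> T" "T \<subseteq> cells X"
  shows "boundaries (restrict_cw X T) n = Bd (T \<inter> E)"
proof -
  have bm: "boundary_map (restrict_cw X T) x = (\<Sum>e\<in>T \<inter> E. vec_nth x e *s cell_boundary e)"
    if "x \<in> chains (restrict_cw X T) (Suc n)" for x :: "int ^ 'c"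
    using boundary_map_restrict_top[OF T that] by (simp add: cvec_eq_iff mult.commute)
  show ?thesis
  proof (intro equalityI subsetI)
    fix y :: "int ^ 'c" assume "y \<in> boundaries (restrict_cw X T) n"
    then show "y \<in> Bd (T \<inter> E)" using bm by (auto simp: boundaries_def Bd_def)
  next
    fix y assume "y \<in> Bd (T \<inter> E)"
    then obtain c where y: "y = (\<Sum>e\<in>T \<inter> E. c e *s cell_boundary e)" by (auto simp: Bd_def)
    define x :: "int ^ 'c" where "x = (\<chi> e. if e \<in> T \<inter> E then c e else 0)"
    have "x \<in> chains (restrict_cw X T) (Suc n)" unfolding chains_restrict_top[OF T] by (simp add: x_def)
    moreover have "y = boundary_map (restrict_cw X T) x"
      unfolding bm[OF calculation] y by (intro sum.cong) (auto simp: x_def)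
    ultimately show "y \<in> boundaries (restrict_cw X T) n" by (auto simp: boundaries_def)
  qed
qed

lemma boundaries_eq: "boundaries X n = Bd E"
  using boundaries_restrict[of "cells X"] E_cells chain_complex_restrict_cells[where 'r = int, of X]
  by (simp add: boundaries_def inf.absorb2)

lemma boundary_map_real:
  assumes x: "x \<in> chains X (Suc n)"
  shows "boundary_map X x = (\<Sum>e\<in>E. vec_nth x e *\<^sub>R real_boundary e)"
  using boundary_map_restrict_top[of "cells X" x] E_cells x chain_complex_restrict_cells[where 'r = real, of X]
  by (simp add: cvec_eq_iff inf.absorb2 real_boundary_def mult.commute)

lemma chains_top: "chains X (Suc n) = {x. \<forall>\<sigma>. \<sigma> \<notin> E \<longrightarrow> vec_nth x \<sigma> = 0}"
  by (simp add: chains_def E_def)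

lemma boundaries_real: "(boundaries X n :: (real ^ 'c) set) = span (real_boundary ` E)"
proof
  have "boundary_map X x \<in> span (real_boundary ` E)" if "x \<in> chains X (Suc n)" for x :: "real ^ 'c"
    unfolding boundary_map_real[OF that] by (intro span_sum span_scale span_base) auto
  then show "(boundaries X n :: (real ^ 'c) set) \<subseteq> span (real_boundary ` E)" by (auto simp: boundaries_def)
  have lin: "boundary_map X (x + y) = boundary_map X x + boundary_map X y"
    "boundary_map X (a *\<^sub>R x) = a *\<^sub>R boundary_map X x" for x y :: "real ^ 'c" and a
    by (auto simp: cvec_eq_iff boundary_map_def algebra_simps sum.distrib sum_distrib_left)
  show "span (real_boundary ` E) \<subseteq> boundaries X n"
  proof (rule span_minimal)
    show "real_boundary ` E \<subseteq> boundaries X n"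
    proof safe
      fix e assume e: "e \<in> E"
      have a: "axis e 1 \<in> (chains X (Suc n) :: (real ^ 'c) set)" using e by (auto simp: chains_top axis_def)
      have "boundary_map X (axis e 1) = (\<Sum>f\<in>E. if f = e then real_boundary f else 0)"
        unfolding boundary_map_real[OF a] by (intro sum.cong) (auto simp: axis_def)
      also have "\<dots> = real_boundary e" using e by simp
      finally show "real_boundary e \<in> boundaries X n" using a by (force simp: boundaries_def)
    qed
    show "subspace (boundaries X n :: (real ^ 'c) set)"
      unfolding boundaries_def
    proof (rule subspaceI)
      have "0 = boundary_map X (0 :: real ^ 'c)" by (simp add: cvec_eq_iff boundary_map_def)
      moreover have "(0 :: real ^ 'c) \<in> chains X (Suc n)" by (simp add: chains_def)
      ultimately show "(0 :: real ^ 'c) \<in> boundary_map X ` chains X (Suc n)" by blast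
    next
      fix x y :: "real ^ 'c"
      assume "x \<in> boundary_map X ` chains X (Suc n)" "y \<in> boundary_map X ` chains X (Suc n)"
      then obtain u v where "u \<in> chains X (Suc n)" "v \<in> chains X (Suc n)" "x = boundary_map X u" "y = boundary_map X v" by blast
      then show "x + y \<in> boundary_map X ` chains X (Suc n)"
        by (intro image_eqI[of _ _ "u + v"]) (auto simp: lin chains_def)
    next
      fix a and x :: "real ^ 'c"
      assume "x \<in> boundary_map X ` chains X (Suc n)"
      then obtain u where "u \<in> chains X (Suc n)" "x = boundary_map X u" by blast
      then show "a *\<^sub>R x \<in> boundary_map X ` chains X (Suc n)"
        by (intro image_eqI[of _ _ "a *\<^sub>R u"]) (auto simp: lin chains_def)
    qed
  qed
qed

definition Z :: "(int ^ 'c) set" where "Z = cycles X n"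

lemma cycles_restrict:
  assumes T: "cells X - E \<subseteq> T" "T \<subseteq> cells X"
  shows "(cycles (restrict_cw X T) n :: (int ^ 'c) set) = Z"
proof -
  have low: "\<sigma> \<in> T" if "\<sigma> \<in> cells X" "cdim X \<sigma> \<le> n" for \<sigma>
    using T(1) that unfolding lower_cells by blast
  have ch: "chains (restrict_cw X T) n = (chains X n :: (int ^ 'c) set)"
  proof -
    have "cells_of_dim (restrict_cw X T) n = cells_of_dim X n"
      using low T(2) by (auto simp: cells_of_dim_def)
    then show ?thesis by (simp add: chains_def)
  qed
  have "boundary_map (restrict_cw X T) x = boundary_map X x" if x: "x \<in> chains X n" for x :: "int ^ 'c"
  proof (subst cvec_eq_iff, rule allI)
    fix \<tau>
    have x0: "vec_nth x \<sigma> = 0" if "\<sigma> \<notin> {\<sigma> \<in> cells X. cdim X \<sigma> = n}" for \<sigma>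
      using x that by (auto simp: chains_def cells_of_dim_def)
    have s: "(\<Sum>\<sigma>\<in>T. incidence X \<sigma> \<tau> * vec_nth x \<sigma>) = (\<Sum>\<sigma>\<in>cells X. incidence X \<sigma> \<tau> * vec_nth x \<sigma>)"
    proof (rule sum.mono_neutral_left)
      have "vec_nth x \<sigma> = 0" if "\<sigma> \<in> cells X - T" for \<sigma>
        using that low[of \<sigma>] by (intro x0) auto
      then show "\<forall>\<sigma>\<in>cells X - T. incidence X \<sigma> \<tau> * vec_nth x \<sigma> = 0" by simp
    qed (use T(2) in auto)
    have "(\<Sum>\<sigma>\<in>cells X. incidence X \<sigma> \<tau> * vec_nth x \<sigma>) = 0" if "\<tau> \<in> cells X" "\<tau> \<notin> T"
    proof (rule sum.neutral, rule ballI)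
      fix \<sigma>
      have "cdim X \<tau> > n" using low that by force
      then show "incidence X \<sigma> \<tau> * vec_nth x \<sigma> = 0"
        using x0[of \<sigma>] by (cases "cdim X \<sigma> = n") (auto simp: incidence_def)
    qed
    then show "vec_nth (boundary_map (restrict_cw X T) x) \<tau> = vec_nth (boundary_map X x) \<tau>"
      using s T(2) by (auto simp: boundary_map_def)
  qed
  then show ?thesis using ch by (auto simp: cycles_def Z_def)
qed

lemma boundary_map_diff: "boundary_map Y (x - y) = boundary_map Y x - boundary_map Y (y :: int ^ 'c)"
  by (auto simp: cvec_eq_iff boundary_map_def algebra_simps sum_subtractf)

lemma boundary_map_0: "boundary_map Y 0 = (0 :: int ^ 'c)"
  by (simp add: cvec_eq_iff boundary_map_def)

lemma add_subgroup_cycles: "add_subgroup (cycles Y k :: (int ^ 'c) set)"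
  by (auto simp: add_subgroup_def cycles_def chains_def boundary_map_diff boundary_map_0)

lemma add_subgroup_Z: "add_subgroup Z"
  unfolding Z_def by (rule add_subgroup_cycles)

lemma add_subgroup_Bd: "add_subgroup (Bd S)"
  unfolding add_subgroup_def
proof (intro conjI ballI)
  show "0 \<in> Bd S" unfolding Bd_def by (auto intro!: exI[of _ "\<lambda>_. 0"])
  fix x y assume "x \<in> Bd S" "y \<in> Bd S"
  then obtain c c' where xy: "x = (\<Sum>e\<in>S. c e *s cell_boundary e)" "y = (\<Sum>e\<in>S. c' e *s cell_boundary e)"
    by (auto simp: Bd_def)
  have "x - y = (\<Sum>e\<in>S. (c e - c' e) *s cell_boundary e)"
    unfolding xy sum_subtractf[symmetric] by (intro sum.cong) (auto simp: cvec_eq_iff algebra_simps)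
  then show "x - y \<in> Bd S" unfolding Bd_def by (auto intro!: exI[of _ "\<lambda>e. c e - c' e"])
qed

text \<open>This is where the square of the boundary operator has to vanish.\<close>

lemma cell_boundary_cycle:
  assumes e: "e \<in> E"
  shows "cell_boundary e \<in> Z"
proof -
  have "cell_boundary e \<in> chains X n"
    using e by (auto simp: chains_def cell_boundary_def incidence_def cells_of_dim_def E_def)
  moreover have "boundary_map X (cell_boundary e) = 0"
  proof (subst cvec_eq_iff, rule allI)
    fix \<rho>
    show "vec_nth (boundary_map X (cell_boundary e)) \<rho> = vec_nth 0 \<rho>"
      using incidence_incidence[of e \<rho>] e E_cells by (auto simp: boundary_map_def cell_boundary_def mult.commute)
  qed
  ultimately show ?thesis by (simp add: Z_def cycles_def)
qed

lemma Bd_subset_Z: "S \<subseteq> E \<Longrightarrow> Bd S \<subseteq> Z"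
  unfolding Bd_def
  by (auto intro!: add_subgroup_sum[OF add_subgroup_Z] add_subgroup_scale[OF add_subgroup_Z] cell_boundary_cycle)

lemma chain_quotient: "S \<subseteq> E \<Longrightarrow> chain_quotient Z (Bd S)"
  by unfold_locales (use add_subgroup_Z add_subgroup_Bd Bd_subset_Z in auto)

lemma span_Bd: "finite S \<Longrightarrow> span (\<iota> ` Bd S) = span (real_boundary ` S)"
proof
  show "span (\<iota> ` Bd S) \<subseteq> span (real_boundary ` S)"
  proof (rule span_minimal)
    show "\<iota> ` Bd S \<subseteq> span (real_boundary ` S)"
    proof safe
      fix x assume "x \<in> Bd S"
      then obtain c where "x = (\<Sum>e\<in>S. c e *s cell_boundary e)" by (auto simp: Bd_def)
      then have "\<iota> x = (\<Sum>e\<in>S. of_int (c e) *\<^sub>R real_boundary e)"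
        by (simp add: int_chain_to_real_sum int_chain_to_real_scale real_boundary_def)
      then show "\<iota> x \<in> span (real_boundary ` S)"
        by (simp only:) (intro span_sum span_scale span_base imageI)
    qed
  qed simp
  assume S: "finite S"
  show "span (real_boundary ` S) \<subseteq> span (\<iota> ` Bd S)"
  proof (rule span_mono, safe)
    fix e assume e: "e \<in> S"
    have "(\<Sum>f\<in>S. (if f = e then 1 else 0) *s cell_boundary f) = (\<Sum>f\<in>S. if f = e then cell_boundary f else 0)"
      by (intro sum.cong) (auto simp: cvec_eq_iff)
    also have "\<dots> = cell_boundary e" using e S by simp
    finally have "cell_boundary e \<in> Bd S"
      unfolding Bd_def by (intro CollectI exI[of _ "\<lambda>f. if f = e then 1 else 0"]) simp
    then show "real_boundary e \<in> \<iota> ` Bd S" unfolding real_boundary_def by blast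
  qed
qed

text \<open>A spanning tree contains all cells of dimension at most \<open>n\<close> and is thus determined by its set \<open>S\<close> of
  top-dimensional cells. In terms of \<open>S\<close>, vanishing of the top homology says that the boundaries are
  independent, and equality of Betti numbers that they have the same span as all boundaries.\<close>

definition tree :: "'c set \<Rightarrow> bool" where
  "tree S \<longleftrightarrow> S \<subseteq> E \<and> family_independent real_boundary S \<and> span (real_boundary ` S) = span (real_boundary ` E)"

definition \<theta> :: "'c set \<Rightarrow> nat" where
  "\<theta> S = card (torsion_subgroup (additive_group Z Mod Bd S))"

lemma subcomplex_above_skeleton:
  assumes "cells X - E \<subseteq> T" "T \<subseteq> cells X"
  shows "subcomplex X T"
proof -
  have "face_closed X T"
    unfolding face_closed_def
  proof (intro conjI ballI)
    fix \<sigma> assume \<sigma>: "\<sigma> \<in> T"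
    then have "\<sigma> \<in> cells X" using assms by blast
    moreover have "{\<tau> \<in> cells X. cdim X \<tau> < cdim X \<sigma>} \<subseteq> T"
    proof safe
      fix \<tau> assume \<tau>: "\<tau> \<in> cells X" "cdim X \<tau> < cdim X \<sigma>"
      have "cdim X \<sigma> \<le> Suc n" using dim_cw \<open>\<sigma> \<in> cells X\<close> by (auto simp: has_cw_dim_def)
      then have "\<tau> \<in> cells X - E" using \<tau> by (auto simp: lower_cells)
      then show "\<tau> \<in> T" using assms by blast
    qed
    ultimately show "chmap X \<sigma> ` disc_boundary (cdim X \<sigma>) \<subseteq> cell_union X T"
      using attaching_in_lower_cells[of \<sigma>] unfolding cell_union_def by blast
  qed (rule assms)
  then have "closedin (cw_space X) (cell_union X T)" by (rule closedin_face_closed)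
  then show ?thesis using assms by (simp add: subcomplex_def cell_union_def)
qed

lemma homology_restrict:
  assumes T: "cells X - E \<subseteq> T" "T \<subseteq> cells X"
  shows "cellular_homology (restrict_cw X T) n = additive_group Z Mod Bd (T \<inter> E)"
  unfolding cellular_homology_def boundaries_restrict[OF T] cycles_restrict[OF T] ..

lemma homology_eq: "cellular_homology X n = additive_group Z Mod Bd E"
  unfolding cellular_homology_def boundaries_eq Z_def ..

lemma trivial_top_homology_iff:
  assumes T: "cells X - E \<subseteq> T" "T \<subseteq> cells X"
  shows "trivial_group (cellular_homology (restrict_cw X T) (Suc n)) \<longleftrightarrow> family_independent real_boundary (T \<inter> E)"
proof -
  let ?Y = "restrict_cw X T"
  let ?C = "cycles ?Y (Suc n) :: (int ^ 'c) set"
  have ch: "chains ?Y (Suc (Suc n)) = ({0} :: (int ^ 'c) set)"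
  proof -
    have "cells_of_dim ?Y (Suc (Suc n)) = {}"
      using dim_cw T(2) by (fastforce simp: cells_of_dim_def has_cw_dim_def)
    then show ?thesis by (auto simp: chains_def cvec_eq_iff)
  qed
  have B0: "boundaries ?Y (Suc n) = ({0} :: (int ^ 'c) set)"
    unfolding boundaries_def ch by (simp add: boundary_map_0)
  interpret chain_quotient ?C "{0}"
    by unfold_locales (use add_subgroup_cycles[of ?Y] in \<open>auto simp: add_subgroup_def\<close>)
  have "trivial_group (cellular_homology ?Y (Suc n)) \<longleftrightarrow> ?C \<subseteq> {0}"
    unfolding cellular_homology_def B0 by (rule trivial_group_quotient)
  also have "\<dots> \<longleftrightarrow> family_independent real_boundary (T \<inter> E)"
  proof
    assume C0: "?C \<subseteq> {0}"
    show "family_independent real_boundary (T \<inter> E)"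
    proof (rule family_independent_integral)
      fix c :: "'c \<Rightarrow> int" assume s: "(\<Sum>e\<in>T \<inter> E. of_int (c e) *\<^sub>R real_boundary e) = 0"
      define x :: "int ^ 'c" where "x = (\<chi> e. if e \<in> T \<inter> E then c e else 0)"
      have x: "x \<in> chains ?Y (Suc n)" unfolding chains_restrict_top[OF T] by (simp add: x_def)
      have "\<iota> (boundary_map ?Y x) = (\<Sum>e\<in>T \<inter> E. of_int (c e) *\<^sub>R real_boundary e)"
        unfolding cvec_eq_iff int_chain_to_real_nth boundary_map_restrict_top[OF T x]
        by (auto simp: real_boundary_def x_def mult.commute intro!: sum.cong)
      then have "boundary_map ?Y x = 0" using s by (metis int_chain_to_real_0 int_chain_to_real_eq_iff)
      then have "x = 0" using x C0 by (auto simp: cycles_def)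
      moreover have "vec_nth x e = c e" if "e \<in> T \<inter> E" for e using that by (simp add: x_def)
      ultimately show "\<forall>e\<in>T \<inter> E. c e = 0" by (metis zero_index)
    qed (auto simp: real_boundary_def)
  next
    assume f: "family_independent real_boundary (T \<inter> E)"
    show "?C \<subseteq> {0}"
    proof
      fix x assume "x \<in> ?C"
      then have x: "x \<in> chains ?Y (Suc n)" and b: "boundary_map ?Y x = 0" by (auto simp: cycles_def)
      have "(\<Sum>e\<in>T \<inter> E. of_int (vec_nth x e) *\<^sub>R real_boundary e) = \<iota> (boundary_map ?Y x)"
        unfolding cvec_eq_iff int_chain_to_real_nth boundary_map_restrict_top[OF T x]
        by (auto simp: real_boundary_def mult.commute intro!: sum.cong)
      also have "\<dots> = 0" using b by simp
      finally have "\<forall>e\<in>T \<inter> E. real_of_int (vec_nth x e) = 0"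
        by (rule f[unfolded family_independent_def, THEN spec, THEN mp])
      then show "x \<in> {0}" using x unfolding chains_restrict_top[OF T] by (auto simp: cvec_eq_iff)
    qed
  qed
  finally show ?thesis .
qed

text \<open>The two complexes have the same \<open>n\<close>-cycles, so their Betti numbers agree if and only if their
  boundaries have spans of the same dimension; one span contains the other.\<close>

lemma betti_eq_iff:
  assumes T: "cells X - E \<subseteq> T" "T \<subseteq> cells X"
  shows "betti (restrict_cw X T) n = betti X n \<longleftrightarrow> span (real_boundary ` (T \<inter> E)) = span (real_boundary ` E)"
proof -
  let ?S = "T \<inter> E"
  interpret S: chain_quotient Z "Bd ?S" by (rule chain_quotient) auto
  interpret E: chain_quotient Z "Bd E" by (rule chain_quotient) auto
  have dims: "dim (\<iota> ` Bd ?S) = dim (span (real_boundary ` ?S))" "dim (\<iota> ` Bd E) = dim (span (real_boundary ` E))"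
    using span_Bd[of ?S] span_Bd[of E] by (metis dim_span finite)+
  have "betti (restrict_cw X T) n = betti X n \<longleftrightarrow> dim (span (real_boundary ` ?S)) = dim (span (real_boundary ` E))"
    unfolding betti_def homology_restrict[OF T] homology_eq S.group_rank_quotient E.group_rank_quotient
    using S.dim_B_le E.dim_B_le dims by linarith
  also have "\<dots> \<longleftrightarrow> span (real_boundary ` ?S) = span (real_boundary ` E)"
  proof
    assume "dim (span (real_boundary ` ?S)) = dim (span (real_boundary ` E))"
    then show "span (real_boundary ` ?S) = span (real_boundary ` E)"
      by (intro subspace_dim_equal subspace_span span_mono) auto
  qed simp
  finally show ?thesis .
qed

lemma spanning_tree_iff:
  "spanning_tree X (Suc n) T \<longleftrightarrow> cells X - E \<subseteq> T \<and> T \<subseteq> cells X \<and> tree (T \<inter> E)"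
proof (cases "cells X - E \<subseteq> T \<and> T \<subseteq> cells X")
  case True
  then show ?thesis
    using subcomplex_above_skeleton trivial_top_homology_iff betti_eq_iff
    by (simp add: spanning_tree_def tree_def lower_cells[symmetric])
next
  case False
  then show ?thesis by (auto simp: spanning_tree_def subcomplex_def lower_cells[symmetric])
qed

lemma spanning_tree_set: "{T. spanning_tree X (Suc n) T} = (\<lambda>S. (cells X - E) \<union> S) ` {S. tree S}"
proof (intro equalityI subsetI)
  fix T assume "T \<in> {T. spanning_tree X (Suc n) T}"
  then have "cells X - E \<subseteq> T" "T \<subseteq> cells X" "tree (T \<inter> E)" by (auto simp: spanning_tree_iff)
  moreover from this have "T = (cells X - E) \<union> (T \<inter> E)" by blast
  ultimately show "T \<in> (\<lambda>S. (cells X - E) \<union> S) ` {S. tree S}" by blast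
next
  fix T assume "T \<in> (\<lambda>S. (cells X - E) \<union> S) ` {S. tree S}"
  then obtain S where S: "tree S" "T = (cells X - E) \<union> S" by blast
  then have SE: "S \<subseteq> E" by (simp add: tree_def)
  then have "T \<inter> E = S" using S by blast
  then show "T \<in> {T. spanning_tree X (Suc n) T}" using S SE E_cells by (auto simp: spanning_tree_iff)
qed

lemma tree_weight_eq:
  assumes "tree S"
  shows "tree_weight X (Suc n) r ((cells X - E) \<union> S) = (real (\<theta> S))\<^sup>2 * (\<Prod>b\<in>S. inverse (r b))"
proof -
  let ?T = "(cells X - E) \<union> S"
  have SE: "S \<subseteq> E" using assms by (simp add: tree_def)
  then have T: "cells X - E \<subseteq> ?T" "?T \<subseteq> cells X" and TE: "?T \<inter> E = S" using E_cells by auto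
  have "cells_of_dim (restrict_cw X ?T) (Suc n) = S"
    using SE by (auto simp: cells_of_dim_def E_def)
  then show ?thesis
    by (simp add: tree_weight_def torsion_order_def homology_restrict[OF T] TE \<theta>_def)
qed

lemma lattice_basis_tree:
  assumes S: "tree S" and es: "distinct es" "set es = S"
  shows "lattice_basis (\<iota> ` Bd S) (map real_boundary es)"
proof -
  have f: "inj_on real_boundary S" "independent (real_boundary ` S)"
    using S by (auto simp: tree_def family_independent_iff)
  have sum: "(\<Sum>i<length es. of_int (c (es ! i)) *\<^sub>R map real_boundary es ! i) = \<iota> (\<Sum>e\<in>S. c e *s cell_boundary e)"
    for c :: "'c \<Rightarrow> int"
  proof -
    have "(\<Sum>i<length es. of_int (c (es ! i)) *\<^sub>R map real_boundary es ! i) = (\<Sum>i<length es. (\<lambda>e. of_int (c e) *\<^sub>R real_boundary e) (es ! i))"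
      by (intro sum.cong) auto
    also have "\<dots> = (\<Sum>e\<in>S. of_int (c e) *\<^sub>R real_boundary e)" using sum_list_index[OF es(1)] es(2) by simp
    finally show ?thesis by (simp add: int_chain_to_real_sum int_chain_to_real_scale real_boundary_def)
  qed
  have "\<iota> ` Bd S = {\<Sum>i<length (map real_boundary es). of_int (c i) *\<^sub>R map real_boundary es ! i |c :: nat \<Rightarrow> int. True}"
  proof (intro equalityI subsetI)
    fix y assume "y \<in> \<iota> ` Bd S"
    then obtain c where "y = \<iota> (\<Sum>e\<in>S. c e *s cell_boundary e)" by (auto simp: Bd_def)
    then show "y \<in> {\<Sum>i<length (map real_boundary es). of_int (c i) *\<^sub>R map real_boundary es ! i |c :: nat \<Rightarrow> int. True}"
      using sum[of c] by (auto intro!: exI[of _ "\<lambda>i. c (es ! i)"])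
  next
    fix y assume "y \<in> {\<Sum>i<length (map real_boundary es). of_int (c i) *\<^sub>R map real_boundary es ! i |c :: nat \<Rightarrow> int. True}"
    then obtain c :: "nat \<Rightarrow> int" where y: "y = (\<Sum>i<length es. of_int (c i) *\<^sub>R map real_boundary es ! i)" by auto
    define c' where "c' = (\<lambda>e. c (inv_into {..<length es} (\<lambda>i. es ! i) e))"
    have "c' (es ! i) = c i" if "i < length es" for i
      using inv_into_f_f[of "\<lambda>i. es ! i" "{..<length es}" i] that es(1) by (simp add: c'_def inj_on_def nth_eq_iff_index_eq)
    then have "y = \<iota> (\<Sum>e\<in>S. c' e *s cell_boundary e)" unfolding y sum[symmetric] by (intro sum.cong) auto
    then show "y \<in> \<iota> ` Bd S" by (auto simp: Bd_def)
  qed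
  then show ?thesis
    using f es by (auto simp: lattice_basis_def distinct_map)
qed

text \<open>Both torsion subgroups are quotients of the group \<open>P\<close> of cycles in the span of the boundaries, which
  is the same for the tree and for the whole complex. Their orders are determinants of the two
  lattices with respect to a basis of \<open>P\<close>, and the chain rule for changes of basis relates them.\<close>

theorem torsion_quotient:
  assumes bs: "lattice_basis (\<iota> ` Bd E) bs"
    and S: "tree S" and es: "distinct es" "set es = S"
  shows "real (\<theta> S) = real (\<theta> E) * \<bar>coord_det bs (map real_boundary es)\<bar>"
    "length es = length bs" "\<theta> E \<noteq> 0" "coord_det bs (map real_boundary es) \<noteq> 0"
proof -
  let ?cs = "map real_boundary es"
  have SE: "S \<subseteq> E" using S by (simp add: tree_def)
  interpret S: chain_quotient Z "Bd S" by (rule chain_quotient[OF SE])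
  interpret E: chain_quotient Z "Bd E" by (rule chain_quotient) auto
  have cs: "lattice_basis (\<iota> ` Bd S) ?cs" by (rule lattice_basis_tree[OF S es])
  have spanS: "span (\<iota> ` Bd S) = span (\<iota> ` Bd E)" using S span_Bd[of S] span_Bd[of E] by (simp add: tree_def)
  define P where "P = {z \<in> Z. \<iota> z \<in> span (\<iota> ` Bd E)}"
  have "add_subgroup P"
    unfolding add_subgroup_def P_def
    using add_subgroupD[OF add_subgroup_Z] by (auto simp: span_zero int_chain_to_real_diff span_diff)
  then obtain ps where ps: "lattice_basis (\<iota> ` P) ps" using integral_lattice_basis by blast
  have tS: "real (\<theta> S) = \<bar>coord_det ps ?cs\<bar>" "length ps = length ?cs"
    unfolding \<theta>_def by (rule S.card_torsion_subgroup[OF _ ps cs]; simp add: P_def spanS)+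
  have tE: "real (\<theta> E) = \<bar>coord_det ps bs\<bar>" "length ps = length bs"
    unfolding \<theta>_def by (rule E.card_torsion_subgroup[OF _ ps bs]; simp add: P_def)+
  have p: "distinct ps" "independent (set ps)" and b: "distinct bs" "independent (set bs)"
    and c: "distinct ?cs" "independent (set ?cs)"
    using ps bs cs by (auto simp: lattice_basis_def)
  have span_b: "span (set bs) = span (\<iota> ` Bd E)" using E.lattice_image(1)[OF bs] by simp
  have span_c: "span (set ?cs) = span (set bs)" using S.lattice_image(1)[OF cs] spanS span_b by simp
  have span_p: "span (set ps) = span (set bs)"
  proof -
    have "span (set ps) = span (\<iota> ` P)" using ps span_int_comb[OF p(2)] by (simp add: lattice_basis_iff)
    moreover have "span (\<iota> ` P) \<subseteq> span (\<iota> ` Bd E)" by (rule span_minimal) (auto simp: P_def)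
    moreover have "Bd E \<subseteq> P" using E.BZ by (auto simp: P_def intro: span_base)
    ultimately show ?thesis unfolding span_b by (metis image_mono span_mono subset_antisym)
  qed
  show len: "length es = length bs" using tS(2) tE(2) by simp
  have "coord_mat ps ?cs = coord_mat ps bs * coord_mat bs ?cs"
    using span_superset[of "set bs"] span_superset[of "set ?cs"] span_p span_c
    by (intro coord_mat_mult p b) blast+
  then have "coord_det ps ?cs = coord_det ps bs * coord_det bs ?cs"
    using coord_mat_carrier[of ps bs] coord_mat_carrier[of bs ?cs] len tE(2) by (simp add: Determinant.det_mult[of _ "length bs"])
  then show "real (\<theta> S) = real (\<theta> E) * \<bar>coord_det bs ?cs\<bar>"
    using tS tE by (simp add: abs_mult)
  show "\<theta> E \<noteq> 0"
  proof
    assume "\<theta> E = 0"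
    then have "coord_det ps bs = 0" using tE(1) by simp
    then show False using det_coord_mat_inverse[OF p b span_p] by simp
  qed
  show "coord_det bs ?cs \<noteq> 0" using det_coord_mat_inverse[OF b c span_c[symmetric]] by auto
qed

text \<open>A relation among the boundaries of \<open>S\<close> would give a vector in the kernel of the coordinate matrix.\<close>

lemma tree_if_det_nonzero:
  assumes bs: "lattice_basis (\<iota> ` Bd E) bs"
    and S: "S \<subseteq> E" and es: "distinct es" "set es = S" "length es = length bs"
    and det: "coord_det bs (map real_boundary es) \<noteq> 0"
  shows "tree S"
proof -
  let ?N = "coord_mat bs (map real_boundary es)" and ?k = "length bs"
  have N: "?N \<in> carrier_mat ?k ?k" using coord_mat_carrier[of bs "map real_boundary es"] es(3) by simp
  interpret E: chain_quotient Z "Bd E" by (rule chain_quotient) auto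
  have b: "distinct bs" "independent (set bs)" using bs by (auto simp: lattice_basis_def)
  have span_b: "span (set bs) = span (real_boundary ` E)" using E.lattice_image(1)[OF bs] span_Bd[of E] by simp
  have inV: "real_boundary e \<in> span (set bs)" if "e \<in> E" for e unfolding span_b using that by (auto intro: span_base)
  have fam: "family_independent real_boundary S"
    unfolding family_independent_def
  proof (intro allI impI ballI, rule ccontr)
    fix a e assume s: "(\<Sum>e\<in>S. a e *\<^sub>R real_boundary e) = 0" and e: "e \<in> S" and a: "a e \<noteq> 0"
    define v where "v = Matrix.vec ?k (\<lambda>j. a (es ! j))"
    have "?N *\<^sub>v v = 0\<^sub>v ?k"
    proof (rule eq_vecI)
      fix i assume i: "i < dim_vec (0\<^sub>v ?k)"
      have "Matrix.vec_index (?N *\<^sub>v v) i = (\<Sum>j<?k. representation (set bs) (real_boundary (es ! j)) (bs ! i) * a (es ! j))"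
        using i es(3) by (simp add: v_def scalar_prod_def atLeast0LessThan)
      also have "\<dots> = (\<Sum>e\<in>S. representation (set bs) (real_boundary e) (bs ! i) * a e)"
        using sum_list_index[OF es(1), of "\<lambda>e. representation (set bs) (real_boundary e) (bs ! i) * a e"] es by simp
      also have "\<dots> = representation (set bs) (\<Sum>e\<in>S. a e *\<^sub>R real_boundary e) (bs ! i)"
        using inV S by (subst representation_comb[OF b(2)]) (auto simp: mult.commute)
      finally show "Matrix.vec_index (?N *\<^sub>v v) i = Matrix.vec_index (0\<^sub>v ?k) i"
        using i s by (simp add: real_vector.representation_zero)
    qed (simp add: es(3))
    moreover have "v \<in> carrier_vec ?k" by (simp add: v_def)
    moreover have "v \<noteq> 0\<^sub>v ?k"
    proof
      assume v0: "v = 0\<^sub>v ?k"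
      obtain j where j: "j < ?k" "es ! j = e" using e es by (metis in_set_conv_nth)
      then have "Matrix.vec_index v j = a e" by (simp add: v_def)
      then show False using v0 j a by simp
    qed
    ultimately show False using det_0_iff_vec_prod_zero[OF N] det by blast
  qed
  then have f: "inj_on real_boundary S" "independent (real_boundary ` S)" by (auto simp: family_independent_iff)
  have "span (real_boundary ` E) \<subseteq> span (real_boundary ` S)"
  proof (rule card_ge_dim_independent[OF _ f(2)])
    show "real_boundary ` S \<subseteq> span (real_boundary ` E)" using S by (auto intro: span_base)
    have "dim (span (real_boundary ` E)) = length bs"
      unfolding span_b[symmetric] dim_span_eq_card_independent[OF b(2)] using b(1) by (rule distinct_card)
    also have "\<dots> = card (real_boundary ` S)" using card_image[OF f(1)] es distinct_card by metis
    finally show "dim (span (real_boundary ` E)) \<le> card (real_boundary ` S)" by simp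
  qed
  moreover have "span (real_boundary ` S) \<subseteq> span (real_boundary ` E)" using S by (intro span_mono) auto
  ultimately show ?thesis using S fam by (auto simp: tree_def)
qed

end

section \<open>The determinant of the weighted Laplacian\<close>

text \<open>By the Cauchy-Binet formula a Gram determinant is a sum of squares of minors.\<close>

lemma gram_det_nonneg:
  fixes bs :: "(real ^ 'c::finite) list"
  shows "Determinant.det (gram_matrix bs) \<ge> 0"
proof -
  define en :: "'c set \<Rightarrow> 'c list" where "en = (\<lambda>S. SOME xs. distinct xs \<and> set xs = S)"
  have en: "distinct (en S) \<and> set (en S) = S" for S
    unfolding en_def by (rule someI_ex) (use finite_distinct_list[of S] in auto)
  have "gram_matrix bs = Matrix.mat (length bs) (length bs) (\<lambda>(i, j). \<Sum>\<sigma>\<in>UNIV. 1 * vec_nth (bs ! i) \<sigma> * vec_nth (bs ! j) \<sigma>)"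
    by (simp add: gram_matrix_def inner_vec_def)
  then show ?thesis
    using cauchy_binet_weighted[of UNIV "length bs" en "\<lambda>_. 1" "\<lambda>i \<sigma>. vec_nth (bs ! i) \<sigma>"] en
    by (simp add: sum_nonneg)
qed

locale weighted_top_cells = top_cells X n for X :: "('a, 'c::finite) cw" and n +
  fixes r :: "'c \<Rightarrow> real"
  assumes r_pos: "\<And>b. b \<in> cells_of_dim X (Suc n) \<Longrightarrow> r b > 0"
begin

abbreviation "L \<equiv> weighted_laplacian X (Suc n) r"
abbreviation "V \<equiv> span (real_boundary ` E)"

lemma boundary_adjoint_eq:
  "boundary_adjoint X (Suc n) r y = (\<chi> b. if b \<in> E then (real_boundary b \<bullet> y) / r b else 0)" (is "_ = ?z")
  unfolding boundary_adjoint_def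
proof (rule the_equality)
  have inner: "boundary_map X x \<bullet> y = (\<Sum>e\<in>E. vec_nth x e * (real_boundary e \<bullet> y))" if "x \<in> chains X (Suc n)" for x
    unfolding boundary_map_real[OF that] by (simp add: inner_sum_left)
  have mod: "modified_inner r x z = (\<Sum>e\<in>E. r e * vec_nth x e * vec_nth z e)" if "x \<in> chains X (Suc n)" for x z
  proof -
    have "modified_inner r x z = (\<Sum>e\<in>UNIV. r e * vec_nth x e * vec_nth z e)"
      by (simp add: modified_inner_def resistance_map_def inner_vec_def)
    also have "\<dots> = (\<Sum>e\<in>E. r e * vec_nth x e * vec_nth z e)"
      by (rule sum.mono_neutral_right) (use that chains_top in auto)
    finally show ?thesis .
  qed
  have r0: "r e \<noteq> 0" if "e \<in> E" for e using r_pos[of e] that by (auto simp: E_def)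
  show "?z \<in> chains X (Suc n) \<and> (\<forall>x\<in>chains X (Suc n). boundary_map X x \<bullet> y = modified_inner r x ?z)"
    using r0 by (auto simp: chains_top inner mod intro!: sum.cong)
  fix z assume z: "z \<in> chains X (Suc n) \<and> (\<forall>x\<in>chains X (Suc n). boundary_map X x \<bullet> y = modified_inner r x z)"
  have "vec_nth z b = (real_boundary b \<bullet> y) / r b" if b: "b \<in> E" for b
  proof -
    have a: "axis b 1 \<in> chains X (Suc n)" using b by (auto simp: chains_top axis_def)
    have "(\<Sum>e\<in>E. vec_nth (axis b 1) e * (real_boundary e \<bullet> y)) = (\<Sum>e\<in>E. r e * vec_nth (axis b 1) e * vec_nth z e)"
      using z a inner[OF a] mod[OF a, of z] by metis
    moreover have "(\<Sum>e\<in>E. vec_nth (axis b 1) e * (real_boundary e \<bullet> y)) = (\<Sum>e\<in>E. if e = b then real_boundary e \<bullet> y else 0)"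
      by (intro sum.cong) (auto simp: axis_def)
    moreover have "(\<Sum>e\<in>E. r e * vec_nth (axis b 1) e * vec_nth z e) = (\<Sum>e\<in>E. if e = b then r e * vec_nth z e else 0)"
      by (intro sum.cong) (auto simp: axis_def)
    ultimately show ?thesis using b r0[OF b] by (simp add: field_simps)
  qed
  then show "z = ?z" using z by (auto simp: cvec_eq_iff chains_top)
qed

lemma L_eq: "L y = (\<Sum>e\<in>E. (inverse (r e) * (real_boundary e \<bullet> y)) *\<^sub>R real_boundary e)"
proof -
  have c: "boundary_adjoint X (Suc n) r y \<in> chains X (Suc n)"
    unfolding boundary_adjoint_eq by (simp add: chains_top)
  show ?thesis
    unfolding weighted_laplacian_def boundary_map_real[OF c]
    by (auto simp: boundary_adjoint_eq divide_inverse mult.commute intro!: sum.cong)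
qed

lemma linear_L: "linear L"
  by (rule linearI) (simp_all add: L_eq inner_add_right algebra_simps sum.distrib scaleR_sum_right)

lemma L_in_V: "L y \<in> V"
  unfolding L_eq by (intro span_sum span_scale span_base) auto

text \<open>The quadratic form of \<open>L\<close> is \<open>\<Sum>\<^sub>e r\<^sub>e\<inverse> \<langle>\<partial>e, y\<rangle>\<^sup>2\<close>; if it vanishes, then \<open>y\<close> is orthogonal to all
  boundaries, hence to itself.\<close>

lemma L_injective:
  assumes "y \<in> V" "L y = 0"
  shows "y = 0"
proof -
  have rp: "inverse (r e) > 0" if "e \<in> E" for e using r_pos[of e] that by (simp add: E_def)
  have "(\<Sum>e\<in>E. inverse (r e) * (real_boundary e \<bullet> y)\<^sup>2) = L y \<bullet> y"
    unfolding L_eq by (simp add: inner_sum_left power2_eq_square mult.assoc)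
  also have "\<dots> = 0" using assms by simp
  finally have s0: "(\<Sum>e\<in>E. inverse (r e) * (real_boundary e \<bullet> y)\<^sup>2) = 0" .
  have "\<forall>e\<in>E. inverse (r e) * (real_boundary e \<bullet> y)\<^sup>2 = 0"
  proof (rule sum_nonneg_eq_0_iff[THEN iffD1, OF _ _ s0])
    show "0 \<le> inverse (r e) * (real_boundary e \<bullet> y)\<^sup>2" if "e \<in> E" for e
      using rp[OF that] by (intro mult_nonneg_nonneg) auto
  qed simp
  then have orth: "real_boundary e \<bullet> y = 0" if "e \<in> E" for e using that rp[OF that] by auto
  have "V \<subseteq> {v. v \<bullet> y = 0}"
    by (rule span_minimal) (use orth in \<open>auto intro!: subspaceI simp: inner_add_left\<close>)
  then have "y \<bullet> y = 0" using assms(1) by blast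
  then show ?thesis by simp
qed

lemma bij_L: "bij_betw L V V"
proof -
  have inj: "inj_on L V"
  proof (rule inj_onI)
    fix x y assume xy: "x \<in> V" "y \<in> V" "L x = L y"
    then have "L (x - y) = 0" using linear_diff[OF linear_L] by simp
    then have "x - y = 0" using L_injective[of "x - y"] xy by (simp add: span_diff)
    then show "x = y" by simp
  qed
  have "L ` V = V"
  proof (rule subspace_dim_equal)
    show "subspace (L ` V)" using linear_subspace_image[OF linear_L] by simp
    show "subspace V" by simp
    show "L ` V \<subseteq> V" using L_in_V by blast
    have "dim (L ` V) = dim V"
      by (rule dim_image_eq[OF linear_L]) (simp only: span_span inj)
    then show "dim V \<le> dim (L ` V)" by simp
  qed
  then show ?thesis using inj by (simp add: bij_betw_def)
qed

text \<open>In a lattice basis, \<open>L\<close> has the matrix \<open>A * G\<close> with \<open>G\<close> the Gram matrix and \<open>A = M D M\<^sup>T\<close>. The nonzero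
  terms of the Cauchy-Binet expansion of \<open>det A\<close> belong to the trees.\<close>

theorem laplacian_det:
  shows "mu X (Suc n) \<in> \<nat>"
    and "endo_det V L = gamma X (Suc n) * (\<Sum>T | spanning_tree X (Suc n) T. tree_weight X (Suc n) r T)"
proof -
  interpret E: chain_quotient Z "Bd E" by (rule chain_quotient) auto
  \<comment> \<open>The basis that enters the definition of the covolume, so that \<open>mu\<close> is its Gram determinant.\<close>
  define bs where "bs = (SOME bs. lattice_basis (\<iota> ` Bd E) bs)"
  have bs: "lattice_basis (\<iota> ` Bd E) bs"
    unfolding bs_def using integral_lattice_basis[OF add_subgroup_Bd] by (rule someI_ex)
  let ?k = "length bs" and ?G = "gram_matrix bs"
  have b: "distinct bs" "independent (set bs)" "\<iota> ` Bd E = int_comb (set bs)" using bs by (auto simp: lattice_basis_iff)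
  have span_b: "span (set bs) = V" using E.lattice_image(1)[OF bs] span_Bd[of E] by simp
  have G: "?G \<in> carrier_mat ?k ?k" by (simp add: gram_matrix_def)
  have mu: "mu X (Suc n) = Determinant.det ?G"
    using gram_det_nonneg[of bs] by (simp add: mu_def covolume_def boundaries_eq bs_def)
  have "Determinant.det ?G \<in> \<int>"
  proof (rule det_Ints)
    fix i j assume "i < dim_row ?G" "j < dim_row ?G"
    then have ij: "i < ?k" "j < ?k" by (simp_all add: gram_matrix_def)
    then obtain x y where "bs ! i = \<iota> x" "bs ! j = \<iota> y" using E.lattice_image(3)[OF bs] by (meson imageE nth_mem subsetD)
    then show "?G $$ (i, j) \<in> \<int>" using ij by (auto simp: gram_matrix_def inner_vec_def intro!: Ints_sum)
  qed
  then show "mu X (Suc n) \<in> \<nat>"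
    using gram_det_nonneg[of bs] unfolding mu by (metis Ints_cases Nats_altdef2 mem_Collect_eq of_int_0_le_iff Ints_of_int)
  define M where "M = (\<lambda>i e. representation (set bs) (real_boundary e) (bs ! i))"
  define w where "w = (\<lambda>e. inverse (r e))"
  define A where "A = Matrix.mat ?k ?k (\<lambda>(i, j). \<Sum>e\<in>E. w e * M i e * M j e)"
  have A: "A \<in> carrier_mat ?k ?k" by (simp add: A_def)
  have inV: "real_boundary e \<in> span (set bs)" if "e \<in> E" for e unfolding span_b using that by (auto intro: span_base)
  have "endo_det V L = coord_det bs (map L bs)"
    by (rule endo_det_eq[OF linear_L]) (use L_in_V b span_b in \<open>auto simp: ordered_basis_def\<close>)
  also have "coord_mat bs (map L bs) = A * ?G"
  proof (rule eq_matI)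
    fix i j assume "i < dim_row (A * ?G)" "j < dim_col (A * ?G)"
    then have ij: "i < ?k" "j < ?k" by (simp_all add: A_def gram_matrix_def)
    have "representation (set bs) (L (bs ! j)) (bs ! i) = (\<Sum>e\<in>E. w e * (real_boundary e \<bullet> bs ! j) * M i e)"
      unfolding L_eq M_def w_def by (rule representation_comb[OF b(2)]) (use inV in auto)
    also have "\<dots> = (\<Sum>e\<in>E. w e * (\<Sum>l<?k. M l e * (bs ! l \<bullet> bs ! j)) * M i e)"
    proof (intro sum.cong refl)
      fix e assume e: "e \<in> E"
      have "real_boundary e \<bullet> bs ! j = (\<Sum>l<?k. M l e *\<^sub>R bs ! l) \<bullet> bs ! j"
        unfolding M_def sum_representation_list[OF b(1,2) inV[OF e]] ..
      then show "w e * (real_boundary e \<bullet> bs ! j) * M i e = w e * (\<Sum>l<?k. M l e * (bs ! l \<bullet> bs ! j)) * M i e"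
        by (simp add: inner_sum_left)
    qed
    also have "\<dots> = (\<Sum>e\<in>E. \<Sum>l<?k. w e * M i e * M l e * (bs ! l \<bullet> bs ! j))"
      by (simp add: sum_distrib_left sum_distrib_right mult_ac)
    also have "\<dots> = (\<Sum>l<?k. (\<Sum>e\<in>E. w e * M i e * M l e) * (bs ! l \<bullet> bs ! j))"
      by (subst sum.swap) (simp add: sum_distrib_right)
    also have "\<dots> = (A * ?G) $$ (i, j)"
      using ij by (simp add: A_def gram_matrix_def scalar_prod_def atLeast0LessThan)
    finally show "coord_mat bs (map L bs) $$ (i, j) = (A * ?G) $$ (i, j)" using ij by simp
  qed (simp_all add: A_def gram_matrix_def)
  also have "Determinant.det (A * ?G) = Determinant.det A * mu X (Suc n)"
    unfolding mu using Determinant.det_mult[OF A G] .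
  finally have det: "endo_det V L = Determinant.det A * mu X (Suc n)" .
  define en :: "'c set \<Rightarrow> 'c list" where "en = (\<lambda>S. SOME xs. distinct xs \<and> set xs = S)"
  have en: "distinct (en S)" "set (en S) = S" for S
    using someI_ex[OF finite_distinct_list[of S, simplified], of] unfolding en_def
    by (metis (mono_tags, lifting) finite finite_distinct_list someI_ex)+
  have len_en: "length (en S) = card S" for S using en[of S] distinct_card by metis
  define N where "N = (\<lambda>S. coord_det bs (map real_boundary (en S)))"
  have "Determinant.det A = (\<Sum>S | S \<subseteq> E \<and> card S = ?k. (\<Prod>e\<in>S. w e) * (Determinant.det (Matrix.mat ?k ?k (\<lambda>(i, j). M i (en S ! j))))\<^sup>2)"
    unfolding A_def by (rule cauchy_binet_weighted) (use en in auto)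
  also have "\<dots> = (\<Sum>S | S \<subseteq> E \<and> card S = ?k. (\<Prod>e\<in>S. w e) * (N S)\<^sup>2)"
  proof (intro sum.cong refl)
    fix S assume "S \<in> {S. S \<subseteq> E \<and> card S = ?k}"
    then have "length (en S) = ?k" using len_en by simp
    then have "Matrix.mat ?k ?k (\<lambda>(i, j). M i (en S ! j)) = coord_mat bs (map real_boundary (en S))"
      by (intro eq_matI) (auto simp: M_def)
    then show "(\<Prod>e\<in>S. w e) * (Determinant.det (Matrix.mat ?k ?k (\<lambda>(i, j). M i (en S ! j))))\<^sup>2 = (\<Prod>e\<in>S. w e) * (N S)\<^sup>2"
      by (simp add: N_def)
  qed
  also have "\<dots> = (\<Sum>S | tree S. (\<Prod>e\<in>S. w e) * (N S)\<^sup>2)"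
  proof (rule sum.mono_neutral_right)
    show "{S. tree S} \<subseteq> {S. S \<subseteq> E \<and> card S = ?k}"
      using torsion_quotient(2)[OF bs _ en] len_en by (auto simp: tree_def)
    show "\<forall>S\<in>{S. S \<subseteq> E \<and> card S = ?k} - {S. tree S}. (\<Prod>e\<in>S. w e) * (N S)\<^sup>2 = 0"
      using tree_if_det_nonzero[OF bs _ en] len_en by (auto simp: N_def)
  qed simp
  also have "\<dots> = (\<Sum>S | tree S. (real (\<theta> S))\<^sup>2 * (\<Prod>e\<in>S. w e) / (real (\<theta> E))\<^sup>2)"
  proof (intro sum.cong refl)
    fix S assume "S \<in> {S. tree S}"
    then have S: "tree S" by simp
    have "(real (\<theta> S))\<^sup>2 = (real (\<theta> E))\<^sup>2 * (N S)\<^sup>2"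
      unfolding N_def torsion_quotient(1)[OF bs S en] by (simp add: power_mult_distrib)
    then show "(\<Prod>e\<in>S. w e) * (N S)\<^sup>2 = (real (\<theta> S))\<^sup>2 * (\<Prod>e\<in>S. w e) / (real (\<theta> E))\<^sup>2"
      using torsion_quotient(3)[OF bs S en] by (simp add: field_simps)
  qed
  also have "\<dots> = (\<Sum>S | tree S. tree_weight X (Suc n) r ((cells X - E) \<union> S)) / (real (\<theta> E))\<^sup>2"
    unfolding sum_divide_distrib by (intro sum.cong refl) (simp add: tree_weight_eq w_def)
  also have "(\<Sum>S | tree S. tree_weight X (Suc n) r ((cells X - E) \<union> S)) = (\<Sum>T | spanning_tree X (Suc n) T. tree_weight X (Suc n) r T)"
    unfolding spanning_tree_set
    by (rule sum.reindex[symmetric, unfolded o_def]) (auto simp: inj_on_def tree_def)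
  finally have detA: "Determinant.det A = (\<Sum>T | spanning_tree X (Suc n) T. tree_weight X (Suc n) r T) / (real (\<theta> E))\<^sup>2" .
  have "gamma X (Suc n) = mu X (Suc n) / (real (\<theta> E))\<^sup>2"
    by (simp add: gamma_def torsion_order_def homology_eq \<theta>_def)
  then show "endo_det V L = gamma X (Suc n) * (\<Sum>T | spanning_tree X (Suc n) T. tree_weight X (Suc n) r T)"
    unfolding det detA by simp
qed

end

theorem theorem3:
  fixes X :: "('a, 'c::finite) cw" and d :: nat and r :: "'c \<Rightarrow> real"
  assumes "finite_cw_complex X"
    and "connected_space (cw_space X)"
    and "has_cw_dim X d" and "d \<ge> 1"
    and "\<And>b. b \<in> cells_of_dim X d \<Longrightarrow> r b > 0"
  shows "bij_betw (weighted_laplacian X d r) (boundaries X (d - 1)) (boundaries X (d - 1)) \<and>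
    mu X d \<in> \<nat> \<and>
    endo_det (boundaries X (d - 1)) (weighted_laplacian X d r) =
      gamma X d * (\<Sum>T | spanning_tree X d T. tree_weight X d r T)"
proof -
  obtain n where d: "d = Suc n" using assms(4) by (cases d) auto
  interpret weighted_top_cells X n r
    by unfold_locales (use assms d in auto)
  show ?thesis
    using bij_L laplacian_det by (simp add: d boundaries_real)
qed

end
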